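(* Let $(\Sigma,\mu)$ be a non-atomic $\sigma$-finite measure space with $\mu(\Sigma)>0$, let $\mathcal{B}$ be a Muckenhoupt basis and $\mathcal{F}$ a family of extrapolation pairs. Let $u,v$ be $\mathcal{B}$-weights with $v(B)<\infty$ for every $B\in\mathcal{B}$, and let $\Phi$ be a Young function with $\Phi\in\Delta_2$ (equivalently $I_\Phi<\infty$). Assume that there is $\mathcal{N}<\infty$ such that $$\int_\Sigma\overline{\Phi}((M'_{\mathcal{B},v}h)u^{-1})\,v\,d\mu\le\mathcal{N}\int_\Sigma\overline{\Phi}(|h|u^{-1})\,v\,d\mu,\qquad\forall h\in\mathbb{M}_\mu.$$ If for some $p_0\in(0,\infty)$ and for every $w\in A_{\infty,\mathcal{B}}$, $$\|f\|_{L^{p_0}(\Sigma,w)}\le\Psi([w]_{A_{\infty,\mathcal{B}}})\|g\|_{L^{p_0}(\Sigma,w)},\qquad(f,g)\in\mathcal{F},$$ where $\Psi:[1,\infty)\to[1,\infty)$ is non-decreasing, then for every $p\in(0,\infty)$ there is a constant $C<\infty$ (independent of $(f,g)$) such that $$\int_\Sigma\Phi(f^pu)\,v\,d\mu\le C\,\Psi(2\mathcal{N})^p\int_\Sigma\Phi(g^pu)\,v\,d\mu,\qquad(f,g)\in\mathcal{F},$$ and for every $q\in(0,\infty)$ there is a constant $C<\infty$ such that $$\int_\Sigma\Phi\Big(\Big(\sum_jf_j^q\Big)^{\frac1q}u\Big)v\,d\mu\le C\int_\Sigma\Phi\Big(\Big(\sum_jg_j^q\Big)^{\frac1q}u\B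ig)v\,d\mu,\qquad\{(f_j,g_j)\}_j\subset\mathcal{F}.$$
   Context: Non-atomic: every measurable $F$ with $\mu(F)>0$ contains a measurable $F'$ with $0<\mu(F')<\mu(F)$. A basis $\mathcal{B}$ is a collection of $\mu$-measurable sets with $0<\mu(B)<\infty$; standing assumption: $\mu(\Sigma\setminus\Sigma_{\mathcal{B}})=0$, $\Sigma_{\mathcal{B}}=\bigcup_{B\in\mathcal{B}}B$. $\mathbb{M}_\mu$: $\mu$-measurable functions. $M_{\mathcal{B}}f(x)=\sup_{x\in B\in\mathcal{B}}\frac1{\mu(B)}\int_B|f|\,d\mu$ for $x\in\Sigma_{\mathcal{B}}$, $0$ otherwise; $M'_{\mathcal{B},v}h=M_{\mathcal{B}}(hv)/v$. A $\mathcal{B}$-weight is a $\mu$-measurable $w$ with $0<w<\infty$ $\mu$-a.e.; $v(B)=\int_Bv\,d\mu$; $L^p(\Sigma,w)=L^p(\Sigma,w\,d\mu)$. For $1<p<\infty$, $w\in A_{p,\mathcal{B}}$ iff $[w]_{A_{p,\mathcal{B}}}=\sup_{B}\big(\frac1{\mu(B)}\int_Bw\,d\mu\big)\big(\frac1{\mu(B)}\int_Bw^{1-p'}d\mu\big)^{p-1}<\infty$; $w\in A_{1,\mathcal{B}}$ iff $[w]_{A_{1,\mathcal{B}}}=\|(M_{\mathcal{B}}w)w^{-1}\|_{L^\infty(\Sigma,\mu)}<\infty$; $A_{\infty,\mathcal{B}}=\bigcup_{p\ge1}A_{p,\mathcal{B}}$, $[w]_{A_{\infty,\mathcal{B}}}=\inf_{p:\,w\in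 A_{p,\mathcal{B}}}[w]_{A_{p,\mathcal{B}}}$. $\mathcal{B}$ is a Muckenhoupt basis if for all $p\in(1,\infty)$ and $w\in A_{p,\mathcal{B}}$, $\|M_{\mathcal{B}}f\|_{L^p(\Sigma,w)}\le C\|f\|_{L^p(\Sigma,w)}$. A Young function is a continuous, convex, strictly increasing $\Phi:[0,\infty)\to[0,\infty)$ with $\lim_{t\to0^+}\Phi(t)/t=0$ and $\lim_{t\to\infty}\Phi(t)/t=\infty$ (and $\Phi(\infty)=\infty$). Complementary function: $\overline{\Phi}(t)=\sup_{s>0}\{st-\Phi(s)\}$. $\Phi\in\Delta_2$ means $\Phi(2t)\le C\Phi(t)$ for all $t>0$. $I_\Phi=\lim_{t\to\infty}\frac{\log h_\Phi(t)}{\log t}$ with $h_\Phi(t)=\sup_{s>0}\frac{\Phi(st)}{\Phi(s)}$. A family of extrapolation pairs $\mathcal{F}$ is a collection of pairs $(f,g)$ of nonnegative measurable functions. *)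

theory Defs
  imports "HOL-Analysis.Analysis" "HOL-Probability.Essential_Supremum"
begin

text \<open>
  Nonnegative quantities (weights, maximal functions, extrapolation pairs, integrals) take values in
  \<^typ>\<open>ennreal\<close>; elements of \<open>\<M>\<^sub>\<mu>\<close> are real-valued and enter only through their absolute values.
  The \<open>\<mu>\<close>-measurable sets are those of \<open>sets M\<close>; \<open>M\<close> may, but need not, be complete.
\<close>

text \<open>Powers with a nonzero real exponent; \<open>\<infinity>\<^sup>a = \<infinity>\<close> if \<open>a > 0\<close>, and \<open>0\<^sup>a = \<infinity>\<close>, \<open>\<infinity>\<^sup>a = 0\<close> if \<open>a < 0\<close>.\<close>

definition epowr :: "ennreal \<Rightarrow> real \<Rightarrow> ennreal"  (infixr "epowr" 80) where
  "x epowr a =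
    (let y = (if x = \<infinity> then \<infinity> else ennreal (enn2real x powr \<bar>a\<bar>))
     in if a < 0 then inverse y else y)"

definition Lp_norm :: "'a measure \<Rightarrow> real \<Rightarrow> ('a \<Rightarrow> ennreal) \<Rightarrow> ennreal" where
  "Lp_norm M p f = (\<integral>\<^sup>+x. f x epowr p \<partial>M) epowr (1 / p)"

definition non_atomic :: "'a measure \<Rightarrow> bool" where
  "non_atomic M \<longleftrightarrow>
    (\<forall>F\<in>sets M. 0 < emeasure M F \<longrightarrow>
      (\<exists>F'\<in>sets M. F' \<subseteq> F \<and> 0 < emeasure M F' \<and> emeasure M F' < emeasure M F))"

definition basis :: "'a measure \<Rightarrow> 'a set set \<Rightarrow> bool" where
  "basis M \<B> \<longleftrightarrow>
    \<B> \<subseteq> sets M \<and> (\<forall>B\<in>\<B>. 0 < emeasure M B \<and> emeasure M B < \<infinity>) \<and>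
    space M - \<Union>\<B> \<in> null_sets M"

definition average :: "'a measure \<Rightarrow> 'a set \<Rightarrow> ('a \<Rightarrow> ennreal) \<Rightarrow> ennreal" where
  "average M B f = (\<integral>\<^sup>+x\<in>B. f x \<partial>M) / emeasure M B"

text \<open>
  The argument of the maximal operator is \<open>|f|\<close>.
  In \<^typ>\<open>ennreal\<close> the empty supremum is \<open>0\<close>, which is the prescribed value off \<open>\<Union>\<B>\<close>.
\<close>

definition maximal :: "'a measure \<Rightarrow> 'a set set \<Rightarrow> ('a \<Rightarrow> ennreal) \<Rightarrow> 'a \<Rightarrow> ennreal" where
  "maximal M \<B> f x = (SUP B\<in>{B\<in>\<B>. x \<in> B}. average M B f)"

definition dual_maximal ::
    "'a measure \<Rightarrow> 'a set set \<Rightarrow> ('a \<Rightarrow> ennreal) \<Rightarrow> ('a \<Rightarrow> ennreal) \<Rightarrow> 'a \<Rightarrow> ennreal" where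
  "dual_maximal M \<B> v h x = maximal M \<B> (\<lambda>y. h y * v y) x / v x"

definition weight :: "'a measure \<Rightarrow> ('a \<Rightarrow> ennreal) \<Rightarrow> bool" where
  "weight M w \<longleftrightarrow> w \<in> borel_measurable M \<and> (AE x in M. 0 < w x \<and> w x < \<infinity>)"

definition conj_exponent :: "real \<Rightarrow> real" where
  "conj_exponent p = p / (p - 1)"

text \<open>Meaningful for \<open>1 \<le> p\<close>.\<close>

definition Ap_const :: "'a measure \<Rightarrow> 'a set set \<Rightarrow> real \<Rightarrow> ('a \<Rightarrow> ennreal) \<Rightarrow> ennreal" where
  "Ap_const M \<B> p w =
    (if p = 1 then esssup M (\<lambda>x. maximal M \<B> w x * inverse (w x))
     else (SUP B\<in>\<B>. average M B w *
             average M B (\<lambda>x. w x epowr (1 - conj_exponent p)) epowr (p - 1)))"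

definition Ap :: "'a measure \<Rightarrow> 'a set set \<Rightarrow> real \<Rightarrow> ('a \<Rightarrow> ennreal) set" where
  "Ap M \<B> p = {w. weight M w \<and> Ap_const M \<B> p w < \<infinity>}"

definition Ainf :: "'a measure \<Rightarrow> 'a set set \<Rightarrow> ('a \<Rightarrow> ennreal) set" where
  "Ainf M \<B> = (\<Union>p\<in>{1..}. Ap M \<B> p)"

definition Ainf_const :: "'a measure \<Rightarrow> 'a set set \<Rightarrow> ('a \<Rightarrow> ennreal) \<Rightarrow> ennreal" where
  "Ainf_const M \<B> w = (INF p\<in>{p. 1 \<le> p \<and> w \<in> Ap M \<B> p}. Ap_const M \<B> p w)"

text \<open>
  Boundedness of the maximal operator on \<open>L\<^sup>p(w d\<mu>)\<close>.  The supremum over an uncountable basis need not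
  be measurable, so the measurability implicit in \<open>M\<^sub>\<B> f \<in> L\<^sup>p\<close> is spelled out; for a non-measurable
  function the \<^const>\<open>nn_integral\<close> would only be a lower integral.  The bound may depend on \<open>p\<close> and \<open>w\<close>.
\<close>

definition muckenhoupt_basis :: "'a measure \<Rightarrow> 'a set set \<Rightarrow> bool" where
  "muckenhoupt_basis M \<B> \<longleftrightarrow> basis M \<B> \<and>
    (\<forall>p>1. \<forall>w\<in>Ap M \<B> p. \<exists>C<(\<infinity>::ennreal). \<forall>f::'a \<Rightarrow> real.
      f \<in> borel_measurable M \<and> Lp_norm (density M w) p (\<lambda>x. ennreal \<bar>f x\<bar>) < \<infinity> \<longrightarrow>
      maximal M \<B> (\<lambda>x. ennreal \<bar>f x\<bar>) \<in> borel_measurable M \<and>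
      Lp_norm (density M w) p (maximal M \<B> (\<lambda>x. ennreal \<bar>f x\<bar>))
        \<le> C * Lp_norm (density M w) p (\<lambda>x. ennreal \<bar>f x\<bar>))"

text \<open>Only the values of \<open>\<Phi>\<close> on \<open>[0, \<infinity>)\<close> matter.\<close>

definition young_function :: "(real \<Rightarrow> real) \<Rightarrow> bool" where
  "young_function \<Phi> \<longleftrightarrow>
    \<Phi> \<in> {0..} \<rightarrow> {0..} \<and> continuous_on {0..} \<Phi> \<and> convex_on {0..} \<Phi> \<and> strict_mono_on {0..} \<Phi> \<and>
    ((\<lambda>t. \<Phi> t / t) \<longlongrightarrow> 0) (at_right 0) \<and> filterlim (\<lambda>t. \<Phi> t / t) at_top at_top"

text \<open>The convention \<open>\<Phi>(\<infinity>) = \<infinity>\<close>.\<close>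

definition extend_inf :: "(real \<Rightarrow> real) \<Rightarrow> ennreal \<Rightarrow> ennreal" where
  "extend_inf \<Phi> x = (if x = \<infinity> then \<infinity> else ennreal (\<Phi> (enn2real x)))"

text \<open>For a Young function the supremum is over a set that is bounded above, since \<open>\<Phi>(s)/s \<rightarrow> \<infinity>\<close>.\<close>

definition complementary :: "(real \<Rightarrow> real) \<Rightarrow> real \<Rightarrow> real" where
  "complementary \<Phi> t = (SUP s\<in>{0<..}. s * t - \<Phi> s)"

definition Delta2 :: "(real \<Rightarrow> real) \<Rightarrow> bool" where
  "Delta2 \<Phi> \<longleftrightarrow> (\<exists>C. \<forall>t>0. \<Phi> (2 * t) \<le> C * \<Phi> t)"

definition extrapolation_family ::
    "'a measure \<Rightarrow> (('a \<Rightarrow> ennreal) \<times> ('a \<Rightarrow> ennreal)) set \<Rightarrow> bool" where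
  "extrapolation_family M \<F> \<longleftrightarrow>
    (\<forall>(f, g)\<in>\<F>. f \<in> borel_measurable M \<and> g \<in> borel_measurable M)"

end

theory Submission
  imports Defs "HOL-Probability.Probability_Measure"
begin

text \<open>
  The proof runs by duality. Young's equality provides a function \<open>h\<close> for which
  \<open>\<integral> \<Phi>(f\<^sup>p u) v \<le> \<integral> f\<^sup>p h v\<close> and whose complementary modular is at most the left-hand side.
  Iterating the dual maximal operator, which the hypothesis bounds in that modular, gives a majorant of \<open>h\<close>
  whose product \<open>w\<close> with \<open>v\<close> is an \<open>A\<^sub>1\<close> weight with constant at most \<open>2\<N>\<close>. If
  \<open>\<integral> f\<^sup>p w \<le> C \<integral> g\<^sup>p w\<close> for all these weights, then Young's inequality with a large parameter
  brings back the modular of \<open>g\<^sup>p u\<close>, multiplied by a constant because of the doubling condition,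
  and a small multiple of the left-hand side, which is absorbed. This is \<open>modular_extrapolation\<close>.

  So the inequality in \<open>L\<^sup>p(w)\<close> is needed for one given \<open>p\<close>, with a constant that depends on the weight only
  through its \<open>A\<^sub>1\<close> constant, whereas the hypothesis is about \<open>p0\<close>. The exponent is changed for weights
  \<open>w\<^sub>1 w\<^sub>2\<^sup>-\<^sup>a\<close> with \<open>A\<^sub>1\<close> factors. It is lowered (\<open>extrapolation_down\<close>) by means of a majorant \<open>H\<close> of
  \<open>g\<close>, a power of which is an \<open>A\<^sub>1\<close> weight, and of the pointwise bound
  \<open>f\<^sup>p \<le> f\<^sup>q H\<^sup>p\<^sup>-\<^sup>q + H\<^sup>p\<close>. It is raised (\<open>extrapolation_up\<close>) by \<open>modular_extrapolation\<close>, for the Young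
  function \<open>\<Phi>(s) = s\<^sup>1\<^sup>+\<^sup>a\<close> and the exponent \<open>p/(1+a)\<close>.

  Both changes rest on a bound for the maximal operator on \<open>L\<^sup>t(w\<^sub>1 w\<^sub>2\<^sup>1\<^sup>-\<^sup>t)\<close> that is uniform in the \<open>A\<^sub>1\<close> weights
  \<open>w\<^sub>1\<close>, \<open>w\<^sub>2\<close> with given constants (\<open>ess_maximal_uniform_bound\<close>). A Muckenhoupt basis gives a bound for each
  weight separately; uniformity comes from Baire's theorem. In the topology of convergence in measure the
  pairs \<open>(w\<^sub>1, w\<^sub>2)\<close> form a complete space, and those with bound \<open>n\<close> form a closed set, so for some \<open>n\<close> this
  set contains a ball around a pair of weights \<open>v\<close>. For any \<open>A\<^sub>1\<close> weight \<open>w\<close> the weight \<open>min(v + w/L, L w)\<close> is again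
  \<open>A\<^sub>1\<close> with the same constant, is comparable to \<open>w\<close> with factor \<open>L\<close>, and is close to \<open>v\<close> in measure
  once \<open>L\<close> is large and \<open>w\<close> is normalised. Normalised weights are tight (\<open>A1_tight\<close>), so that one \<open>L\<close> serves for all of
  them, and the bound \<open>n\<close> in the ball gives a bound for every pair.

  Testing the hypothesis on \<open>c 1\<^sub>B / v\<close> shows \<open>\<N> \<ge> 1\<close>, hence \<open>\<Psi>(2\<N>) \<ge> 1\<close>. For the vector-valued inequality,
  the bounds in \<open>L\<^sup>q(w)\<close> are summed over \<open>j\<close>; this makes the pairs of \<open>\<ell>\<^sup>q\<close> sums an extrapolation family for
  the exponent \<open>q\<close>, and the scalar inequality for \<open>p = 1\<close> applies to it.
\<close>

section \<open>Powers of extended nonnegative reals\<close>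

lemma epowr_ennreal:
  assumes "0 < x"
  shows "ennreal x epowr a = ennreal (x powr a)"
  using assms by (auto simp: epowr_def Let_def inverse_ennreal powr_minus)

lemma epowr_ennreal_nonneg:
  assumes "0 \<le> x" "0 < a"
  shows "ennreal x epowr a = ennreal (x powr a)"
  using assms by (auto simp: epowr_def Let_def)

lemma epowr_top: "0 < a \<Longrightarrow> top epowr a = top"
  by (simp add: epowr_def)

lemma epowr_zero: "0 < a \<Longrightarrow> 0 epowr a = 0"
  by (simp add: epowr_def)

lemma epowr_one: "x epowr 1 = x"
  by (cases x) (auto simp: epowr_ennreal_nonneg epowr_top)

lemma epowr_mono:
  assumes "x \<le> y" "0 < a"
  shows "x epowr a \<le> y epowr a"
  using assms
  by (cases x; cases y) (auto simp: epowr_ennreal_nonneg epowr_top top_unique intro!: ennreal_leI powr_mono2)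

lemma epowr_epowr:
  assumes "0 < a" "0 < b"
  shows "(x epowr a) epowr b = x epowr (a * b)"
  using assms
  by (cases x) (auto simp: epowr_ennreal_nonneg epowr_top powr_powr)

lemma epowr_mult:
  assumes "0 < a"
  shows "(x * y) epowr a = x epowr a * y epowr a"
proof (cases x)
  case (real r)
  show ?thesis
  proof (cases y)
    case (real s)
    then show ?thesis using \<open>x = ennreal r\<close> \<open>0 \<le> r\<close> assms
      by (simp add: epowr_ennreal_nonneg flip: ennreal_mult) (simp add: powr_mult ennreal_mult flip: ennreal_mult)
  next
    case top
    then show ?thesis using real assms
      by (cases "r = 0") (auto simp: epowr_top epowr_zero ennreal_mult_top epowr_ennreal_nonneg)
  qed
next
  case top
  then show ?thesis using assms
    by (cases "y = 0"; cases y) (auto simp: epowr_top epowr_zero ennreal_top_mult epowr_ennreal_nonneg)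
qed

lemma epowr_measurable [measurable]:
  assumes "f \<in> borel_measurable M"
  shows "(\<lambda>x. f x epowr a) \<in> borel_measurable M"
  unfolding epowr_def Let_def using assms by measurable

lemma two_epowr: "2 epowr t = ennreal (2 powr t)"
  using epowr_ennreal[of 2 t] by simp

lemma suminf_half: "(\<Sum>j. ennreal ((1/2) ^ j)) = 2"
proof -
  have "(\<Sum>j. ennreal ((1/2) ^ j)) = ennreal (\<Sum>j. (1/2) ^ j)"
    by (rule suminf_ennreal2) (auto intro: summable_geometric)
  then show ?thesis by (simp add: suminf_geometric)
qed

text \<open>
  The \<open>t\<close>-th root of the sum on the right bounds every \<open>y j\<close>, and the geometric weights sum to \<open>2\<close>.
  This replaces Minkowski's inequality, at the price of a constant.
\<close>

lemma epowr_geometric_sum_le: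
  fixes y :: "nat \<Rightarrow> ennreal"
  assumes "0 < t"
  shows "(\<Sum>j. ennreal ((1/2) ^ j) * y j) epowr t \<le> ennreal (2 powr t) * (\<Sum>j. y j epowr t)"
proof -
  define s where "s = (\<Sum>j. y j epowr t)"
  have s1: "s epowr (1/t) \<ge> y j" for j
  proof -
    have "y j epowr t \<le> s" unfolding s_def using sum_le_suminf[of "\<lambda>j. y j epowr t" "{j}"] by auto
    then have "(y j epowr t) epowr (1/t) \<le> s epowr (1/t)" using assms by (intro epowr_mono) auto
    then show ?thesis using assms by (simp add: epowr_epowr epowr_one)
  qed
  have "(\<Sum>j. ennreal ((1/2) ^ j) * y j) \<le> (\<Sum>j. ennreal ((1/2) ^ j) * s epowr (1/t))"
    by (intro suminf_le mult_left_mono s1) auto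
  also have "\<dots> = (\<Sum>j. ennreal ((1/2) ^ j)) * s epowr (1/t)"
    by (simp add: ennreal_suminf_multc)
  also have "(\<Sum>j. ennreal ((1/2) ^ j)) = ennreal 2"
    by (simp add: suminf_half)
  finally have "(\<Sum>j. ennreal ((1/2) ^ j) * y j) epowr t \<le> (ennreal 2 * s epowr (1/t)) epowr t"
    by (rule epowr_mono) fact
  also have "\<dots> = ennreal (2 powr t) * s"
    using assms by (subst epowr_mult) (auto simp: two_epowr epowr_epowr epowr_one)
  finally show ?thesis by (simp add: s_def)
qed

lemma epowr_add_le:
  assumes "0 < t"
  shows "(x + y) epowr t \<le> ennreal (2 powr t) * (x epowr t + y epowr t)"
proof -
  have "x + y \<le> ennreal 2 * max x y"
    using add_mono[of x "max x y" y "max x y"] by (simp add: mult_2)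
  then have "(x + y) epowr t \<le> (ennreal 2 * max x y) epowr t"
    using assms by (rule epowr_mono)
  also have "\<dots> = ennreal (2 powr t) * (max x y) epowr t"
    using assms by (simp add: epowr_mult two_epowr)
  also have "\<dots> \<le> ennreal (2 powr t) * (x epowr t + y epowr t)"
    by (intro mult_left_mono) (auto simp: max_def)
  finally show ?thesis .
qed

section \<open>Convergence in measure and category\<close>

text \<open>
  On a finite measure space this is the usual pseudometric of convergence in measure.
\<close>

definition measure_dist :: "'a measure \<Rightarrow> ('a \<Rightarrow> 'b::metric_space) \<Rightarrow> ('a \<Rightarrow> 'b) \<Rightarrow> ennreal" where
  "measure_dist N f g = (\<integral>\<^sup>+x. ennreal (min 1 (dist (f x) (g x))) \<partial>N)"

lemma measure_dist_triangle:
  fixes f g h :: "'a \<Rightarrow> 'b::{metric_space, second_countable_topology}"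
  assumes [measurable]: "f \<in> borel_measurable N" "g \<in> borel_measurable N" "h \<in> borel_measurable N"
  shows "measure_dist N f h \<le> measure_dist N f g + measure_dist N g h"
proof -
  have "measure_dist N f h \<le>
      (\<integral>\<^sup>+x. ennreal (min 1 (dist (f x) (g x))) + ennreal (min 1 (dist (g x) (h x))) \<partial>N)"
    unfolding measure_dist_def
  proof (intro nn_integral_mono)
    fix x
    have "min 1 (dist (f x) (h x)) \<le> min 1 (dist (f x) (g x)) + min 1 (dist (g x) (h x))"
      using dist_triangle[of "f x" "h x" "g x"] zero_le_dist[of "f x" "g x"] zero_le_dist[of "g x" "h x"]
      by linarith
    then show "ennreal (min 1 (dist (f x) (h x)))
        \<le> ennreal (min 1 (dist (f x) (g x))) + ennreal (min 1 (dist (g x) (h x)))"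
      by (simp add: ennreal_leI flip: ennreal_plus)
  qed
  also have "\<dots> = measure_dist N f g + measure_dist N g h"
    unfolding measure_dist_def by (intro nn_integral_add) auto
  finally show ?thesis .
qed

lemma summable_measure_dist_AE:
  fixes X Y :: "nat \<Rightarrow> 'a \<Rightarrow> 'b::{metric_space, second_countable_topology}"
  assumes [measurable]: "\<And>k. X k \<in> borel_measurable N" "\<And>k. Y k \<in> borel_measurable N"
    and "(\<Sum>k. measure_dist N (X k) (Y k)) < \<infinity>"
  shows "AE x in N. summable (\<lambda>k. dist (X k x) (Y k x))"
proof -
  have "(\<integral>\<^sup>+x. (\<Sum>k. ennreal (min 1 (dist (X k x) (Y k x)))) \<partial>N) = (\<Sum>k. measure_dist N (X k) (Y k))"
    unfolding measure_dist_def by (intro nn_integral_suminf) auto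
  then have "AE x in N. (\<Sum>k. ennreal (min 1 (dist (X k x) (Y k x)))) \<noteq> \<infinity>"
    using assms(3) by (intro nn_integral_PInf_AE) auto
  then show ?thesis
  proof eventually_elim
    case (elim x)
    then have s: "summable (\<lambda>k. min 1 (dist (X k x) (Y k x)))"
      by (intro summable_suminf_not_top) auto
    then have "(\<lambda>k. min 1 (dist (X k x) (Y k x))) \<longlonglongrightarrow> 0"
      by (rule summable_LIMSEQ_zero)
    then have "eventually (\<lambda>k. min 1 (dist (X k x) (Y k x)) < 1) sequentially"
      by (rule order_tendstoD) auto
    then have "eventually (\<lambda>k. min 1 (dist (X k x) (Y k x)) = dist (X k x) (Y k x)) sequentially"
      by eventually_elim auto
    then show ?case
      using s by (subst (asm) summable_cong) auto
  qed
qed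

lemma measure_dist_cauchy_limit:
  fixes X :: "nat \<Rightarrow> 'a \<Rightarrow> 'b::{banach, second_countable_topology}"
  assumes [measurable]: "\<And>k. X k \<in> borel_measurable N"
    and "(\<Sum>k. measure_dist N (X (Suc k)) (X k)) < \<infinity>"
  obtains Z where "Z \<in> borel_measurable N" "AE x in N. (\<lambda>k. X k x) \<longlonglongrightarrow> Z x"
proof
  show "(\<lambda>x. lim (\<lambda>k. X k x)) \<in> borel_measurable N"
    by (rule borel_measurable_lim_metric) fact
  have "AE x in N. summable (\<lambda>k. dist (X (Suc k) x) (X k x))"
    using assms by (intro summable_measure_dist_AE) auto
  then show "AE x in N. (\<lambda>k. X k x) \<longlonglongrightarrow> lim (\<lambda>k. X k x)"
  proof eventually_elim
    case (elim x)
    then have "summable (\<lambda>k. X (Suc k) x - X k x)"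
      by (simp add: dist_norm summable_norm_cancel)
    then have "(\<lambda>n. \<Sum>k<n. X (Suc k) x - X k x) \<longlonglongrightarrow> (\<Sum>k. X (Suc k) x - X k x)"
      by (rule summable_LIMSEQ)
    then have "(\<lambda>n. X n x - X 0 x) \<longlonglongrightarrow> (\<Sum>k. X (Suc k) x - X k x)"
      by (simp add: sum_lessThan_telescope[of "\<lambda>k. X k x"])
    then have "(\<lambda>n. (X n x - X 0 x) + X 0 x) \<longlonglongrightarrow> (\<Sum>k. X (Suc k) x - X k x) + X 0 x"
      by (intro tendsto_add tendsto_const)
    then have "convergent (\<lambda>n. X n x)"
      by (auto simp: convergent_def)
    then show ?case by (simp add: convergent_LIMSEQ_iff)
  qed
qed

lemma measure_dist_liminf:
  fixes X :: "nat \<Rightarrow> 'a \<Rightarrow> 'b::{banach, second_countable_topology}"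
  assumes [measurable]: "\<And>k. X k \<in> borel_measurable N" "Z \<in> borel_measurable N" "Y \<in> borel_measurable N"
    and "AE x in N. (\<lambda>k. X k x) \<longlonglongrightarrow> Z x"
    and "\<And>k. k \<ge> n \<Longrightarrow> measure_dist N (X k) Y \<le> c"
  shows "measure_dist N Z Y \<le> c"
proof -
  have "measure_dist N Z Y = (\<integral>\<^sup>+x. liminf (\<lambda>k. ennreal (min 1 (dist (X k x) (Y x)))) \<partial>N)"
    unfolding measure_dist_def
  proof (rule nn_integral_cong_AE)
    from assms(4) show "AE x in N. ennreal (min 1 (dist (Z x) (Y x))) =
        liminf (\<lambda>k. ennreal (min 1 (dist (X k x) (Y x))))"
    proof eventually_elim
      case (elim x)
      then have "(\<lambda>k. ennreal (min 1 (dist (X k x) (Y x)))) \<longlonglongrightarrow> ennreal (min 1 (dist (Z x) (Y x)))"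
        by (intro tendsto_intros)
      then show ?case by (metis lim_imp_Liminf trivial_limit_sequentially)
    qed
  qed
  also have "\<dots> \<le> liminf (\<lambda>k. measure_dist N (X k) Y)"
    unfolding measure_dist_def by (intro nn_integral_liminf) auto
  also have "\<dots> \<le> liminf (\<lambda>k. c)"
    by (intro Liminf_mono) (use assms(5) in \<open>auto simp: eventually_sequentially\<close>)
  finally show ?thesis by (simp add: Liminf_const)
qed

text \<open>
  A class that is closed under convergence almost everywhere is complete for convergence in measure:
  consecutive distances with finite sum force convergence almost everywhere. So nested balls that avoid more
  and more of the \<open>Q n\<close> have a common point, which would lie in no \<open>Q n\<close>.
\<close>

lemma baire_convergence_in_measure:
  fixes P :: "('a \<Rightarrow> 'b::{banach, second_countable_topology}) set" and Q :: "nat \<Rightarrow> ('a \<Rightarrow> 'b) set"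
  assumes nonempty: "P \<noteq> {}"
    and meas: "\<And>f. f \<in> P \<Longrightarrow> f \<in> borel_measurable N"
    and closed_P: "\<And>X f. (\<And>k. X k \<in> P) \<Longrightarrow> f \<in> borel_measurable N \<Longrightarrow>
      (AE x in N. (\<lambda>k. X k x) \<longlonglongrightarrow> f x) \<Longrightarrow> f \<in> P"
    and closed_Q: "\<And>n X f. (\<And>k. X k \<in> P) \<Longrightarrow> (\<And>k. X k \<in> Q n) \<Longrightarrow> f \<in> P \<Longrightarrow>
      (AE x in N. (\<lambda>k. X k x) \<longlonglongrightarrow> f x) \<Longrightarrow> f \<in> Q n"
    and cover: "P \<subseteq> (\<Union>n. Q n)"
  shows "\<exists>n. \<exists>f0\<in>P. \<exists>r>0. \<forall>f\<in>P. measure_dist N f f0 < ennreal r \<longrightarrow> f \<in> Q n"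
proof (rule ccontr)
  assume "\<not> ?thesis"
  then have dense: "\<exists>f\<in>P. measure_dist N f f0 < ennreal r \<and> f \<notin> Q n" if "f0 \<in> P" "r > 0" for n f0 r
    using that by blast
  have isolated: "\<exists>r>0. \<forall>g\<in>P. measure_dist N g f < ennreal r \<longrightarrow> g \<notin> Q n"
    if "f \<in> P" "f \<notin> Q n" for f n
  proof (rule ccontr)
    assume "\<not> ?thesis"
    then have "\<forall>k. \<exists>g. g \<in> P \<and> measure_dist N g f < ennreal ((1/2) ^ k) \<and> g \<in> Q n"
      by (metis zero_less_divide_1_iff zero_less_numeral zero_less_power)
    then obtain X where X: "\<And>k. X k \<in> P" "\<And>k. measure_dist N (X k) f < ennreal ((1/2) ^ k)"
        "\<And>k. X k \<in> Q n"
      by metis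
    have "(\<Sum>k. measure_dist N (X k) f) \<le> (\<Sum>k. ennreal ((1/2) ^ k))"
      by (intro suminf_le less_imp_le X(2)) auto
    also have "\<dots> < \<infinity>"
      by (simp add: suminf_half)
    finally have "AE x in N. summable (\<lambda>k. dist (X k x) (f x))"
      using X(1) that(1) meas by (intro summable_measure_dist_AE) auto
    then have conv: "AE x in N. (\<lambda>k. X k x) \<longlonglongrightarrow> f x"
    proof eventually_elim
      case (elim x)
      then show ?case by (simp add: tendsto_dist_iff[of _ "f x"] summable_LIMSEQ_zero)
    qed
    then have "f \<in> Q n" using closed_Q[of X n f, OF X(1) X(3) that(1)] by blast
    then show False using that by simp
  qed
  have step: "\<exists>g r'. g \<in> P \<and> r' > 0 \<and> r' \<le> r / 4 \<and> measure_dist N g f < ennreal (r / 4) \<and>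
      (\<forall>h\<in>P. measure_dist N h g < ennreal r' \<longrightarrow> h \<notin> Q n)" if fr: "f \<in> P" "r > 0" for f r n
  proof -
    obtain g where g: "g \<in> P" "measure_dist N g f < ennreal (r / 4)" "g \<notin> Q n"
      using dense[of f "r / 4" n] fr by auto
    obtain r' where r': "r' > 0" "\<forall>h\<in>P. measure_dist N h g < ennreal r' \<longrightarrow> h \<notin> Q n"
      using isolated[OF g(1,3)] by auto
    show ?thesis
      using g r' fr
      by (intro exI[of _ g] exI[of _ "min r' (r / 4)"]) (auto simp: less_le_trans ennreal_leI)
  qed
  have "\<exists>s. \<forall>n. (fst (s n) \<in> P \<and> snd (s n) > 0) \<and>
      (snd (s (Suc n)) \<le> snd (s n) / 4 \<and> measure_dist N (fst (s (Suc n))) (fst (s n)) < ennreal (snd (s n) / 4) \<and>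
       (\<forall>h\<in>P. measure_dist N h (fst (s (Suc n))) < ennreal (snd (s (Suc n))) \<longrightarrow> h \<notin> Q n))"
  proof (rule dependent_nat_choice)
    obtain f where "f \<in> P" using nonempty by auto
    then show "\<exists>s. fst s \<in> P \<and> snd s > (0::real)" by (intro exI[of _ "(f, 1)"]) auto
  next
    fix s :: "('a \<Rightarrow> 'b) \<times> real" and n
    assume "fst s \<in> P \<and> snd s > 0"
    then obtain g r' where "g \<in> P" "r' > 0" "r' \<le> snd s / 4" "measure_dist N g (fst s) < ennreal (snd s / 4)"
        "\<forall>h\<in>P. measure_dist N h g < ennreal r' \<longrightarrow> h \<notin> Q n"
      using step[of "fst s" "snd s" n] by blast
    then show "\<exists>y. (fst y \<in> P \<and> snd y > 0) \<and>
       (snd y \<le> snd s / 4 \<and> measure_dist N (fst y) (fst s) < ennreal (snd s / 4) \<and>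
       (\<forall>h\<in>P. measure_dist N h (fst y) < ennreal (snd y) \<longrightarrow> h \<notin> Q n))"
      by (intro exI[of _ "(g, r')"]) auto
  qed
  then obtain s where s: "\<forall>n. (fst (s n) \<in> P \<and> snd (s n) > 0) \<and>
      (snd (s (Suc n)) \<le> snd (s n) / 4 \<and> measure_dist N (fst (s (Suc n))) (fst (s n)) < ennreal (snd (s n) / 4) \<and>
       (\<forall>h\<in>P. measure_dist N h (fst (s (Suc n))) < ennreal (snd (s (Suc n))) \<longrightarrow> h \<notin> Q n))"
    by blast
  define X where "X n = fst (s n)" for n
  define r where "r n = snd (s n)" for n
  have X: "X n \<in> P" and r: "r n > 0" "r (Suc n) \<le> r n / 4"
    and dX: "measure_dist N (X (Suc n)) (X n) < ennreal (r n / 4)"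
    and avoid: "\<And>h. h \<in> P \<Longrightarrow> measure_dist N h (X (Suc n)) < ennreal (r (Suc n)) \<Longrightarrow> h \<notin> Q n" for n
    using s by (auto simp: X_def r_def)
  note Xm = meas[OF X]
  have tail: "measure_dist N (X (n + k)) (X n) \<le> ennreal (r n / 2)" for n k
  proof (induction k arbitrary: n)
    case 0
    show ?case by (simp add: measure_dist_def)
  next
    case (Suc k)
    have "measure_dist N (X (n + Suc k)) (X n)
        \<le> measure_dist N (X (Suc n + k)) (X (Suc n)) + measure_dist N (X (Suc n)) (X n)"
      using measure_dist_triangle[OF Xm Xm Xm] by simp
    also have "\<dots> \<le> ennreal (r (Suc n) / 2) + ennreal (r n / 4)"
      by (intro add_mono Suc.IH less_imp_le dX)
    also have "\<dots> = ennreal (r (Suc n) / 2 + r n / 4)"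
      using r(1)[of n] r(1)[of "Suc n"] by (subst ennreal_plus) auto
    also have "\<dots> \<le> ennreal (r n / 2)"
      using r(1)[of n] r(2)[of n] by (intro ennreal_leI) linarith
    finally show ?case .
  qed
  have geo: "r n / 4 \<le> r 0 * (1/2) ^ n" for n
  proof -
    have "r n \<le> r 0 * (1/4) ^ n"
    proof (induction n)
      case (Suc n)
      then show ?case using r(2)[of n] by simp
    qed simp
    also have "\<dots> \<le> r 0 * (1/2) ^ n"
      using r(1)[of 0] by (intro mult_left_mono power_mono) auto
    finally show ?thesis using r(1)[of n] by linarith
  qed
  have "(\<Sum>k. measure_dist N (X (Suc k)) (X k)) \<le> (\<Sum>k. ennreal (r 0 * (1/2) ^ k))"
    by (intro suminf_le order_trans[OF less_imp_le[OF dX]] ennreal_leI geo) auto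
  also have "\<dots> < \<infinity>"
    using r(1)[of 0] by (simp add: ennreal_mult suminf_half ennreal_mult_less_top)
  finally obtain Z where Z: "Z \<in> borel_measurable N" "AE x in N. (\<lambda>k. X k x) \<longlonglongrightarrow> Z x"
    using measure_dist_cauchy_limit[of X N, OF Xm] by blast
  have ZP: "Z \<in> P" by (rule closed_P[of X Z, OF X Z])
  have "Z \<notin> Q n" for n
  proof -
    have "measure_dist N (X k) (X (Suc n)) \<le> ennreal (r (Suc n) / 2)" if "k \<ge> Suc n" for k
      using tail[of "Suc n" "k - Suc n"] that by simp
    then have "measure_dist N Z (X (Suc n)) \<le> ennreal (r (Suc n) / 2)"
      using measure_dist_liminf[OF Xm Z(1) Xm Z(2)] by blast
    also have "\<dots> < ennreal (r (Suc n))" using r(1)[of "Suc n"] by (simp add: ennreal_lessI)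
    finally show ?thesis using avoid ZP by blast
  qed
  then show False using ZP cover by blast
qed

section \<open>Averages and the essential maximal operator\<close>

lemma average_eq_nn_integral:
  assumes "f \<in> borel_measurable M" "B \<in> sets M"
  shows "average M B f = (\<integral>\<^sup>+x. f x \<partial>uniform_measure M B)"
  unfolding average_def using assms by (simp add: nn_integral_uniform_measure)

lemma ennreal_INF_sequence:
  fixes g :: "'i \<Rightarrow> ennreal"
  assumes "I \<noteq> {}"
  shows "\<exists>s :: nat \<Rightarrow> 'i. range s \<subseteq> I \<and> (INF i\<in>I. g i) = (INF n. g (s n))"
proof -
  obtain f :: "nat \<Rightarrow> ennreal" where f: "range f \<subseteq> g ` I" "Inf (g ` I) = (INF i. f i)"
    using ennreal_Inf_countable_INF[of "g ` I"] assms by auto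
  then have "\<forall>n. \<exists>i\<in>I. f n = g i" by (meson imageE range_subsetD)
  then obtain s where s: "\<And>n. s n \<in> I" "\<And>n. f n = g (s n)" by metis
  show ?thesis using f(2) s by (intro exI[of _ s]) auto
qed

lemma inverse_le_inverse_ennreal_iff: "inverse x \<le> inverse y \<longleftrightarrow> y \<le> (x::ennreal)"
proof (cases "x = 0 \<or> y = 0 \<or> x = top \<or> y = top")
  case True
  then show ?thesis by (auto simp: top_unique)
next
  case False
  then obtain a b where "x = ennreal a" "y = ennreal b" "0 < a" "0 < b"
    by (cases x; cases y) (auto simp: less_le)
  then show ?thesis by (simp add: inverse_ennreal)
qed

text \<open>
  The basis is taken to be nonempty; with \<open>\<mu>(\<Sigma>) > 0\<close> this follows from the fact that it covers almost all of \<open>\<Sigma>\<close>.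
\<close>

locale muckenhoupt = sigma_finite_measure M for M :: "'a measure" +
  fixes \<B> :: "'a set set"
  assumes muckenhoupt: "muckenhoupt_basis M \<B>"
    and basis_nonempty: "\<B> \<noteq> {}"
begin

lemma basis_sets [measurable (raw)]: "B \<in> \<B> \<Longrightarrow> B \<in> sets M"
  and basis_pos: "B \<in> \<B> \<Longrightarrow> 0 < emeasure M B"
  and basis_finite: "B \<in> \<B> \<Longrightarrow> emeasure M B < \<infinity>"
  using muckenhoupt by (auto simp: muckenhoupt_basis_def basis_def)

lemma AE_on_basis_iff:
  assumes "B \<in> \<B>"
  shows "(AE x in uniform_measure M B. P x) \<longleftrightarrow> (AE x in M. x \<in> B \<longrightarrow> P x)"
  using basis_sets[OF assms] basis_pos[OF assms] basis_finite[OF assms]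
  by (intro AE_uniform_measure) auto

lemma prob_space_on_basis: "B \<in> \<B> \<Longrightarrow> prob_space (uniform_measure M B)"
  using basis_pos[of B] basis_finite[of B] by (intro prob_space_uniform_measure) auto

lemma average_mono:
  assumes "B \<in> \<B>" and [measurable]: "f \<in> borel_measurable M" "g \<in> borel_measurable M"
    and "AE x in M. x \<in> B \<longrightarrow> f x \<le> g x"
  shows "average M B f \<le> average M B g"
  using assms AE_on_basis_iff[of B]
  by (simp add: average_eq_nn_integral basis_sets nn_integral_mono_AE)

lemma average_cong:
  assumes "B \<in> \<B>" and [measurable]: "f \<in> borel_measurable M" "g \<in> borel_measurable M"
    and "AE x in M. x \<in> B \<longrightarrow> f x = g x"
  shows "average M B f = average M B g"
  using assms AE_on_basis_iff[of B]
  by (simp add: average_eq_nn_integral basis_sets cong: nn_integral_cong_AE)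

lemma average_cmult:
  assumes "B \<in> \<B>" and [measurable]: "f \<in> borel_measurable M"
  shows "average M B (\<lambda>x. c * f x) = c * average M B f"
  using assms by (simp add: average_eq_nn_integral basis_sets nn_integral_cmult)

lemma average_add:
  assumes "B \<in> \<B>" and [measurable]: "f \<in> borel_measurable M" "g \<in> borel_measurable M"
  shows "average M B (\<lambda>x. f x + g x) = average M B f + average M B g"
  using assms by (simp add: average_eq_nn_integral basis_sets nn_integral_add)

lemma average_suminf:
  assumes "B \<in> \<B>" and [measurable]: "\<And>k. f k \<in> borel_measurable M"
  shows "average M B (\<lambda>x. \<Sum>k. f k x) = (\<Sum>k. average M B (f k))"
  using assms by (simp add: average_eq_nn_integral basis_sets nn_integral_suminf)

lemma average_liminf:
  assumes "B \<in> \<B>" and [measurable]: "\<And>k. f k \<in> borel_measurable M"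
  shows "average M B (\<lambda>x. liminf (\<lambda>k. f k x)) \<le> liminf (\<lambda>k. average M B (f k))"
  using assms by (simp add: average_eq_nn_integral basis_sets nn_integral_liminf)

lemma average_const:
  assumes "B \<in> \<B>"
  shows "average M B (\<lambda>_. c) = c"
  using prob_space.emeasure_space_1[OF prob_space_on_basis[OF assms]]
  by (simp add: average_eq_nn_integral basis_sets assms)

definition sup_average :: "'a set set \<Rightarrow> ('a \<Rightarrow> ennreal) \<Rightarrow> 'a \<Rightarrow> ennreal" where
  "sup_average C f x = (SUP B\<in>C. average M B f * indicator B x)"

definition dominating :: "('a \<Rightarrow> ennreal) \<Rightarrow> 'a set set \<Rightarrow> bool" where
  "dominating f C \<longleftrightarrow> C \<subseteq> \<B> \<and> countable C \<and>
    (\<forall>B\<in>\<B>. AE x in M. x \<in> B \<longrightarrow> average M B f \<le> sup_average C f x)"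

lemma sup_average_measurable:
  assumes "countable C" "C \<subseteq> \<B>"
  shows "sup_average C f \<in> borel_measurable M"
proof -
  have "(\<lambda>x. SUP B\<in>C. average M B f * indicator B x) \<in> borel_measurable M"
    using assms by (intro borel_measurable_SUP) (auto intro!: borel_measurable_times_ennreal borel_measurable_indicator basis_sets)
  then show ?thesis by (simp add: sup_average_def[abs_def])
qed

lemma sup_average_mono: "C \<subseteq> D \<Longrightarrow> sup_average C f x \<le> sup_average D f x"
  unfolding sup_average_def by (rule SUP_subset_mono) auto

text \<open>
  This is the essential supremum of the averages: among all countable subfamilies choose one for which the
  integral of a bounded decreasing function of \<open>sup_average\<close> is minimal. Adding another member of
  the basis does not lower the integral, hence it changes \<open>sup_average\<close> on a null set only.
\<close>

lemma dominating_exists: "\<exists>C. dominating f C"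
proof -
  obtain h where [measurable]: "h \<in> borel_measurable M" and h: "\<And>x. h x > (0::real)"
      and "\<And>x. h x \<le> 1" and "integrable M h"
    by (rule obtain_positive_integrable_function, rule that)
  have hfin: "(\<integral>\<^sup>+x. ennreal (h x) \<partial>M) < \<infinity>"
    using h \<open>integrable M h\<close> by (simp add: nn_integral_eq_integral less_imp_le)
  let ?I = "{C. C \<subseteq> \<B> \<and> countable C}"
  have I: "?I \<noteq> {}" by auto
  define J where "J C = (\<integral>\<^sup>+x. inverse (1 + sup_average C f x) * ennreal (h x) \<partial>M)" for C
  have le1: "inverse (1 + y) \<le> 1" for y :: ennreal
    using inverse_le_inverse_ennreal_iff[of "1 + y" 1] by simp
  obtain s :: "nat \<Rightarrow> 'a set set" where s: "range s \<subseteq> ?I" "(INF C\<in>?I. J C) = (INF n. J (s n))"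
    using ennreal_INF_sequence[OF I, of J] by (elim exE conjE)
  define C where "C = (\<Union>n. s n)"
  have C: "C \<subseteq> \<B>" "countable C" using s(1) by (auto simp: C_def)
  have J_anti: "J D \<le> J C'" if "C' \<subseteq> D" for C' D
    unfolding J_def using sup_average_mono[OF that, of f]
    by (intro nn_integral_mono mult_right_mono inverse_le_inverse_ennreal_iff[THEN iffD2] add_mono) auto
  have J_C: "J C \<le> J D" if "D \<in> ?I" for D
  proof -
    have "J C \<le> (INF n. J (s n))" by (intro INF_greatest J_anti) (auto simp: C_def)
    also have "\<dots> = (INF C\<in>?I. J C)" by (rule s(2)[symmetric])
    also have "\<dots> \<le> J D" by (rule INF_lower[OF that])
    finally show ?thesis .
  qed
  have "AE x in M. x \<in> B \<longrightarrow> average M B f \<le> sup_average C f x" if B: "B \<in> \<B>" for B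
  proof -
    let ?D = "insert B C"
    have D: "?D \<in> ?I" using C B by auto
    note [measurable] = sup_average_measurable[OF C(2) C(1), of f] sup_average_measurable[of ?D f]
    have [measurable]: "sup_average ?D f \<in> borel_measurable M"
      using D by (intro sup_average_measurable) auto
    have "J ?D \<le> (\<integral>\<^sup>+x. ennreal (h x) \<partial>M)"
      unfolding J_def using le1 by (intro nn_integral_mono) (metis mult.left_neutral mult_right_mono zero_le)
    then have fin: "J ?D < \<infinity>" using hfin by (rule le_less_trans)
    have JJ: "J C \<le> J ?D" by (rule J_C[OF D])
    have "J C - J ?D = 0" by (rule diff_eq_0_ennreal[OF _ JJ]) (use JJ fin in auto)
    then have "(\<integral>\<^sup>+x. inverse (1 + sup_average C f x) * ennreal (h x)
        - inverse (1 + sup_average ?D f x) * ennreal (h x) \<partial>M) = 0"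
      using fin sup_average_mono[of C ?D f] unfolding J_def
      by (subst nn_integral_diff) (auto intro!: AE_I2 mult_right_mono inverse_le_inverse_ennreal_iff[THEN iffD2] add_mono)
    then have "AE x in M. inverse (1 + sup_average C f x) * ennreal (h x)
        - inverse (1 + sup_average ?D f x) * ennreal (h x) = 0"
      by (subst (asm) nn_integral_0_iff_AE) auto
    then show ?thesis
    proof eventually_elim
      case (elim x)
      then have "inverse (1 + sup_average C f x) * ennreal (h x)
        \<le> inverse (1 + sup_average ?D f x) * ennreal (h x)"
        by (simp add: diff_eq_0_iff_ennreal)
      then have "inverse (1 + sup_average C f x) \<le> inverse (1 + sup_average ?D f x)"
        using h[of x] by (simp add: ennreal_mult_le_mult_iff mult.commute[of _ "ennreal (h x)"])
      then have "1 + sup_average ?D f x \<le> 1 + sup_average C f x"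
        by (simp add: inverse_le_inverse_ennreal_iff)
      then have "sup_average ?D f x \<le> sup_average C f x"
        by (simp add: ennreal_add_left_cancel_le)
      moreover have "average M B f * indicator B x \<le> sup_average ?D f x"
        unfolding sup_average_def by (intro SUP_upper) auto
      ultimately show ?case by (auto simp: indicator_def)
    qed
  qed
  then show ?thesis using C by (auto simp: dominating_def)
qed

text \<open>
  The essential maximal function. The pointwise supremum over all of \<open>\<B>\<close> can be larger, as an uncountable basis may
  reach points through null sets: if \<open>\<B>\<close> consists of disjoint bounded intervals \<open>Q\<close> and \<open>E\<close> and of all \<open>Q \<union> {x}\<close> with
  \<open>x \<in> E\<close>, then the weights with value \<open>1\<close> on \<open>Q\<close> and \<open>\<lambda>\<close> on \<open>E\<close> all have \<open>A\<^sub>t\<close> constant \<open>1\<close>, but the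
  pointwise operator maps the indicator of \<open>Q\<close> to a function that is \<open>1\<close> on \<open>E\<close>, so its bounds on \<open>L\<^sup>t\<close> are not
  uniform in \<open>\<lambda>\<close>. The essential operator only depends on the members of \<open>\<B>\<close> up to null sets.
\<close>

definition ess_maximal :: "('a \<Rightarrow> ennreal) \<Rightarrow> 'a \<Rightarrow> ennreal" where
  "ess_maximal f = sup_average (SOME C. dominating f C) f"

lemma ess_maximal_eq:
  obtains C where "dominating f C" "ess_maximal f = sup_average C f"
  using someI_ex[OF dominating_exists[of f]] that by (auto simp: ess_maximal_def)

lemma ess_maximal_measurable [measurable]: "ess_maximal f \<in> borel_measurable M"
  by (rule ess_maximal_eq[of f]) (auto simp: dominating_def intro: sup_average_measurable)

lemma average_le_ess_maximal:
  assumes "B \<in> \<B>"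
  shows "AE x in M. x \<in> B \<longrightarrow> average M B f \<le> ess_maximal f x"
proof -
  obtain C where "dominating f C" "ess_maximal f = sup_average C f"
    by (rule ess_maximal_eq)
  then show ?thesis using assms by (simp add: dominating_def)
qed

lemma ess_maximal_least:
  assumes "\<And>B. B \<in> \<B> \<Longrightarrow> AE x in M. x \<in> B \<longrightarrow> average M B f \<le> m x"
  shows "AE x in M. ess_maximal f x \<le> m x"
proof -
  obtain C where C: "dominating f C" "ess_maximal f = sup_average C f"
    by (rule ess_maximal_eq)
  have "AE x in M. \<forall>B\<in>C. x \<in> B \<longrightarrow> average M B f \<le> m x"
    using C(1) assms by (subst AE_ball_countable) (auto simp: dominating_def)
  then show ?thesis
    unfolding C(2) by eventually_elim (auto simp: sup_average_def indicator_def intro!: SUP_least)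
qed

lemma ess_maximal_le_maximal:
  assumes [measurable]: "f \<in> borel_measurable M" "g \<in> borel_measurable M"
    and "AE x in M. f x = g x"
  shows "ess_maximal f x \<le> maximal M \<B> g x"
proof -
  obtain C where C: "dominating f C" "ess_maximal f = sup_average C f"
    by (rule ess_maximal_eq)
  have "average M B f * indicator B x \<le> maximal M \<B> g x" if "B \<in> C" for B
  proof (cases "x \<in> B")
    case True
    have B: "B \<in> \<B>" using that C(1) by (auto simp: dominating_def)
    have "average M B f = average M B g" using assms by (intro average_cong B) auto
    then show ?thesis using B True by (auto simp: maximal_def intro!: SUP_upper)
  qed auto
  then show ?thesis unfolding C(2) by (auto simp: sup_average_def intro!: SUP_least)
qed

text \<open>
  The essential maximal function is dominated by the pointwise one, so it inherits the bounds that define a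
  Muckenhoupt basis. An infinite right-hand side is the reason for asking \<open>1 \<le> C\<close>.
\<close>

lemma ess_maximal_bounded:
  assumes t: "1 < t" and W: "W \<in> Ap M \<B> t"
  shows "\<exists>C::real. 1 \<le> C \<and> (\<forall>f\<in>borel_measurable M.
    (\<integral>\<^sup>+x. ess_maximal f x epowr t * W x \<partial>M) \<le> ennreal C * (\<integral>\<^sup>+x. f x epowr t * W x \<partial>M))"
proof -
  have [measurable]: "W \<in> borel_measurable M" and Wpos: "AE x in M. 0 < W x \<and> W x < \<infinity>"
    using W by (auto simp: Ap_def weight_def)
  obtain C :: ennreal where C: "C < \<infinity>"
    and bound: "\<And>f::'a \<Rightarrow> real. f \<in> borel_measurable M \<Longrightarrow>
      Lp_norm (density M W) t (\<lambda>x. ennreal \<bar>f x\<bar>) < \<infinity> \<Longrightarrow>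
      maximal M \<B> (\<lambda>x. ennreal \<bar>f x\<bar>) \<in> borel_measurable M \<and>
      Lp_norm (density M W) t (maximal M \<B> (\<lambda>x. ennreal \<bar>f x\<bar>))
        \<le> C * Lp_norm (density M W) t (\<lambda>x. ennreal \<bar>f x\<bar>)"
    using muckenhoupt t W unfolding muckenhoupt_basis_def by blast
  define D where "D = max 1 (enn2real (C epowr t))"
  have CD: "C epowr t \<le> ennreal D"
  proof -
    have "C epowr t < \<infinity>" using C t by (cases C) (auto simp: epowr_ennreal_nonneg)
    then have "C epowr t = ennreal (enn2real (C epowr t))" by simp
    also have "\<dots> \<le> ennreal D" by (intro ennreal_leI) (simp add: D_def)
    finally show ?thesis .
  qed
  have "(\<integral>\<^sup>+x. ess_maximal f x epowr t * W x \<partial>M) \<le> ennreal D * (\<integral>\<^sup>+x. f x epowr t * W x \<partial>M)"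
    if f[measurable]: "f \<in> borel_measurable M" for f
  proof (cases "(\<integral>\<^sup>+x. f x epowr t * W x \<partial>M) = \<infinity>")
    case True
    then show ?thesis by (simp add: D_def ennreal_mult_top)
  next
    case False
    have "AE x in M. f x epowr t * W x \<noteq> \<infinity>" using False by (intro nn_integral_PInf_AE) auto
    with Wpos have fin: "AE x in M. f x < \<infinity>"
    proof eventually_elim
      case (elim x)
      then show ?case using t by (auto simp: less_top[symmetric] epowr_top ennreal_top_mult split: if_splits)
    qed
    define g where "g x = enn2real (f x)" for x
    have [measurable]: "g \<in> borel_measurable M" unfolding g_def by measurable
    have fg: "AE x in M. f x = ennreal \<bar>g x\<bar>" using fin by eventually_elim (auto simp: g_def)
    have int_eq: "(\<integral>\<^sup>+x. ennreal \<bar>g x\<bar> epowr t \<partial>density M W) = (\<integral>\<^sup>+x. f x epowr t * W x \<partial>M)"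
      using fg by (subst nn_integral_density) (auto intro!: nn_integral_cong_AE simp: mult.commute)
    have "(\<integral>\<^sup>+x. f x epowr t * W x \<partial>M) epowr (1/t) < \<infinity>"
      using False t by (cases "\<integral>\<^sup>+x. f x epowr t * W x \<partial>M") (auto simp: epowr_ennreal_nonneg)
    then have "Lp_norm (density M W) t (\<lambda>x. ennreal \<bar>g x\<bar>) < \<infinity>"
      by (simp add: Lp_norm_def int_eq)
    from bound[OF _ this] have m[measurable]: "maximal M \<B> (\<lambda>x. ennreal \<bar>g x\<bar>) \<in> borel_measurable M"
      and b: "Lp_norm (density M W) t (maximal M \<B> (\<lambda>x. ennreal \<bar>g x\<bar>))
        \<le> C * Lp_norm (density M W) t (\<lambda>x. ennreal \<bar>g x\<bar>)" by auto
    have "(\<integral>\<^sup>+x. ess_maximal f x epowr t * W x \<partial>M)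
        \<le> (\<integral>\<^sup>+x. maximal M \<B> (\<lambda>x. ennreal \<bar>g x\<bar>) x epowr t * W x \<partial>M)"
      using t fg by (intro nn_integral_mono mult_right_mono epowr_mono ess_maximal_le_maximal) auto
    also have "\<dots> = (\<integral>\<^sup>+x. maximal M \<B> (\<lambda>x. ennreal \<bar>g x\<bar>) x epowr t \<partial>density M W)"
      by (subst nn_integral_density) (auto simp: mult.commute)
    also have "\<dots> = Lp_norm (density M W) t (maximal M \<B> (\<lambda>x. ennreal \<bar>g x\<bar>)) epowr t"
      using t by (simp add: Lp_norm_def epowr_epowr epowr_one)
    also have "\<dots> \<le> (C * Lp_norm (density M W) t (\<lambda>x. ennreal \<bar>g x\<bar>)) epowr t"
      using t by (intro epowr_mono b) auto
    also have "\<dots> = C epowr t * (\<integral>\<^sup>+x. f x epowr t * W x \<partial>M)"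
      using t by (simp add: Lp_norm_def epowr_epowr epowr_one epowr_mult int_eq)
    also have "\<dots> \<le> ennreal D * (\<integral>\<^sup>+x. f x epowr t * W x \<partial>M)"
      by (intro mult_right_mono CD) auto
    finally show ?thesis .
  qed
  then show ?thesis by (intro exI[of _ D]) (auto simp: D_def)
qed

section \<open>Weights satisfying the A1 condition\<close>

text \<open>
  The \<open>A\<^sub>1\<close> condition for the essential maximal operator, for weights that are finite and positive everywhere.
  It implies \<open>A\<^sub>r\<close> for each \<open>r > 1\<close>, is inherited by sums, minima and limits with the same constant, and says that a weight
  is bounded below on each \<open>B\<close> by a multiple of its average.
\<close>

definition A1 :: "real \<Rightarrow> ('a \<Rightarrow> real) \<Rightarrow> bool" where
  "A1 K w \<longleftrightarrow> w \<in> borel_measurable M \<and> (\<forall>x. 0 < w x) \<and>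
    (\<forall>B\<in>\<B>. AE x in M. x \<in> B \<longrightarrow> average M B (\<lambda>x. ennreal (w x)) \<le> ennreal (K * w x))"

lemma A1_measurable [measurable_dest]: "A1 K w \<Longrightarrow> w \<in> borel_measurable M"
  and A1_pos: "A1 K w \<Longrightarrow> 0 < w x"
  and A1_average: "A1 K w \<Longrightarrow> B \<in> \<B> \<Longrightarrow>
    AE x in M. x \<in> B \<longrightarrow> average M B (\<lambda>x. ennreal (w x)) \<le> ennreal (K * w x)"
  by (auto simp: A1_def)

lemma A1_mono:
  assumes "A1 K w" "K \<le> L"
  shows "A1 L w"
proof -
  have le: "ennreal (K * w x) \<le> ennreal (L * w x)" for x
    using A1_pos[OF assms(1), of x] assms(2) by (intro ennreal_leI mult_right_mono) auto
  have "AE x in M. x \<in> B \<longrightarrow> average M B (\<lambda>x. ennreal (w x)) \<le> ennreal (L * w x)" if "B \<in> \<B>" for B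
    using A1_average[OF assms(1) that] by eventually_elim (auto intro: order_trans[OF _ le])
  then show ?thesis using assms(1) by (simp add: A1_def)
qed

lemma A1_one: "1 \<le> K \<Longrightarrow> A1 K (\<lambda>_. 1)"
  by (auto simp: A1_def average_const)

lemma A1_average_real:
  assumes w: "A1 K w" and B: "B \<in> \<B>"
  obtains a where "0 < a" "average M B (\<lambda>x. ennreal (w x)) = ennreal a"
    "AE x in M. x \<in> B \<longrightarrow> a \<le> K * w x"
proof -
  note [measurable] = A1_measurable[OF w]
  have nontriv: "\<not> (AE x in uniform_measure M B. False)"
    using prob_space.AE_False[OF prob_space_on_basis[OF B]] by simp
  have fin: "average M B (\<lambda>x. ennreal (w x)) \<noteq> \<infinity>"
  proof
    assume "average M B (\<lambda>x. ennreal (w x)) = \<infinity>"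
    then have "AE x in uniform_measure M B. False"
      using A1_average[OF w B] AE_on_basis_iff[OF B, of "\<lambda>_. False"] by (auto simp: top_unique)
    then show False using nontriv by simp
  qed
  have pos: "average M B (\<lambda>x. ennreal (w x)) \<noteq> 0"
  proof
    assume "average M B (\<lambda>x. ennreal (w x)) = 0"
    then have "AE x in uniform_measure M B. ennreal (w x) = 0"
      using B by (simp add: average_eq_nn_integral basis_sets nn_integral_0_iff_AE)
    then have "AE x in uniform_measure M B. False"
      by eventually_elim (use A1_pos[OF w] in \<open>auto simp: less_le not_le[symmetric]\<close>)
    then show False using nontriv by simp
  qed
  obtain a where a: "0 < a" "average M B (\<lambda>x. ennreal (w x)) = ennreal a"
    using fin pos by (cases "average M B (\<lambda>x. ennreal (w x))") (auto simp: less_le)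
  have "AE x in M. x \<in> B \<longrightarrow> a \<le> K * w x"
    using A1_average[OF w B] unfolding a(2)
    by eventually_elim (use a(1) in \<open>auto simp: ennreal_le_iff2\<close>)
  then show ?thesis using a that by blast
qed

lemma A1_add:
  assumes v: "A1 K v" and w: "A1 K w" and c: "0 < c" and K: "0 \<le> K"
  shows "A1 K (\<lambda>x. v x + c * w x)"
proof -
  note [measurable] = A1_measurable[OF v] A1_measurable[OF w]
  have "AE x in M. x \<in> B \<longrightarrow> average M B (\<lambda>x. ennreal (v x + c * w x)) \<le> ennreal (K * (v x + c * w x))"
    if B: "B \<in> \<B>" for B
    using A1_average[OF v B] A1_average[OF w B]
  proof eventually_elim
    case (elim x)
    show ?case
    proof
      assume x: "x \<in> B"
      have "average M B (\<lambda>x. ennreal (v x + c * w x)) = average M B (\<lambda>x. ennreal (v x) + ennreal c * ennreal (w x))"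
        using A1_pos[OF v] A1_pos[OF w] c
        by (intro arg_cong[where f="average M B"]) (auto simp: ennreal_plus ennreal_mult less_imp_le fun_eq_iff)
      also have "\<dots> = average M B (\<lambda>x. ennreal (v x)) + ennreal c * average M B (\<lambda>x. ennreal (w x))"
        using B by (simp add: average_add average_cmult)
      also have "\<dots> \<le> ennreal (K * v x) + ennreal c * ennreal (K * w x)"
        using elim x by (intro add_mono mult_left_mono) auto
      also have "\<dots> = ennreal (K * (v x + c * w x))"
        using A1_pos[OF v, of x] A1_pos[OF w, of x] c K
        by (simp add: algebra_simps flip: ennreal_plus ennreal_mult)
      finally show "average M B (\<lambda>x. ennreal (v x + c * w x)) \<le> ennreal (K * (v x + c * w x))" .
    qed
  qed
  then show ?thesis using A1_pos[OF v] A1_pos[OF w] c by (auto simp: A1_def add_pos_pos)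
qed

lemma A1_min:
  assumes v: "A1 K v" and w: "A1 K w" and K: "0 \<le> K"
  shows "A1 K (\<lambda>x. min (v x) (w x))"
proof -
  note [measurable] = A1_measurable[OF v] A1_measurable[OF w]
  have "AE x in M. x \<in> B \<longrightarrow> average M B (\<lambda>x. ennreal (min (v x) (w x))) \<le> ennreal (K * min (v x) (w x))"
    if B: "B \<in> \<B>" for B
    using A1_average[OF v B] A1_average[OF w B]
  proof eventually_elim
    case (elim x)
    have "average M B (\<lambda>x. ennreal (min (v x) (w x))) \<le> average M B (\<lambda>x. ennreal (v x))"
         "average M B (\<lambda>x. ennreal (min (v x) (w x))) \<le> average M B (\<lambda>x. ennreal (w x))"
      using B by (auto intro!: average_mono ennreal_leI)
    then show ?case using elim by (auto simp: min_def)
  qed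
  then show ?thesis using A1_pos[OF v] A1_pos[OF w] by (auto simp: A1_def)
qed

lemma A1_limit:
  assumes w: "\<And>k. A1 K (w k)" and [measurable]: "v \<in> borel_measurable M" and v: "\<And>x. 0 < v x"
    and lim: "AE x in M. (\<lambda>k. w k x) \<longlonglongrightarrow> v x"
  shows "A1 K v"
proof -
  note [measurable] = A1_measurable[OF w]
  have "AE x in M. x \<in> B \<longrightarrow> average M B (\<lambda>x. ennreal (v x)) \<le> ennreal (K * v x)" if B: "B \<in> \<B>" for B
  proof -
    have lim': "AE x in M. liminf (\<lambda>k. ennreal (w k x)) = ennreal (v x)"
      using lim by eventually_elim (auto intro!: lim_imp_Liminf tendsto_ennrealI)
    have "average M B (\<lambda>x. ennreal (v x)) = average M B (\<lambda>x. liminf (\<lambda>k. ennreal (w k x)))"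
      using lim' B by (intro average_cong) auto
    also have "\<dots> \<le> liminf (\<lambda>k. average M B (\<lambda>x. ennreal (w k x)))"
      by (intro average_liminf B) auto
    finally have le: "average M B (\<lambda>x. ennreal (v x)) \<le> liminf (\<lambda>k. average M B (\<lambda>x. ennreal (w k x)))" .
    have "AE x in M. \<forall>k. x \<in> B \<longrightarrow> average M B (\<lambda>x. ennreal (w k x)) \<le> ennreal (K * w k x)"
      unfolding AE_all_countable using A1_average[OF w B] by blast
    with lim show ?thesis
    proof eventually_elim
      case (elim x)
      show ?case
      proof
        assume "x \<in> B"
        then have "liminf (\<lambda>k. average M B (\<lambda>x. ennreal (w k x))) \<le> liminf (\<lambda>k. ennreal (K * w k x))"
          using elim by (intro Liminf_mono) auto
        also have "\<dots> = ennreal (K * v x)"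
          using elim by (intro lim_imp_Liminf tendsto_ennrealI tendsto_mult) auto
        finally show "average M B (\<lambda>x. ennreal (v x)) \<le> ennreal (K * v x)" using le by order
      qed
    qed
  qed
  then show ?thesis using v by (auto simp: A1_def)
qed

text \<open>
  The easy half of the factorisation of \<open>A\<^sub>r\<close> weights: in each of the two averages, the factor with a negative
  exponent is estimated by its lower bound on \<open>B\<close>.
\<close>

lemma A1_factor_in_Ap:
  assumes w1: "A1 K w1" and w2: "A1 K w2" and r: "1 < r" and K: "0 < K"
  shows "(\<lambda>x. ennreal (w1 x * w2 x powr (1 - r))) \<in> Ap M \<B> r"
    and "Ap_const M \<B> r (\<lambda>x. ennreal (w1 x * w2 x powr (1 - r))) \<le> ennreal (K powr r)"
proof -
  note [measurable] = A1_measurable[OF w1] A1_measurable[OF w2]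
  let ?W = "\<lambda>x. ennreal (w1 x * w2 x powr (1 - r))"
  note p1 = A1_pos[OF w1] and p2 = A1_pos[OF w2]
  define s where "s = 1 - conj_exponent r"
  have s: "s = - (1 / (r - 1))" "s < 0" "(1 - r) * s = 1" "s * (r - 1) = -1"
    using r by (auto simp: s_def conj_exponent_def field_simps)
  have We: "?W x epowr s = ennreal (w1 x powr s * w2 x)" for x
    using p1[of x] p2[of x] s(3) by (simp add: epowr_ennreal powr_mult powr_powr)
  have "average M B ?W * average M B (\<lambda>x. ?W x epowr s) epowr (r - 1) \<le> ennreal (K powr r)"
    if B: "B \<in> \<B>" for B
  proof -
    obtain a1 where a1: "0 < a1" "average M B (\<lambda>x. ennreal (w1 x)) = ennreal a1"
        "AE x in M. x \<in> B \<longrightarrow> a1 \<le> K * w1 x"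
      by (rule A1_average_real[OF w1 B])
    obtain a2 where a2: "0 < a2" "average M B (\<lambda>x. ennreal (w2 x)) = ennreal a2"
        "AE x in M. x \<in> B \<longrightarrow> a2 \<le> K * w2 x"
      by (rule A1_average_real[OF w2 B])
    have "average M B ?W \<le> average M B (\<lambda>x. ennreal ((a2 / K) powr (1 - r)) * ennreal (w1 x))"
    proof (intro average_mono B)
      show "AE x in M. x \<in> B \<longrightarrow> ?W x \<le> ennreal ((a2 / K) powr (1 - r)) * ennreal (w1 x)"
        using a2(3)
      proof eventually_elim
        case (elim x)
        show ?case
        proof
          assume "x \<in> B"
          then have "w2 x powr (1 - r) \<le> (a2 / K) powr (1 - r)"
            using elim a2(1) K r by (intro powr_mono2') (auto simp: field_simps)
          then have "w1 x * w2 x powr (1 - r) \<le> (a2 / K) powr (1 - r) * w1 x"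
            using p1[of x] by (simp add: mult.commute)
          then show "?W x \<le> ennreal ((a2 / K) powr (1 - r)) * ennreal (w1 x)"
            by (simp add: ennreal_leI flip: ennreal_mult')
        qed
      qed
    qed auto
    also have "\<dots> = ennreal ((a2 / K) powr (1 - r) * a1)"
      using a1 B by (simp add: average_cmult ennreal_mult)
    finally have 1: "average M B ?W \<le> ennreal ((a2 / K) powr (1 - r) * a1)" .
    have "average M B (\<lambda>x. ?W x epowr s) \<le> average M B (\<lambda>x. ennreal ((a1 / K) powr s) * ennreal (w2 x))"
    proof (intro average_mono B)
      show "AE x in M. x \<in> B \<longrightarrow> ?W x epowr s \<le> ennreal ((a1 / K) powr s) * ennreal (w2 x)"
        using a1(3)
      proof eventually_elim
        case (elim x)
        show ?case
        proof
          assume "x \<in> B"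
          then have "w1 x powr s \<le> (a1 / K) powr s"
            using elim a1(1) K s(2) by (intro powr_mono2') (auto simp: field_simps)
          then show "?W x epowr s \<le> ennreal ((a1 / K) powr s) * ennreal (w2 x)"
            using p2[of x] unfolding We by (simp add: mult_right_mono ennreal_leI flip: ennreal_mult')
        qed
      qed
    qed auto
    also have "\<dots> = ennreal ((a1 / K) powr s * a2)"
      using a2 B by (simp add: average_cmult ennreal_mult)
    finally have "average M B (\<lambda>x. ?W x epowr s) epowr (r - 1) \<le> ennreal ((a1 / K) powr s * a2) epowr (r - 1)"
      using r by (intro epowr_mono) auto
    also have "\<dots> = ennreal (((a1 / K) powr s * a2) powr (r - 1))"
      using a1 a2 K by (intro epowr_ennreal) auto
    also have "((a1 / K) powr s * a2) powr (r - 1) = (a1 / K) powr -1 * a2 powr (r - 1)"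
      using a1 a2 K s by (simp add: powr_mult powr_powr)
    finally have "average M B ?W * average M B (\<lambda>x. ?W x epowr s) epowr (r - 1)
        \<le> ennreal ((a2 / K) powr (1 - r) * a1) * ennreal ((a1 / K) powr -1 * a2 powr (r - 1))"
      by (intro mult_mono 1) auto
    also have "\<dots> = ennreal (((a2 / K) powr (1 - r) * a1) * ((a1 / K) powr -1 * a2 powr (r - 1)))"
      by (rule ennreal_mult[symmetric]) (use a1 in auto)
    also have "((a2 / K) powr (1 - r) * a1) * ((a1 / K) powr -1 * a2 powr (r - 1)) = K powr r"
      using a1 a2 K by (simp add: powr_divide powr_diff powr_minus field_simps)
    finally show ?thesis .
  qed
  then have "(SUP B\<in>\<B>. average M B ?W * average M B (\<lambda>x. ?W x epowr s) epowr (r - 1)) \<le> ennreal (K powr r)"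
    by (intro SUP_least)
  then show le: "Ap_const M \<B> r ?W \<le> ennreal (K powr r)"
    using r by (simp add: Ap_const_def s_def)
  have "0 < w1 x * w2 x powr (1 - r)" for x using p1[of x] p2[of x] by simp
  then have "weight M ?W" by (simp add: weight_def)
  then show "?W \<in> Ap M \<B> r"
    using le by (auto simp: Ap_def intro: le_less_trans)
qed

end

section \<open>Components of the basis and tightness of normalised weights\<close>

lemma le_liminf_epowr:
  fixes a :: "nat \<Rightarrow> ennreal"
  assumes "y \<le> liminf a" and t: "0 < t"
  shows "y epowr t \<le> liminf (\<lambda>m. a m epowr t)"
  unfolding le_Liminf_iff
proof (intro allI impI)
  have iff: "z < x epowr t \<longleftrightarrow> z epowr (1/t) < x" for z x
  proof -
    have "x epowr t \<le> z \<longleftrightarrow> x \<le> z epowr (1/t)"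
      using epowr_mono[of "x epowr t" z "1/t"] epowr_mono[of x "z epowr (1/t)" t] t
      by (auto simp: epowr_epowr epowr_one)
    then show ?thesis by (simp add: not_le[symmetric])
  qed
  fix z assume "z < y epowr t"
  then have "z epowr (1/t) < y" by (simp add: iff)
  then have "eventually (\<lambda>m. z epowr (1/t) < a m) sequentially"
    using assms(1) by (simp add: le_Liminf_iff)
  then show "eventually (\<lambda>m. z < a m epowr t) sequentially" by (simp add: iff)
qed

lemma (in finite_measure) tight_pos_function:
  fixes g :: "'a \<Rightarrow> real"
  assumes [measurable]: "g \<in> borel_measurable M" and pos: "\<And>x. 0 < g x" and "0 < e"
  shows "\<exists>R\<ge>1. emeasure M {x\<in>space M. \<not> (1 / R \<le> g x \<and> g x \<le> R)} \<le> ennreal e"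
proof -
  define T where "T n = {x\<in>space M. \<not> (1 / real (Suc n) \<le> g x \<and> g x \<le> real (Suc n))}" for n
  have [measurable]: "T n \<in> sets M" for n unfolding T_def by measurable
  have "decseq T"
  proof (rule decseq_SucI)
    fix n
    have "1 / real (Suc (Suc n)) \<le> 1 / real (Suc n)" by (simp add: frac_le)
    then show "T (Suc n) \<subseteq> T n" unfolding T_def by (auto intro: order_trans)
  qed
  moreover have "(\<Inter>n. T n) = {}"
  proof -
    have "x \<notin> (\<Inter>n. T n)" for x
    proof -
      obtain n where n: "max (g x) (1 / g x) < real n" using reals_Archimedean2 by blast
      then have "g x \<le> real (Suc n)" "1 / g x \<le> real (Suc n)" by auto
      then have "1 / real (Suc n) \<le> g x" using pos[of x] by (simp add: field_simps)
      then have "x \<notin> T n" using \<open>g x \<le> real (Suc n)\<close> by (auto simp: T_def)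
      then show ?thesis by auto
    qed
    then show ?thesis by auto
  qed
  moreover have "range T \<subseteq> sets M" by auto
  ultimately have "(\<lambda>n. emeasure M (T n)) \<longlonglongrightarrow> 0"
    using Lim_emeasure_decseq[of T M] by auto
  then have "eventually (\<lambda>n. emeasure M (T n) < ennreal e) sequentially"
    by (rule order_tendstoD) (use assms in auto)
  then obtain n where "emeasure M (T n) < ennreal e" by (auto simp: eventually_sequentially)
  then show ?thesis by (intro exI[of _ "real (Suc n)"]) (auto simp: T_def)
qed

context muckenhoupt
begin

text \<open>
  \<open>A\<^sub>1\<close> weights can be rescaled independently on sets that no member of the basis joins. Membership in
  the same component is being linked by a chain of members with overlaps of positive measure; along such a
  chain the averages of an \<open>A\<^sub>1\<close> weight are comparable, with constants that depend on the chain and on \<open>K\<close> only.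
\<close>

definition linked :: "'a set \<Rightarrow> 'a set \<Rightarrow> bool" where
  "linked = (\<lambda>A B. A \<in> \<B> \<and> B \<in> \<B> \<and> 0 < emeasure M (A \<inter> B))\<^sup>*\<^sup>*"

lemma linked_refl: "linked A A"
  by (simp add: linked_def)

lemma linked_trans: "linked A B \<Longrightarrow> linked B C \<Longrightarrow> linked A C"
  unfolding linked_def by (rule rtranclp_trans)

lemma linked_sym: "linked A B \<Longrightarrow> linked B A"
  unfolding linked_def
  by (rule sympD[OF symp_rtranclp]) (auto simp: symp_def Int_commute)

lemma linked_step: "A \<in> \<B> \<Longrightarrow> B \<in> \<B> \<Longrightarrow> 0 < emeasure M (A \<inter> B) \<Longrightarrow> linked A B"
  by (auto simp: linked_def)

lemma A1_average_step:
  assumes A: "A \<in> \<B>" and B: "B \<in> \<B>" and pos: "0 < emeasure M (A \<inter> B)" and K: "1 \<le> K"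
  shows "\<exists>c>0. \<forall>w. A1 K w \<longrightarrow> average M B (\<lambda>x. ennreal (w x)) \<le> ennreal c * average M A (\<lambda>x. ennreal (w x))"
proof -
  define q where "q = average M A (indicator B)"
  have q_eq: "q = emeasure M (A \<inter> B) / emeasure M A"
    unfolding q_def average_def using A B basis_sets
    by (simp add: nn_integral_indicator Int_commute flip: indicator_inter_arith)
  have "emeasure M (A \<inter> B) \<le> emeasure M A" using basis_sets[OF A] by (intro emeasure_mono) auto
  then have "q < \<infinity>"
    unfolding q_eq using basis_pos[OF A] basis_finite[OF A]
    by (metis divide_less_ennreal ennreal_mult_less_top ennreal_mult_top infinity_ennreal_def le_less_trans less_irrefl mult.commute)
  moreover have "q \<noteq> 0"
    unfolding q_eq using pos basis_finite[OF A] by (auto simp: ennreal_divide_eq_0_iff zero_less_iff_neq_zero less_top)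
  ultimately obtain q' where q': "0 < q'" "q = ennreal q'"
    by (cases q) (auto simp: less_le)
  have "average M B (\<lambda>x. ennreal (w x)) \<le> ennreal (K / q') * average M A (\<lambda>x. ennreal (w x))"
    if w: "A1 K w" for w
  proof -
    note [measurable] = A1_measurable[OF w]
    have [measurable]: "B \<in> sets M" by (rule basis_sets[OF B])
    let ?a = "average M B (\<lambda>x. ennreal (w x))"
    have "?a * q = average M A (\<lambda>x. ?a * indicator B x)"
      unfolding q_def using A by (simp add: average_cmult)
    also have "\<dots> \<le> average M A (\<lambda>x. ennreal K * ennreal (w x))"
    proof (rule average_mono[OF A])
      show "AE x in M. x \<in> A \<longrightarrow> ?a * indicator B x \<le> ennreal K * ennreal (w x)"
        using A1_average[OF w B] by eventually_elim (use K in \<open>auto simp: indicator_def ennreal_mult'\<close>)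
    qed auto
    also have "\<dots> = ennreal K * average M A (\<lambda>x. ennreal (w x))"
      using A by (simp add: average_cmult)
    finally have le: "?a * ennreal q' \<le> ennreal K * average M A (\<lambda>x. ennreal (w x))" by (simp add: q')
    have "?a = (?a * ennreal q') * ennreal (1 / q')"
      using q' by (simp add: mult.assoc flip: ennreal_mult)
    also have "\<dots> \<le> (ennreal K * average M A (\<lambda>x. ennreal (w x))) * ennreal (1 / q')"
      by (intro mult_right_mono le) auto
    also have "\<dots> = (ennreal K * ennreal (1 / q')) * average M A (\<lambda>x. ennreal (w x))"
      by (simp add: mult_ac)
    also have "ennreal K * ennreal (1 / q') = ennreal (K / q')"
      using q' K by (simp flip: ennreal_mult)
    finally show ?thesis .
  qed
  then show ?thesis using q' K by (intro exI[of _ "K / q'"]) auto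
qed

lemma A1_average_linked:
  assumes "linked A B" and K: "1 \<le> K"
  shows "\<exists>c>0. \<forall>w. A1 K w \<longrightarrow> average M B (\<lambda>x. ennreal (w x)) \<le> ennreal c * average M A (\<lambda>x. ennreal (w x))"
  using assms(1) unfolding linked_def
proof (induction rule: rtranclp_induct)
  case base
  show ?case by (intro exI[of _ 1]) auto
next
  case (step B C)
  obtain c where c: "0 < c" "\<And>w. A1 K w \<Longrightarrow>
      average M B (\<lambda>x. ennreal (w x)) \<le> ennreal c * average M A (\<lambda>x. ennreal (w x))"
    using step.IH by blast
  obtain d where d: "0 < d" "\<And>w. A1 K w \<Longrightarrow>
      average M C (\<lambda>x. ennreal (w x)) \<le> ennreal d * average M B (\<lambda>x. ennreal (w x))"
    using A1_average_step[of B C K] step.hyps(2) K by blast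
  have "average M C (\<lambda>x. ennreal (w x)) \<le> ennreal (d * c) * average M A (\<lambda>x. ennreal (w x))" if "A1 K w" for w
  proof -
    have "average M C (\<lambda>x. ennreal (w x)) \<le> ennreal d * average M B (\<lambda>x. ennreal (w x))"
      by (rule d(2)[OF that])
    also have "\<dots> \<le> ennreal d * (ennreal c * average M A (\<lambda>x. ennreal (w x)))"
      by (intro mult_left_mono c(2)[OF that]) auto
    also have "\<dots> = ennreal (d * c) * average M A (\<lambda>x. ennreal (w x))"
      using c d by (simp add: ennreal_mult mult.assoc)
    finally show ?thesis .
  qed
  then show ?case using c d by (intro exI[of _ "d * c"]) auto
qed

text \<open>
  A countable subfamily that dominates the averages of the constant \<open>1\<close> covers each member of the basis up to a
  null set.
\<close>

lemma countable_cover: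
  obtains e :: "nat \<Rightarrow> 'a set" where "\<And>n. e n \<in> \<B>"
    "\<And>B. B \<in> \<B> \<Longrightarrow> AE x in M. x \<in> B \<longrightarrow> (\<exists>n. x \<in> e n)"
proof -
  obtain C where C: "dominating (\<lambda>_. 1) C" using dominating_exists by blast
  obtain B0 where B0: "B0 \<in> \<B>" using basis_nonempty by blast
  define e where "e = from_nat_into (insert B0 C)"
  have ran: "range e = insert B0 C"
    unfolding e_def using C by (intro range_from_nat_into) (auto simp: dominating_def)
  show ?thesis
  proof
    show "e n \<in> \<B>" for n
      using ran C B0 by (auto simp: dominating_def)
    show "AE x in M. x \<in> B \<longrightarrow> (\<exists>n. x \<in> e n)" if B: "B \<in> \<B>" for B
    proof -
      have "AE x in M. x \<in> B \<longrightarrow> 1 \<le> sup_average C (\<lambda>_. 1) x"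
        using C B by (auto simp: dominating_def average_const)
      then show ?thesis
      proof eventually_elim
        case (elim x)
        show ?case
        proof
          assume "x \<in> B"
          then have le: "1 \<le> sup_average C (\<lambda>_. 1) x" using elim by auto
          have "\<exists>B'\<in>C. x \<in> B'"
          proof (rule ccontr)
            assume "\<not> (\<exists>B'\<in>C. x \<in> B')"
            then have "sup_average C (\<lambda>_. 1) x \<le> 0"
              unfolding sup_average_def by (intro SUP_least) auto
            then show False using le by (auto dest: order_trans)
          qed
          then show "\<exists>n. x \<in> e n" using ran by blast
        qed
      qed
    qed
  qed
qed

text \<open>
  The factors by which a weight may be rescaled without affecting its \<open>A\<^sub>1\<close> constant. The
  values on overlapping members agree, so they depend on the component only.
\<close>

definition component_constant :: "('a \<Rightarrow> real) \<Rightarrow> bool" where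
  "component_constant \<kappa> \<longleftrightarrow> \<kappa> \<in> borel_measurable M \<and> (\<forall>x. 0 < \<kappa> x) \<and>
    (\<forall>B\<in>\<B>. \<exists>c. AE x in M. x \<in> B \<longrightarrow> \<kappa> x = c)"

lemma component_constantE:
  assumes "component_constant \<kappa>" "B \<in> \<B>"
  obtains c where "0 < c" "AE x in M. x \<in> B \<longrightarrow> \<kappa> x = c"
proof -
  obtain c where c: "AE x in M. x \<in> B \<longrightarrow> \<kappa> x = c"
    using assms by (auto simp: component_constant_def)
  have "0 < c"
  proof (rule ccontr)
    assume "\<not> 0 < c"
    then have "AE x in M. x \<notin> B"
      using c assms(1) by (auto simp: component_constant_def)
    then have "AE x in uniform_measure M B. False"
      using AE_on_basis_iff[OF assms(2), of "\<lambda>_. False"] by simp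
    then show False using prob_space.AE_False[OF prob_space_on_basis[OF assms(2)]] by simp
  qed
  then show ?thesis using c that by blast
qed

lemma A1_scale:
  assumes k: "component_constant \<kappa>" and w: "A1 K w"
  shows "A1 K (\<lambda>x. \<kappa> x * w x)"
proof -
  note [measurable] = A1_measurable[OF w]
  have [measurable]: "\<kappa> \<in> borel_measurable M" and kp: "\<And>x. 0 < \<kappa> x"
    using k by (auto simp: component_constant_def)
  have "AE x in M. x \<in> B \<longrightarrow> average M B (\<lambda>x. ennreal (\<kappa> x * w x)) \<le> ennreal (K * (\<kappa> x * w x))"
    if B: "B \<in> \<B>" for B
  proof -
    obtain c where c: "0 < c" "AE x in M. x \<in> B \<longrightarrow> \<kappa> x = c"
      using component_constantE[OF k B] by blast
    have "average M B (\<lambda>x. ennreal (\<kappa> x * w x)) = average M B (\<lambda>x. ennreal c * ennreal (w x))"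
      using c by (intro average_cong B) (auto simp: ennreal_mult')
    also have "\<dots> = ennreal c * average M B (\<lambda>x. ennreal (w x))"
      using B by (simp add: average_cmult)
    finally have eq: "average M B (\<lambda>x. ennreal (\<kappa> x * w x)) = ennreal c * average M B (\<lambda>x. ennreal (w x))" .
    show ?thesis using A1_average[OF w B] c(2)
    proof eventually_elim
      case (elim x)
      show ?case
      proof
        assume x: "x \<in> B"
        have "ennreal c * average M B (\<lambda>x. ennreal (w x)) \<le> ennreal c * ennreal (K * w x)"
          using elim x by (intro mult_left_mono) auto
        also have "\<dots> = ennreal (K * (\<kappa> x * w x))"
          using elim x c(1) by (simp add: mult_ac flip: ennreal_mult')
        finally show "average M B (\<lambda>x. ennreal (\<kappa> x * w x)) \<le> ennreal (K * (\<kappa> x * w x))"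
          by (simp add: eq)
      qed
    qed
  qed
  then show ?thesis using A1_pos[OF w] kp by (auto simp: A1_def)
qed

text \<open>
  Since the operator ignores null sets, it suffices that \<open>\<kappa>\<close> is constant almost everywhere on each member of the
  basis.
\<close>

lemma ess_maximal_scale:
  assumes k: "component_constant \<kappa>" and [measurable]: "f \<in> borel_measurable M"
  shows "AE x in M. ess_maximal f x \<le> ennreal (1 / \<kappa> x) * ess_maximal (\<lambda>x. ennreal (\<kappa> x) * f x) x"
proof (rule ess_maximal_least)
  have [measurable]: "\<kappa> \<in> borel_measurable M" and kp: "\<And>x. 0 < \<kappa> x"
    using k by (auto simp: component_constant_def)
  fix B assume B: "B \<in> \<B>"
  obtain c where c: "0 < c" "AE x in M. x \<in> B \<longrightarrow> \<kappa> x = c"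
    using component_constantE[OF k B] by blast
  have "average M B (\<lambda>x. ennreal (\<kappa> x) * f x) = average M B (\<lambda>x. ennreal c * f x)"
    using c by (intro average_cong B) auto
  also have "\<dots> = ennreal c * average M B f"
    using B by (simp add: average_cmult)
  finally have "ennreal (1 / c) * average M B (\<lambda>x. ennreal (\<kappa> x) * f x) = average M B f"
    using c(1) by (simp add: mult.assoc[symmetric] flip: ennreal_mult')
  then have eq: "average M B f = ennreal (1 / c) * average M B (\<lambda>x. ennreal (\<kappa> x) * f x)" by simp
  show "AE x in M. x \<in> B \<longrightarrow> average M B f \<le> ennreal (1 / \<kappa> x) * ess_maximal (\<lambda>x. ennreal (\<kappa> x) * f x) x"
    using average_le_ess_maximal[OF B, of "\<lambda>x. ennreal (\<kappa> x) * f x"] c(2)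
    by eventually_elim (auto simp: eq intro: mult_left_mono)
qed

text \<open>
  The normalising factor makes the average equal to \<open>1\<close> over one member of a countable cover in each component,
  and makes the weight equal to \<open>1\<close> off the cover. Averages over
  finitely many members of the cover are then bounded above and below uniformly in \<open>w\<close>. The \<open>A\<^sub>1\<close> condition turns the lower
  bound into a pointwise one, and Markov's inequality shows that the weight is rarely large. The
  density \<open>h\<close> makes the measure finite, so that finitely many members suffice.
\<close>

lemma A1_tight:
  assumes K: "1 \<le> K" and e: "0 < (e::real)"
    and [measurable]: "h \<in> borel_measurable M" and h: "\<And>x. 0 < h x" "\<And>x. h x \<le> (1::real)" "integrable M h"
  shows "\<exists>R\<ge>1. \<forall>w. A1 K w \<longrightarrow> (\<exists>\<kappa>. component_constant \<kappa> \<and>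
    emeasure (density M h) {x\<in>space M. \<not> (1 / R \<le> \<kappa> x * w x \<and> \<kappa> x * w x \<le> R)} \<le> ennreal e)"
proof -
  let ?N = "density M (\<lambda>x. ennreal (h x))"
  obtain E :: "nat \<Rightarrow> 'a set" where E: "\<And>n. E n \<in> \<B>"
      "\<And>B. B \<in> \<B> \<Longrightarrow> AE x in M. x \<in> B \<longrightarrow> (\<exists>n. x \<in> E n)"
    by (rule countable_cover, rule that)
  have Esets[measurable]: "\<And>n. E n \<in> sets M" using E(1) basis_sets by auto
  interpret N: finite_measure ?N
    using h by (intro finite_measureI) (simp add: emeasure_density nn_integral_eq_integral less_imp_le cong: nn_integral_cong)
  have N_le: "emeasure ?N X \<le> emeasure M X" if [measurable]: "X \<in> sets M" for X
  proof -
    have "emeasure ?N X = (\<integral>\<^sup>+x. ennreal (h x) * indicator X x \<partial>M)"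
      by (intro emeasure_density) auto
    also have "\<dots> \<le> (\<integral>\<^sup>+x. indicator X x \<partial>M)"
      using h(2) by (intro nn_integral_mono) (auto simp: indicator_def)
    finally show ?thesis by simp
  qed
  \<comment> \<open>the index of the member of the cover that represents the component of \<open>B\<close>\<close>
  define rep where "rep B = (LEAST m. linked (E m) B)" for B
  have rep_linked: "linked (E (rep (E n))) (E n)" for n
    unfolding rep_def by (rule LeastI[of _ n]) (rule linked_refl)
  have rep_eq: "rep A = rep B" if "linked A B" for A B
    unfolding rep_def using linked_trans linked_sym that by (metis (no_types, lifting))
  define idx where "idx x = (LEAST n. x \<in> E n)" for x
  have [measurable]: "idx \<in> measurable M (count_space UNIV)"
    unfolding idx_def by measurable
  have rep_AE: "AE x in M. x \<in> B \<longrightarrow> (\<exists>n. x \<in> E n) \<and> rep (E (idx x)) = rep B" if B: "B \<in> \<B>" for B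
  proof -
    have "AE x in M. x \<in> B \<inter> E n \<longrightarrow> 0 < emeasure M (B \<inter> E n)" for n
    proof (cases "0 < emeasure M (B \<inter> E n)")
      case False
      then have "B \<inter> E n \<in> null_sets M" using basis_sets[OF B] Esets[of n] by (auto simp: null_sets_def)
      then have "AE x in M. x \<notin> B \<inter> E n" by (rule AE_not_in)
      then show ?thesis by eventually_elim auto
    qed auto
    then have "AE x in M. \<forall>n. x \<in> B \<inter> E n \<longrightarrow> 0 < emeasure M (B \<inter> E n)"
      unfolding AE_all_countable by blast
    with E(2)[OF B] show ?thesis
    proof eventually_elim
      case (elim x)
      show ?case
      proof
        assume x: "x \<in> B"
        then obtain n where "x \<in> E n" using elim by auto
        then have "x \<in> E (idx x)" unfolding idx_def by (rule LeastI)
        then have "linked (E (idx x)) B" 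
            using elim x by (intro linked_sym[OF linked_step[OF B E(1)]]) auto
        then show "(\<exists>n. x \<in> E n) \<and> rep (E (idx x)) = rep B" using rep_eq elim x by auto
      qed
    qed
  qed
  \<comment> \<open>all but a small part of the union of the cover lies in its first \<open>n\<close> members\<close>
  define T where "T n = (\<Union>m. E m) - (\<Union>m<n. E m)" for n
  have [measurable]: "T n \<in> sets M" for n unfolding T_def by measurable
  have "decseq T" by (rule decseq_SucI) (auto simp: T_def less_Suc_eq)
  moreover have "(\<Inter>n. T n) = {}" by (auto simp: T_def)
  moreover have "range T \<subseteq> sets ?N" by auto
  ultimately have "(\<lambda>n. emeasure ?N (T n)) \<longlonglongrightarrow> 0"
    using Lim_emeasure_decseq[of T ?N] by auto
  then have "eventually (\<lambda>n. emeasure ?N (T n) < ennreal (e / 2)) sequentially"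
    by (rule order_tendstoD) (use e in auto)
  then obtain n where n: "emeasure ?N (T n) < ennreal (e / 2)" by (auto simp: eventually_sequentially)
  have "\<exists>c>0. \<forall>w. A1 K w \<longrightarrow>
      average M (E i) (\<lambda>x. ennreal (w x)) \<le> ennreal c * average M (E (rep (E i))) (\<lambda>x. ennreal (w x))" for i
    by (rule A1_average_linked[OF rep_linked K])
  then obtain c where c: "\<And>i. 0 < c i" "\<And>i w. A1 K w \<Longrightarrow>
      average M (E i) (\<lambda>x. ennreal (w x)) \<le> ennreal (c i) * average M (E (rep (E i))) (\<lambda>x. ennreal (w x))"
    by metis
  have "\<exists>d>0. \<forall>w. A1 K w \<longrightarrow>
      average M (E (rep (E i))) (\<lambda>x. ennreal (w x)) \<le> ennreal d * average M (E i) (\<lambda>x. ennreal (w x))" for i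
    by (rule A1_average_linked[OF linked_sym[OF rep_linked] K])
  then obtain d where d: "\<And>i. 0 < d i" "\<And>i w. A1 K w \<Longrightarrow>
      average M (E (rep (E i))) (\<lambda>x. ennreal (w x)) \<le> ennreal (d i) * average M (E i) (\<lambda>x. ennreal (w x))"
    by metis
  define S where "S = (\<Sum>i<n. c i * measure M (E i))"
  \<comment> \<open>the middle term serves for the lower bound, the last one makes the exceptional set of the upper bound small\<close>
  define R where "R = 1 + (\<Sum>i<n. K * d i) + 2 * S / e"
  have S0: "0 \<le> S" unfolding S_def using c(1) by (intro sum_nonneg) (simp add: less_imp_le)
  have Kd0: "0 \<le> K * d i" for i using K d(1)[of i] by auto
  have R1: "1 \<le> R" unfolding R_def using S0 e Kd0 by (simp add: sum_nonneg)
  have RKd: "K * d i \<le> R" if "i < n" for i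
  proof -
    have "K * d i \<le> (\<Sum>i<n. K * d i)" using Kd0 that by (intro member_le_sum) auto
    then show ?thesis unfolding R_def using S0 e by (simp add: add_increasing2)
  qed
  have RS: "S / R \<le> e / 2"
  proof -
    have "2 * S / e \<le> R" unfolding R_def using Kd0 by (simp add: sum_nonneg)
    then show ?thesis using e R1 by (simp add: field_simps)
  qed
  show ?thesis
  proof (intro exI[of _ R] conjI allI impI R1)
    fix w assume w: "A1 K w"
    note [measurable] = A1_measurable[OF w]
    define a where "a m = enn2real (average M (E m) (\<lambda>x. ennreal (w x)))" for m
    have a: "0 < a m \<and> average M (E m) (\<lambda>x. ennreal (w x)) = ennreal (a m) \<and> (AE x in M. x \<in> E m \<longrightarrow> a m \<le> K * w x)" for m
      by (rule A1_average_real[OF w E(1)[of m]]) (simp add: a_def)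
    define \<kappa> where "\<kappa> x = (if \<exists>n. x \<in> E n then 1 / a (rep (E (idx x))) else 1 / w x)" for x
    have [measurable]: "\<kappa> \<in> borel_measurable M" unfolding \<kappa>_def by measurable
    have k_B: "AE x in M. x \<in> B \<longrightarrow> \<kappa> x = 1 / a (rep B)" if "B \<in> \<B>" for B
      using rep_AE[OF that] by eventually_elim (simp add: \<kappa>_def)
    have kpos: "0 < \<kappa> x" for x using a A1_pos[OF w, of x] by (simp add: \<kappa>_def)
    have k: "component_constant \<kappa>" using k_B kpos by (auto simp: component_constant_def)
    let ?g = "\<lambda>x. \<kappa> x * w x"
    let ?Bad = "{x\<in>space M. \<not> (1 / R \<le> ?g x \<and> ?g x \<le> R)}"
    have low: "AE x in M. x \<in> E i \<longrightarrow> 1 / R \<le> ?g x" if "i < n" for i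
    proof -
      have "ennreal (a (rep (E i))) \<le> ennreal (d i) * ennreal (a i)"
        using d(2)[OF w, of i] a by simp
      then have "a (rep (E i)) \<le> d i * a i"
        using d(1)[of i] a[of i] by (simp flip: ennreal_mult)
      have "AE x in M. x \<in> E i \<longrightarrow> a i \<le> K * w x" using a by blast
      with k_B[OF E(1)[of i]] show ?thesis
      proof eventually_elim
        case (elim x)
        show ?case
        proof
          assume x: "x \<in> E i"
          have "a (rep (E i)) \<le> d i * (K * w x)"
            using \<open>a (rep (E i)) \<le> d i * a i\<close> elim x d(1)[of i]
            by (meson mult_left_mono less_imp_le order_trans)
          also have "\<dots> = (K * d i) * w x" by simp
          also have "\<dots> \<le> R * w x" using RKd[OF that] A1_pos[OF w, of x] by (intro mult_right_mono) auto
          finally have "1 / R \<le> 1 / a (rep (E i)) * w x"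
            using a[of "rep (E i)"] R1 by (simp add: field_simps)
          then show "1 / R \<le> ?g x" using elim x by simp
        qed
      qed
    qed
    have high: "emeasure M {x\<in>E i. R < ?g x} \<le> ennreal (c i * measure M (E i) / R)" for i
    proof -
      let ?m = "rep (E i)"
      have "(\<integral>\<^sup>+x\<in>E i. ennreal (?g x) \<partial>M) = average M (E i) (\<lambda>x. ennreal (?g x)) * emeasure M (E i)"
        unfolding average_def using basis_pos[OF E(1)[of i]] basis_finite[OF E(1)[of i]]
        by (simp add: ennreal_divide_times ennreal_mult_divide_eq)
      also have "average M (E i) (\<lambda>x. ennreal (?g x)) = average M (E i) (\<lambda>x. ennreal (1 / a ?m) * ennreal (w x))"
        using k_B[OF E(1)[of i]] a[of ?m] by (intro average_cong E(1)) (auto simp flip: ennreal_mult')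
      also have "\<dots> = ennreal (1 / a ?m) * average M (E i) (\<lambda>x. ennreal (w x))"
        using E(1) by (simp add: average_cmult)
      also have "\<dots> \<le> ennreal (1 / a ?m) * (ennreal (c i) * ennreal (a ?m))"
        using c(2)[OF w, of i] a[of ?m] by (intro mult_left_mono) auto
      also have "\<dots> = ennreal (c i)"
        using a[of ?m] c(1)[of i] by (simp flip: ennreal_mult' ennreal_mult'')
      also have "emeasure M (E i) = ennreal (measure M (E i))"
        using basis_finite[OF E(1)[of i]] by (intro emeasure_eq_ennreal_measure) auto
      finally have int: "(\<integral>\<^sup>+x\<in>E i. ennreal (?g x) \<partial>M) \<le> ennreal (c i) * ennreal (measure M (E i))"
        by (simp add: mult_right_mono)
      have "emeasure M {x\<in>E i. R < ?g x} \<le> emeasure M {x\<in>E i. 1 \<le> ennreal (1 / R) * ennreal (?g x)}"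
        using R1 sets.sets_into_space[OF Esets[of i]]
        by (intro emeasure_mono) (auto simp flip: ennreal_mult')
      also have "\<dots> \<le> ennreal (1 / R) * (\<integral>\<^sup>+x\<in>E i. ennreal (?g x) \<partial>M)"
        using sets.sets_into_space[OF Esets[of i]] by (intro nn_integral_Markov_inequality) auto
      also have "\<dots> \<le> ennreal (1 / R) * (ennreal (c i) * ennreal (measure M (E i)))"
        by (intro mult_left_mono int) auto
      also have "\<dots> = ennreal (c i * measure M (E i) / R)"
        using R1 c(1)[of i] by (simp flip: ennreal_mult')
      finally show ?thesis .
    qed
    have "?Bad \<subseteq> T n \<union> (\<Union>i<n. {x\<in>E i. R < ?g x}) \<union> (\<Union>i<n. {x\<in>E i. \<not> 1 / R \<le> ?g x})"
    proof
      fix x assume x: "x \<in> ?Bad"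
      have "\<exists>n. x \<in> E n"
      proof (rule ccontr)
        assume "\<not> (\<exists>n. x \<in> E n)"
        then have "?g x = 1" using A1_pos[OF w, of x] by (simp add: \<kappa>_def)
        then show False using x R1 by auto
      qed
      then show "x \<in> T n \<union> (\<Union>i<n. {x\<in>E i. R < ?g x}) \<union> (\<Union>i<n. {x\<in>E i. \<not> 1 / R \<le> ?g x})"
        using x by (auto simp: T_def)
    qed
    moreover have "{x\<in>E i. R < ?g x} \<in> sets M" "{x\<in>E i. \<not> 1 / R \<le> ?g x} \<in> sets M" for i
      using sets.sets_into_space[OF Esets[of i]] by (auto simp: Int_def[symmetric] intro!: sets.sets_Collect_conj)
    note this[measurable]
    ultimately have "emeasure ?N ?Bad \<le>
        emeasure ?N (T n \<union> (\<Union>i<n. {x\<in>E i. R < ?g x}) \<union> (\<Union>i<n. {x\<in>E i. \<not> 1 / R \<le> ?g x}))"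
      by (intro emeasure_mono) auto
    also have "\<dots> \<le> emeasure ?N (T n \<union> (\<Union>i<n. {x\<in>E i. R < ?g x})) + emeasure ?N (\<Union>i<n. {x\<in>E i. \<not> 1 / R \<le> ?g x})"
      by (intro emeasure_subadditive) auto
    also have "emeasure ?N (\<Union>i<n. {x\<in>E i. \<not> 1 / R \<le> ?g x}) = 0"
    proof -
      have "AE x in M. \<forall>i\<in>{..<n}. x \<in> E i \<longrightarrow> 1 / R \<le> ?g x"
        using low by (intro AE_finite_allI) auto
      then have "AE x in M. x \<notin> (\<Union>i<n. {x\<in>E i. \<not> 1 / R \<le> ?g x})"
        by eventually_elim auto
      then have "emeasure M (\<Union>i<n. {x\<in>E i. \<not> 1 / R \<le> ?g x}) = 0"
        by (subst (asm) AE_iff_null_sets[symmetric]) auto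
      then show ?thesis using N_le[of "\<Union>i<n. {x\<in>E i. \<not> 1 / R \<le> ?g x}"] by simp
    qed
    also have "emeasure ?N (T n \<union> (\<Union>i<n. {x\<in>E i. R < ?g x}))
        \<le> emeasure ?N (T n) + emeasure ?N (\<Union>i<n. {x\<in>E i. R < ?g x})"
      by (intro emeasure_subadditive) auto
    also have "emeasure ?N (\<Union>i<n. {x\<in>E i. R < ?g x}) \<le> emeasure M (\<Union>i<n. {x\<in>E i. R < ?g x})"
      by (intro N_le) auto
    also have "\<dots> \<le> (\<Sum>i<n. emeasure M {x\<in>E i. R < ?g x})"
      by (intro emeasure_subadditive_finite) auto
    also have "\<dots> \<le> (\<Sum>i<n. ennreal (c i * measure M (E i) / R))"
      by (intro sum_mono high)
    also have "\<dots> = ennreal (S / R)"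
      using c(1) R1 unfolding S_def sum_divide_distrib by (intro sum_ennreal) (auto simp: less_imp_le)
    also have "\<dots> \<le> ennreal (e / 2)" by (intro ennreal_leI RS)
    also have "emeasure ?N (T n) \<le> ennreal (e / 2)" using n by simp
    finally have "emeasure ?N ?Bad \<le> ennreal (e / 2) + ennreal (e / 2)"
      by (simp add: add_right_mono add_left_mono)
    also have "\<dots> = ennreal e" using e by (simp flip: ennreal_plus)
    finally have "emeasure ?N ?Bad \<le> ennreal e" .
    then show "\<exists>\<kappa>. component_constant \<kappa> \<and>
        emeasure ?N {x\<in>space M. \<not> (1 / R \<le> \<kappa> x * w x \<and> \<kappa> x * w x \<le> R)} \<le> ennreal e"
      using k by blast
  qed
qed

end

section \<open>A uniform bound for the essential maximal operator\<close>

text \<open>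
  A weight that is comparable to \<open>w\<close> everywhere and close to \<open>v\<close> where \<open>v\<close> and \<open>w\<close> are of similar size. Being built from
  sums, minima and positive multiples, it keeps the \<open>A\<^sub>1\<close> constant.
\<close>

definition blend :: "real \<Rightarrow> real \<Rightarrow> real \<Rightarrow> real" where
  "blend L v w = min (v + 1 / L * w) (L * w)"

lemma blend_bounds:
  assumes "1 \<le> L" "0 < v" "0 < w"
  shows "w / L \<le> blend L v w" "blend L v w \<le> L * w" "0 < blend L v w"
proof -
  have "w / L \<le> L * w"
  proof -
    have "w / L \<le> w / 1" using assms by (intro divide_left_mono) auto
    also have "\<dots> \<le> L * w" using assms by simp
    finally show ?thesis .
  qed
  then show 1: "w / L \<le> blend L v w" using assms by (simp add: blend_def)
  show "blend L v w \<le> L * w" by (simp add: blend_def)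
  have "0 < w / L" using assms by simp
  then show "0 < blend L v w" using 1 by linarith
qed

lemma ln_blend_close:
  assumes R: "1 \<le> R" and L: "R\<^sup>2 + 1 \<le> L"
    and v: "1 / R \<le> v" "v \<le> R" and w: "1 / R \<le> w" "w \<le> R"
  shows "\<bar>ln (blend L v w) - ln v\<bar> \<le> R\<^sup>2 / L"
proof -
  have pos: "0 < v" "0 < w" using R v w by (auto intro: less_le_trans[of 0 "1 / R"])
  have L1: "1 \<le> L" using L by (simp add: add_increasing order_trans[OF _ L])
  have "v \<le> R\<^sup>2 * w"
  proof -
    have "v \<le> R" by fact
    also have "R = R\<^sup>2 * (1 / R)" using R by (simp add: power2_eq_square)
    also have "\<dots> \<le> R\<^sup>2 * w" using w by (intro mult_left_mono) auto
    finally show ?thesis .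
  qed
  moreover have "1 / L * w \<le> w" using L1 pos by (simp add: field_simps)
  ultimately have "v + 1 / L * w \<le> (R\<^sup>2 + 1) * w" by (simp add: algebra_simps)
  also have "\<dots> \<le> L * w" using L pos by (intro mult_right_mono) auto
  finally have eq: "blend L v w = v * (1 + w / (L * v))"
    using pos L1 by (simp add: blend_def field_simps)
  have "0 < 1 + w / (L * v)" using pos L1 by (intro add_pos_pos) auto
  then have "ln (blend L v w) - ln v = ln (1 + w / (L * v))"
    unfolding eq using pos by (simp add: ln_mult)
  moreover have "0 \<le> ln (1 + w / (L * v))" using pos L1 by (intro ln_ge_zero) auto
  moreover have "ln (1 + w / (L * v)) \<le> w / (L * v)"
    using pos L1 by (intro ln_add_one_self_le_self) auto
  moreover have "w / (L * v) \<le> R\<^sup>2 / L"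
  proof -
    have "w \<le> R\<^sup>2 * v"
    proof -
      have "w \<le> R" by fact
      also have "R = R\<^sup>2 * (1 / R)" using R by (simp add: power2_eq_square)
      also have "\<dots> \<le> R\<^sup>2 * v" using v by (intro mult_left_mono) auto
      finally show ?thesis .
    qed
    then show ?thesis using pos L1 by (simp add: field_simps)
  qed
  ultimately show ?thesis by linarith
qed

lemma borel_measurable_fst_real:
  fixes f :: "'a \<Rightarrow> real \<times> real"
  assumes "f \<in> borel_measurable M"
  shows "(\<lambda>x. fst (f x)) \<in> borel_measurable M"
  by (rule measurable_compose[OF assms borel_measurable_continuous_onI]) (intro continuous_intros)

lemma borel_measurable_snd_real:
  fixes f :: "'a \<Rightarrow> real \<times> real"
  assumes "f \<in> borel_measurable M"
  shows "(\<lambda>x. snd (f x)) \<in> borel_measurable M"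
  by (rule measurable_compose[OF assms borel_measurable_continuous_onI]) (intro continuous_intros)

context muckenhoupt
begin

definition factored_weight :: "real \<Rightarrow> ('a \<Rightarrow> real \<times> real) \<Rightarrow> 'a \<Rightarrow> real" where
  "factored_weight t \<phi> x = exp (fst (\<phi> x)) * exp (snd (\<phi> x)) powr (1 - t)"

text \<open>
  Logarithms turn comparability of weights into closeness of functions with values in a Banach space, and
  make the limit of positive weights positive.
\<close>

definition log_A1_pairs :: "real \<Rightarrow> ('a \<Rightarrow> real \<times> real) set" where
  "log_A1_pairs K = {\<phi> \<in> borel_measurable M. A1 K (\<lambda>x. exp (fst (\<phi> x))) \<and> A1 K (\<lambda>x. exp (snd (\<phi> x)))}"

definition maximal_bound :: "real \<Rightarrow> ennreal \<Rightarrow> ('a \<Rightarrow> real) \<Rightarrow> bool" where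
  "maximal_bound t C W \<longleftrightarrow> (\<forall>f\<in>borel_measurable M.
    (\<integral>\<^sup>+x. ess_maximal f x epowr t * ennreal (W x) \<partial>M) \<le> C * (\<integral>\<^sup>+x. f x epowr t * ennreal (W x) \<partial>M))"

lemma maximal_boundD:
  "maximal_bound t C W \<Longrightarrow> f \<in> borel_measurable M \<Longrightarrow>
    (\<integral>\<^sup>+x. ess_maximal f x epowr t * ennreal (W x) \<partial>M) \<le> C * (\<integral>\<^sup>+x. f x epowr t * ennreal (W x) \<partial>M)"
  by (simp add: maximal_bound_def)

lemma ess_maximal_liminf:
  assumes [measurable]: "f \<in> borel_measurable M" "\<And>m. g m \<in> borel_measurable M"
    and le: "AE x in M. f x \<le> liminf (\<lambda>m. g m x)"
  shows "AE x in M. ess_maximal f x \<le> liminf (\<lambda>m. ess_maximal (g m) x)"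
proof (rule ess_maximal_least)
  fix B assume B: "B \<in> \<B>"
  have "average M B f \<le> average M B (\<lambda>x. liminf (\<lambda>m. g m x))"
    using le B by (intro average_mono) auto
  also have "\<dots> \<le> liminf (\<lambda>m. average M B (g m))" by (intro average_liminf B) auto
  finally have 1: "average M B f \<le> liminf (\<lambda>m. average M B (g m))" .
  have "AE x in M. \<forall>m. x \<in> B \<longrightarrow> average M B (g m) \<le> ess_maximal (g m) x"
    unfolding AE_all_countable using average_le_ess_maximal[OF B] by blast
  then show "AE x in M. x \<in> B \<longrightarrow> average M B f \<le> liminf (\<lambda>m. ess_maximal (g m) x)"
    by eventually_elim (auto intro!: order_trans[OF 1] Liminf_mono)
qed

text \<open>
  Fatou's lemma bounds the left-hand side for \<open>V\<close> by the lower limit of those for \<open>W k\<close>. For the right-hand side the convergence is dominated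
  only where \<open>W k \<le> 2 V\<close> for all \<open>k \<ge> m\<close>, so \<open>f\<close> is first restricted to that set, and then \<open>m\<close> tends to infinity.
\<close>

lemma maximal_bound_limit:
  assumes b: "\<And>k. maximal_bound t (ennreal C) (W k)" and C: "0 < C" and t: "1 < t"
    and [measurable]: "\<And>k. W k \<in> borel_measurable M" "V \<in> borel_measurable M" and V: "\<And>x. 0 < V x"
    and lim: "AE x in M. (\<lambda>k. W k x) \<longlonglongrightarrow> V x"
  shows "maximal_bound t (ennreal C) V"
  unfolding maximal_bound_def
proof
  fix f :: "'a \<Rightarrow> ennreal" assume [measurable]: "f \<in> borel_measurable M"
  let ?I = "\<integral>\<^sup>+x. f x epowr t * ennreal (V x) \<partial>M"
  show "(\<integral>\<^sup>+x. ess_maximal f x epowr t * ennreal (V x) \<partial>M) \<le> ennreal C * ?I"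
  proof (cases "?I = \<infinity>")
    case True
    then show ?thesis using C by (simp add: ennreal_mult_top)
  next
    case False
    define D where "D m = {x\<in>space M. \<forall>k. W (k + m) x \<le> 2 * V x}" for m
    have [measurable]: "D m \<in> sets M" for m unfolding D_def by measurable
    define g where "g m x = f x * indicator (D m) x" for m x
    have [measurable]: "g m \<in> borel_measurable M" for m unfolding g_def by measurable
    have g_le: "g m x \<le> f x" for m x by (auto simp: g_def indicator_def)
    have bound: "(\<integral>\<^sup>+x. ess_maximal (g m) x epowr t * ennreal (V x) \<partial>M) \<le> ennreal C * ?I" for m
    proof -
      have limW: "AE x in M. (\<lambda>k. ennreal (W (k + m) x)) \<longlonglongrightarrow> ennreal (V x)"
        using lim by eventually_elim (auto intro!: tendsto_ennrealI LIMSEQ_ignore_initial_segment)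
      have "AE x in M. ess_maximal (g m) x epowr t * ennreal (V x) \<le>
          liminf (\<lambda>k. ess_maximal (g m) x epowr t * ennreal (W (k + m) x))"
        using limW
      proof eventually_elim
        case (elim x)
        let ?a = "ess_maximal (g m) x epowr t"
        have "?a * ennreal (V x) = ?a * liminf (\<lambda>k. ennreal (W (k + m) x))"
          using lim_imp_Liminf[OF _ elim] by simp
        also have "\<dots> \<le> liminf (\<lambda>k. ?a * ennreal (W (k + m) x))"
        proof (cases "?a = \<infinity>")
          case True
          have "eventually (\<lambda>k. 0 < ennreal (W (k + m) x)) sequentially"
            using order_tendstoD(1)[OF elim, of 0] V[of x] by simp
          then have "eventually (\<lambda>k. top \<le> ?a * ennreal (W (k + m) x)) sequentially"
            by eventually_elim (use True in \<open>auto simp: ennreal_top_mult\<close>)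
          then have "top \<le> liminf (\<lambda>k. ?a * ennreal (W (k + m) x))"
            by (rule Liminf_bounded)
          then show ?thesis by (simp add: top_unique)
        next
          case False
          then have "(\<lambda>k. ?a * ennreal (W (k + m) x)) \<longlonglongrightarrow> ?a * ennreal (V x)"
            by (intro ennreal_tendsto_cmult elim) (simp add: less_top)
          then show ?thesis
            using lim_imp_Liminf[OF _ elim] by (simp add: lim_imp_Liminf)
        qed
        finally show ?case .
      qed
      then have "(\<integral>\<^sup>+x. ess_maximal (g m) x epowr t * ennreal (V x) \<partial>M)
          \<le> (\<integral>\<^sup>+x. liminf (\<lambda>k. ess_maximal (g m) x epowr t * ennreal (W (k + m) x)) \<partial>M)"
        by (rule nn_integral_mono_AE)
      also have "\<dots> \<le> liminf (\<lambda>k. \<integral>\<^sup>+x. ess_maximal (g m) x epowr t * ennreal (W (k + m) x) \<partial>M)"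
        by (intro nn_integral_liminf) auto
      also have "\<dots> \<le> liminf (\<lambda>k. ennreal C * (\<integral>\<^sup>+x. g m x epowr t * ennreal (W (k + m) x) \<partial>M))"
        by (intro Liminf_mono always_eventually allI maximal_boundD[OF b]) auto
      also have "\<dots> = ennreal C * (\<integral>\<^sup>+x. g m x epowr t * ennreal (V x) \<partial>M)"
      proof (intro lim_imp_Liminf ennreal_tendsto_cmult nn_integral_dominated_convergence[where w="\<lambda>x. 2 * (f x epowr t * ennreal (V x))"])
        show "(\<integral>\<^sup>+x. 2 * (f x epowr t * ennreal (V x)) \<partial>M) < \<infinity>"
          using False by (simp add: nn_integral_cmult ennreal_mult_less_top less_top)
        show "AE x in M. g m x epowr t * ennreal (W (k + m) x) \<le> 2 * (f x epowr t * ennreal (V x))" for k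
        proof (rule AE_I2)
          fix x assume "x \<in> space M"
          show "g m x epowr t * ennreal (W (k + m) x) \<le> 2 * (f x epowr t * ennreal (V x))"
          proof (cases "x \<in> D m")
            case True
            then have "ennreal (W (k + m) x) \<le> ennreal (2 * V x)" by (intro ennreal_leI) (auto simp: D_def)
            also have "\<dots> = 2 * ennreal (V x)" using V[of x] by (simp add: ennreal_mult')
            finally have "g m x epowr t * ennreal (W (k + m) x) \<le> f x epowr t * (2 * ennreal (V x))"
              using t g_le by (intro mult_mono epowr_mono) auto
            then show ?thesis by (simp add: mult_ac)
          next
            case False
            then show ?thesis using t by (simp add: g_def epowr_zero)
          qed
        qed
        show "AE x in M. (\<lambda>k. g m x epowr t * ennreal (W (k + m) x)) \<longlonglongrightarrow> g m x epowr t * ennreal (V x)"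
        proof -
          have "AE x in M. f x epowr t * ennreal (V x) \<noteq> \<infinity>"
            using False by (intro nn_integral_PInf_AE) auto
          with limW show ?thesis
          proof eventually_elim
            case (elim x)
            have "f x epowr t \<noteq> \<infinity>"
            proof
              assume "f x epowr t = \<infinity>"
              then show False using elim(2) V[of x] by (simp add: ennreal_top_mult)
            qed
            moreover have "g m x epowr t \<le> f x epowr t" using t by (intro epowr_mono g_le) auto
            ultimately have "g m x epowr t < top" by (auto simp: less_top[symmetric] top_unique)
            then show ?case by (intro ennreal_tendsto_cmult elim)
          qed
        qed
      qed auto
      also have "\<dots> \<le> ennreal C * ?I"
        using t by (intro mult_left_mono nn_integral_mono mult_right_mono epowr_mono g_le) auto
      finally show ?thesis .
    qed
    have "AE x in M. f x \<le> liminf (\<lambda>m. g m x)"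
      using lim AE_space
    proof eventually_elim
      case (elim x)
      have "eventually (\<lambda>k. W k x < 2 * V x) sequentially"
        using V[of x] by (intro order_tendstoD(2)[OF elim(1)]) auto
      then obtain m0 where m0: "\<And>k. k \<ge> m0 \<Longrightarrow> W k x < 2 * V x" by (auto simp: eventually_sequentially)
      have "eventually (\<lambda>m. f x \<le> g m x) sequentially"
        unfolding eventually_sequentially
      proof (intro exI[of _ m0] allI impI)
        fix m assume "m \<ge> m0"
        then have "x \<in> D m" using m0 elim(2) by (auto simp: D_def less_imp_le)
        then show "f x \<le> g m x" by (simp add: g_def)
      qed
      then show ?case by (rule Liminf_bounded)
    qed
    then have "AE x in M. ess_maximal f x \<le> liminf (\<lambda>m. ess_maximal (g m) x)"
      by (intro ess_maximal_liminf) auto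
    then have "AE x in M. ess_maximal f x epowr t * ennreal (V x)
        \<le> liminf (\<lambda>m. ess_maximal (g m) x epowr t * ennreal (V x))"
    proof eventually_elim
      case (elim x)
      have "ess_maximal f x epowr t \<le> liminf (\<lambda>m. ess_maximal (g m) x epowr t)"
        using elim t by (intro le_liminf_epowr) auto
      then have "ess_maximal f x epowr t * ennreal (V x) \<le> ennreal (V x) * liminf (\<lambda>m. ess_maximal (g m) x epowr t)"
        by (simp add: mult_left_mono mult.commute)
      also have "\<dots> = liminf (\<lambda>m. ennreal (V x) * ess_maximal (g m) x epowr t)"
        by (rule Liminf_compose_continuous_mono[symmetric, where f="\<lambda>y. ennreal (V x) * y"])
          (auto simp: mono_def mult_left_mono intro!: ennreal_continuous_on_cmult)
      finally show ?case by (simp add: mult.commute)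
    qed
    then have "(\<integral>\<^sup>+x. ess_maximal f x epowr t * ennreal (V x) \<partial>M)
        \<le> (\<integral>\<^sup>+x. liminf (\<lambda>m. ess_maximal (g m) x epowr t * ennreal (V x)) \<partial>M)"
      by (rule nn_integral_mono_AE)
    also have "\<dots> \<le> liminf (\<lambda>m. \<integral>\<^sup>+x. ess_maximal (g m) x epowr t * ennreal (V x) \<partial>M)"
      by (intro nn_integral_liminf) auto
    also have "\<dots> \<le> liminf (\<lambda>m. ennreal C * ?I)"
      by (intro Liminf_mono always_eventually allI bound)
    finally show ?thesis by (simp add: Liminf_const)
  qed
qed

lemma maximal_bound_comparable:
  assumes b: "maximal_bound t (ennreal C) W" and c: "0 < c" and C: "0 \<le> C" and t: "0 < t"
    and [measurable]: "W \<in> borel_measurable M" "V \<in> borel_measurable M"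
    and le: "\<And>x. V x \<le> c * W x" "\<And>x. W x \<le> c * V x" 
  shows "maximal_bound t (ennreal (c\<^sup>2 * C)) V"
  unfolding maximal_bound_def
proof
  fix f :: "'a \<Rightarrow> ennreal" assume [measurable]: "f \<in> borel_measurable M"
  have e: "ennreal a \<le> ennreal c * ennreal b" if "a \<le> c * b" for a b
    using ennreal_leI[OF that] c by (simp add: ennreal_mult')
  have "(\<integral>\<^sup>+x. ess_maximal f x epowr t * ennreal (V x) \<partial>M)
      \<le> (\<integral>\<^sup>+x. ess_maximal f x epowr t * (ennreal c * ennreal (W x)) \<partial>M)"
    by (intro nn_integral_mono mult_left_mono e le) auto
  also have "\<dots> = ennreal c * (\<integral>\<^sup>+x. ess_maximal f x epowr t * ennreal (W x) \<partial>M)"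
    by (subst nn_integral_cmult[symmetric]) (auto simp: mult_ac)
  also have "\<dots> \<le> ennreal c * (ennreal C * (\<integral>\<^sup>+x. f x epowr t * ennreal (W x) \<partial>M))"
    by (intro mult_left_mono maximal_boundD[OF b]) auto
  also have "\<dots> \<le> ennreal c * (ennreal C * (\<integral>\<^sup>+x. f x epowr t * (ennreal c * ennreal (V x)) \<partial>M))"
    by (intro mult_left_mono nn_integral_mono e le) auto
  also have "(\<integral>\<^sup>+x. f x epowr t * (ennreal c * ennreal (V x)) \<partial>M) = ennreal c * (\<integral>\<^sup>+x. f x epowr t * ennreal (V x) \<partial>M)"
    by (subst nn_integral_cmult[symmetric]) (auto simp: mult_ac)
  also have "ennreal c * (ennreal C * (ennreal c * (\<integral>\<^sup>+x. f x epowr t * ennreal (V x) \<partial>M)))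
      = ennreal (c\<^sup>2 * C) * (\<integral>\<^sup>+x. f x epowr t * ennreal (V x) \<partial>M)"
    using c C by (simp add: power2_eq_square ennreal_mult mult_ac)
  finally show "(\<integral>\<^sup>+x. ess_maximal f x epowr t * ennreal (V x) \<partial>M)
      \<le> ennreal (c\<^sup>2 * C) * (\<integral>\<^sup>+x. f x epowr t * ennreal (V x) \<partial>M)" .
qed

lemma component_constant_powr:
  assumes "component_constant \<kappa>"
  shows "component_constant (\<lambda>x. \<kappa> x powr s)"
  unfolding component_constant_def
proof (intro conjI ballI allI)
  show "(\<lambda>x. \<kappa> x powr s) \<in> borel_measurable M" using assms by (auto simp: component_constant_def)
  show "0 < \<kappa> x powr s" for x using assms by (auto simp: component_constant_def less_imp_neq[symmetric])
  fix B assume "B \<in> \<B>"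
  then obtain c where "AE x in M. x \<in> B \<longrightarrow> \<kappa> x = c" using assms by (auto simp: component_constant_def)
  then have "AE x in M. x \<in> B \<longrightarrow> \<kappa> x powr s = c powr s" by eventually_elim auto
  then show "\<exists>c. AE x in M. x \<in> B \<longrightarrow> \<kappa> x powr s = c" by blast
qed

lemma component_constant_mult:
  assumes "component_constant \<kappa>" "component_constant \<sigma>"
  shows "component_constant (\<lambda>x. \<kappa> x * \<sigma> x)"
  unfolding component_constant_def
proof (intro conjI ballI allI)
  show "(\<lambda>x. \<kappa> x * \<sigma> x) \<in> borel_measurable M" using assms by (auto simp: component_constant_def)
  show "0 < \<kappa> x * \<sigma> x" for x using assms by (auto simp: component_constant_def)
  fix B assume "B \<in> \<B>"
  then obtain c d where "AE x in M. x \<in> B \<longrightarrow> \<kappa> x = c" "AE x in M. x \<in> B \<longrightarrow> \<sigma> x = d"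
    using assms unfolding component_constant_def by blast
  then have "AE x in M. x \<in> B \<longrightarrow> \<kappa> x * \<sigma> x = c * d" by eventually_elim auto
  then show "\<exists>c. AE x in M. x \<in> B \<longrightarrow> \<kappa> x * \<sigma> x = c" by blast
qed

text \<open>
  On each component the factor \<open>\<kappa>\<close> is constant and can be moved from the weight into the function, as \<open>\<kappa>\<^sup>1\<^sup>/\<^sup>t\<close>.
\<close>

lemma maximal_bound_unscale:
  assumes b: "maximal_bound t C (\<lambda>x. \<kappa> x * W x)" and k: "component_constant \<kappa>" and t: "0 < t"
    and [measurable]: "W \<in> borel_measurable M" and W: "\<And>x. 0 < W x"
  shows "maximal_bound t C W"
  unfolding maximal_bound_def
proof
  fix f :: "'a \<Rightarrow> ennreal" assume [measurable]: "f \<in> borel_measurable M"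
  have [measurable]: "\<kappa> \<in> borel_measurable M" and kp: "\<And>x. 0 < \<kappa> x"
    using k by (auto simp: component_constant_def)
  define \<sigma> where "\<sigma> x = \<kappa> x powr (-1/t)" for x
  have l: "component_constant \<sigma>" unfolding \<sigma>_def by (rule component_constant_powr[OF k])
  have [measurable]: "\<sigma> \<in> borel_measurable M" and lp: "\<And>x. 0 < \<sigma> x"
    using l by (auto simp: component_constant_def)
  define g where "g x = ennreal (\<sigma> x) * f x" for x
  have [measurable]: "g \<in> borel_measurable M" unfolding g_def by measurable
  have inv: "ennreal (1 / \<sigma> x) epowr t = ennreal (\<kappa> x)" "ennreal (\<sigma> x) epowr t = ennreal (1 / \<kappa> x)" for x
    using kp[of x] lp[of x] t
    by (auto simp: epowr_ennreal powr_divide \<sigma>_def powr_powr powr_minus inverse_eq_divide)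
  have "(\<integral>\<^sup>+x. ess_maximal f x epowr t * ennreal (W x) \<partial>M)
      \<le> (\<integral>\<^sup>+x. (ennreal (1 / \<sigma> x) * ess_maximal g x) epowr t * ennreal (W x) \<partial>M)"
  proof (rule nn_integral_mono_AE)
    show "AE x in M. ess_maximal f x epowr t * ennreal (W x)
        \<le> (ennreal (1 / \<sigma> x) * ess_maximal g x) epowr t * ennreal (W x)"
      using ess_maximal_scale[OF l, of f] unfolding g_def
      by (auto elim!: eventually_mono intro!: mult_right_mono epowr_mono t)
  qed
  also have "\<dots> = (\<integral>\<^sup>+x. ess_maximal g x epowr t * ennreal (\<kappa> x * W x) \<partial>M)"
  proof (intro nn_integral_cong)
    fix x
    have "ennreal (\<kappa> x * W x) = ennreal (\<kappa> x) * ennreal (W x)"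
      using kp[of x] by (simp add: ennreal_mult')
    then show "(ennreal (1 / \<sigma> x) * ess_maximal g x) epowr t * ennreal (W x)
        = ess_maximal g x epowr t * ennreal (\<kappa> x * W x)"
      by (simp add: epowr_mult t inv mult_ac)
  qed
  also have "\<dots> \<le> C * (\<integral>\<^sup>+x. g x epowr t * ennreal (\<kappa> x * W x) \<partial>M)"
    by (intro maximal_boundD[OF b]) auto
  also have "(\<integral>\<^sup>+x. g x epowr t * ennreal (\<kappa> x * W x) \<partial>M) = (\<integral>\<^sup>+x. f x epowr t * ennreal (W x) \<partial>M)"
  proof (intro nn_integral_cong)
    fix x
    have "ennreal (1 / \<kappa> x) * ennreal (\<kappa> x * W x) = ennreal (W x)"
      using kp[of x] W[of x] by (simp flip: ennreal_mult')
    then show "g x epowr t * ennreal (\<kappa> x * W x) = f x epowr t * ennreal (W x)"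
      unfolding g_def by (simp add: epowr_mult t inv mult_ac)
  qed
  finally show "(\<integral>\<^sup>+x. ess_maximal f x epowr t * ennreal (W x) \<partial>M) \<le> C * (\<integral>\<^sup>+x. f x epowr t * ennreal (W x) \<partial>M)" .
qed

lemma log_A1_pairsD:
  assumes "\<phi> \<in> log_A1_pairs K"
  shows "\<phi> \<in> borel_measurable M" "A1 K (\<lambda>x. exp (fst (\<phi> x)))" "A1 K (\<lambda>x. exp (snd (\<phi> x)))"
  using assms by (auto simp: log_A1_pairs_def)

lemma factored_weight_measurable [measurable]:
  assumes [measurable]: "\<phi> \<in> borel_measurable M"
  shows "factored_weight t \<phi> \<in> borel_measurable M"
proof -
  note [measurable] = borel_measurable_fst_real[OF assms] borel_measurable_snd_real[OF assms]
  show ?thesis unfolding factored_weight_def[abs_def] by measurable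
qed

lemma factored_weight_pos: "0 < factored_weight t \<phi> x"
  by (simp add: factored_weight_def)

text \<open>
  Each pair of weights has some bound, because a factored weight belongs to \<open>A\<^sub>t\<close>, and
  the pairs with a given bound are closed; so Baire's theorem applies.
\<close>

lemma maximal_bound_on_ball:
  assumes t: "1 < t" and K: "1 \<le> K"
    and [measurable]: "h \<in> borel_measurable M" and h: "\<And>x. 0 < (h x :: real)"
  shows "\<exists>n. \<exists>\<phi>0\<in>log_A1_pairs K. \<exists>r>0. \<forall>\<phi>\<in>log_A1_pairs K.
    measure_dist (density M h) \<phi> \<phi>0 < ennreal r \<longrightarrow> maximal_bound t (ennreal (real (Suc n))) (factored_weight t \<phi>)"
proof -
  let ?N = "density M (\<lambda>x. ennreal (h x))"
  have AE_N: "(AE x in ?N. P x) \<longleftrightarrow> (AE x in M. P x)" for P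
    using h by (simp add: AE_density)
  have "\<exists>n. \<exists>\<phi>0\<in>log_A1_pairs K. \<exists>r>0. \<forall>\<phi>\<in>log_A1_pairs K. measure_dist ?N \<phi> \<phi>0 < ennreal r \<longrightarrow>
    \<phi> \<in> {\<phi>. maximal_bound t (ennreal (real (Suc n))) (factored_weight t \<phi>)}"
  proof (rule baire_convergence_in_measure)
    have "(\<lambda>_. (0, 0)) \<in> log_A1_pairs K"
      using K by (auto simp: log_A1_pairs_def A1_one)
    then show "log_A1_pairs K \<noteq> {}" by blast
    show "\<phi> \<in> borel_measurable ?N" if "\<phi> \<in> log_A1_pairs K" for \<phi>
      using log_A1_pairsD(1)[OF that] by simp
  next
    fix X :: "nat \<Rightarrow> 'a \<Rightarrow> real \<times> real" and \<phi>
    assume X: "\<And>k. X k \<in> log_A1_pairs K" and "\<phi> \<in> borel_measurable ?N"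
      and lim: "AE x in ?N. (\<lambda>k. X k x) \<longlonglongrightarrow> \<phi> x"
    then have \<phi>: "\<phi> \<in> borel_measurable M" by simp
    note [measurable] = \<phi> borel_measurable_fst_real[OF \<phi>] borel_measurable_snd_real[OF \<phi>]
    from lim have lim': "AE x in M. (\<lambda>k. X k x) \<longlonglongrightarrow> \<phi> x" by (simp only: AE_N)
    have "A1 K (\<lambda>x. exp (fst (\<phi> x)))"
    proof (rule A1_limit[OF log_A1_pairsD(2)[OF X]])
      show "AE x in M. (\<lambda>k. exp (fst (X k x))) \<longlonglongrightarrow> exp (fst (\<phi> x))"
        using lim' by eventually_elim (intro tendsto_exp tendsto_fst)
    qed auto
    moreover have "A1 K (\<lambda>x. exp (snd (\<phi> x)))"
    proof (rule A1_limit[OF log_A1_pairsD(3)[OF X]])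
      show "AE x in M. (\<lambda>k. exp (snd (X k x))) \<longlonglongrightarrow> exp (snd (\<phi> x))"
        using lim' by eventually_elim (intro tendsto_exp tendsto_snd)
    qed auto
    ultimately show "\<phi> \<in> log_A1_pairs K" by (simp add: log_A1_pairs_def)
  next
    fix n and X :: "nat \<Rightarrow> 'a \<Rightarrow> real \<times> real" and \<phi>
    assume X: "\<And>k. X k \<in> log_A1_pairs K"
      and b: "\<And>k. X k \<in> {\<phi>. maximal_bound t (ennreal (real (Suc n))) (factored_weight t \<phi>)}"
      and \<phi>: "\<phi> \<in> log_A1_pairs K" and lim: "AE x in ?N. (\<lambda>k. X k x) \<longlonglongrightarrow> \<phi> x"
    from lim have lim': "AE x in M. (\<lambda>k. X k x) \<longlonglongrightarrow> \<phi> x" by (simp only: AE_N)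
    have "AE x in M. (\<lambda>k. factored_weight t (X k) x) \<longlonglongrightarrow> factored_weight t \<phi> x"
      using lim' unfolding factored_weight_def
      by eventually_elim (auto intro!: tendsto_mult tendsto_exp tendsto_powr tendsto_fst tendsto_snd)
    note conv = this
    have bb: "maximal_bound t (ennreal (real (Suc n))) (factored_weight t (X k))" for k
      using b[of k] by blast
    have "maximal_bound t (ennreal (real (Suc n))) (factored_weight t \<phi>)"
      by (rule maximal_bound_limit[OF bb _ t factored_weight_measurable[OF log_A1_pairsD(1)[OF X]]
            factored_weight_measurable[OF log_A1_pairsD(1)[OF \<phi>]] factored_weight_pos conv]) simp
    then show "\<phi> \<in> {\<phi>. maximal_bound t (ennreal (real (Suc n))) (factored_weight t \<phi>)}" by simp
  next
    show "log_A1_pairs K \<subseteq> (\<Union>n. {\<phi>. maximal_bound t (ennreal (real (Suc n))) (factored_weight t \<phi>)})"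
    proof
      fix \<phi> assume \<phi>: "\<phi> \<in> log_A1_pairs K"
      have "(\<lambda>x. ennreal (factored_weight t \<phi> x)) \<in> Ap M \<B> t"
        unfolding factored_weight_def
        using K t by (intro A1_factor_in_Ap(1)[OF log_A1_pairsD(2,3)[OF \<phi>]]) auto
      then obtain C :: real where C: "1 \<le> C" "maximal_bound t (ennreal C) (factored_weight t \<phi>)"
        using ess_maximal_bounded[OF t] unfolding maximal_bound_def by blast
      obtain n where n: "C \<le> real n" using real_arch_simple by blast
      have "maximal_bound t (ennreal (real (Suc n))) (factored_weight t \<phi>)"
        unfolding maximal_bound_def
      proof
        fix f :: "'a \<Rightarrow> ennreal" assume f: "f \<in> borel_measurable M"
        have "ennreal C \<le> ennreal (real (Suc n))" using n by (intro ennreal_leI) simp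
        then show "(\<integral>\<^sup>+x. ess_maximal f x epowr t * ennreal (factored_weight t \<phi> x) \<partial>M)
          \<le> ennreal (real (Suc n)) * (\<integral>\<^sup>+x. f x epowr t * ennreal (factored_weight t \<phi> x) \<partial>M)"
          using maximal_boundD[OF C(2) f] by (meson mult_right_mono order_trans zero_le)
      qed
      then show "\<phi> \<in> (\<Union>n. {\<phi>. maximal_bound t (ennreal (real (Suc n))) (factored_weight t \<phi>)})" by blast
    qed
  qed
  then show ?thesis by simp
qed

lemma A1_blend:
  assumes "A1 K v" "A1 K w" "1 \<le> L" "1 \<le> K"
  shows "A1 K (\<lambda>x. blend L (v x) (w x))"
proof -
  have "A1 K (\<lambda>x. v x + 1 / L * w x)" using assms by (intro A1_add) auto
  moreover have "A1 K (\<lambda>x. L * w x)"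
    using assms by (intro A1_scale) (auto simp: component_constant_def)
  ultimately show ?thesis unfolding blend_def using assms by (intro A1_min) auto
qed

text \<open>
  A normalised pair, blended with the centre of the ball, stays in the ball if \<open>L\<close> is chosen large, and tightness
  allows choosing \<open>L\<close> once for all pairs. The bound for the blend carries over to the pair, at the cost of a power
  of \<open>L\<close>.
\<close>

proposition ess_maximal_uniform_bound:
  assumes t: "1 < t" and K: "1 \<le> K"
  shows "\<exists>C::real. 1 \<le> C \<and> (\<forall>w1 w2. A1 K w1 \<longrightarrow> A1 K w2 \<longrightarrow>
    maximal_bound t (ennreal C) (\<lambda>x. w1 x * w2 x powr (1 - t)))"
proof -
  obtain h where hm [measurable]: "h \<in> borel_measurable M" and h: "\<And>x. h x > (0::real)"
      "\<And>x. h x \<le> 1" "integrable M h"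
    by (rule obtain_positive_integrable_function, rule that)
  let ?N = "density M (\<lambda>x. ennreal (h x))"
  interpret N: finite_measure ?N
    using h by (intro finite_measureI) (simp add: emeasure_density nn_integral_eq_integral less_imp_le cong: nn_integral_cong)
  obtain n \<phi>0 r where \<phi>0: "\<phi>0 \<in> log_A1_pairs K" and r: "0 < (r::real)"
    and ball: "\<And>\<phi>. \<phi> \<in> log_A1_pairs K \<Longrightarrow> measure_dist ?N \<phi> \<phi>0 < ennreal r \<Longrightarrow>
      maximal_bound t (ennreal (real (Suc n))) (factored_weight t \<phi>)"
    using maximal_bound_on_ball[OF t K hm h(1)] by blast
  define v1 where "v1 x = exp (fst (\<phi>0 x))" for x
  define v2 where "v2 x = exp (snd (\<phi>0 x))" for x
  have v: "A1 K v1" "A1 K v2" using log_A1_pairsD[OF \<phi>0] by (auto simp: v1_def[abs_def] v2_def[abs_def])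
  note [measurable] = A1_measurable[OF v(1)] A1_measurable[OF v(2)] log_A1_pairsD(1)[OF \<phi>0]
  have r8: "0 < r / 8" using r by simp
  obtain R0 where R0: "1 \<le> R0" "\<And>w. A1 K w \<Longrightarrow> \<exists>\<kappa>. component_constant \<kappa> \<and>
      emeasure ?N {x\<in>space M. \<not> (1 / R0 \<le> \<kappa> x * w x \<and> \<kappa> x * w x \<le> R0)} \<le> ennreal (r / 8)"
    using A1_tight[OF K r8 _ h] by auto
  obtain R1 where R1: "1 \<le> R1" "emeasure ?N {x\<in>space M. \<not> (1 / R1 \<le> v1 x \<and> v1 x \<le> R1)} \<le> ennreal (r / 8)"
    using N.tight_pos_function[of v1 "r / 8"] A1_pos[OF v(1)] r by auto
  obtain R2 where R2: "1 \<le> R2" "emeasure ?N {x\<in>space M. \<not> (1 / R2 \<le> v2 x \<and> v2 x \<le> R2)} \<le> ennreal (r / 8)"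
    using N.tight_pos_function[of v2 "r / 8"] A1_pos[OF v(2)] r by auto
  define R where "R = max R0 (max R1 R2)"
  have R: "1 \<le> R" "R0 \<le> R" "R1 \<le> R" "R2 \<le> R" using R0(1) by (auto simp: R_def)
  define m where "m = measure ?N (space M)"
  have m0: "0 \<le> m" by (simp add: m_def)
  \<comment> \<open>the last term makes the contribution of the good set to the distance at most \<open>r / 4\<close>\<close>
  define L where "L = R\<^sup>2 + 1 + 8 * R\<^sup>2 * m / r"
  have LR: "R\<^sup>2 + 1 \<le> L" unfolding L_def using m0 r by simp
  have L1: "1 \<le> L" using LR by (simp add: order_trans[OF _ LR])
  have Lr: "2 * R\<^sup>2 / L * m \<le> r / 4"
  proof -
    have "8 * R\<^sup>2 * m / r \<le> L" unfolding L_def by (simp add: add_increasing)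
    then show ?thesis using r L1 by (simp add: field_simps)
  qed
  define C where "C = (L powr t)\<^sup>2 * real (Suc n)"
  have Lt: "1 \<le> L powr t" using L1 t by (intro ge_one_powr_ge_zero) auto
  have "1 \<le> C" unfolding C_def using Lt by (intro mult_ge1_I) (auto intro: one_le_power)
  moreover have "maximal_bound t (ennreal C) (\<lambda>x. w1 x * w2 x powr (1 - t))" if w: "A1 K w1" "A1 K w2" for w1 w2
  proof -
    note [measurable] = A1_measurable[OF w(1)] A1_measurable[OF w(2)]
    obtain k1 where k1: "component_constant k1"
      "emeasure ?N {x\<in>space M. \<not> (1 / R0 \<le> k1 x * w1 x \<and> k1 x * w1 x \<le> R0)} \<le> ennreal (r / 8)"
      using R0(2)[OF w(1)] by auto
    obtain k2 where k2: "component_constant k2"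
      "emeasure ?N {x\<in>space M. \<not> (1 / R0 \<le> k2 x * w2 x \<and> k2 x * w2 x \<le> R0)} \<le> ennreal (r / 8)"
      using R0(2)[OF w(2)] by auto
    have [measurable]: "k1 \<in> borel_measurable M" "k2 \<in> borel_measurable M"
      and kp: "0 < k1 x" "0 < k2 x" for x
      using k1 k2 by (auto simp: component_constant_def)
    define u1 where "u1 x = k1 x * w1 x" for x
    define u2 where "u2 x = k2 x * w2 x" for x
    have u: "A1 K u1" "A1 K u2" unfolding u1_def[abs_def] u2_def[abs_def]
      by (auto intro: A1_scale k1 k2 w)
    note [measurable] = A1_measurable[OF u(1)] A1_measurable[OF u(2)]
    define b1 where "b1 x = blend L (v1 x) (u1 x)" for x
    define b2 where "b2 x = blend L (v2 x) (u2 x)" for x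
    have b: "A1 K b1" "A1 K b2" unfolding b1_def[abs_def] b2_def[abs_def]
      by (auto intro: A1_blend u v L1 K)
    note bp = A1_pos[OF b(1)] A1_pos[OF b(2)] and up = A1_pos[OF u(1)] A1_pos[OF u(2)]
      and vp = A1_pos[OF v(1)] A1_pos[OF v(2)] and wp = A1_pos[OF w(1)] A1_pos[OF w(2)]
    note [measurable] = A1_measurable[OF b(1)] A1_measurable[OF b(2)]
    define \<phi> where "\<phi> x = (ln (b1 x), ln (b2 x))" for x
    have [measurable]: "\<phi> \<in> borel_measurable M"
      unfolding \<phi>_def by (intro borel_measurable_Pair) auto
    have exp_ln_b: "exp (ln (b1 x)) = b1 x" "exp (ln (b2 x)) = b2 x" for x using bp by auto
    have \<phi>: "\<phi> \<in> log_A1_pairs K"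
      unfolding log_A1_pairs_def using b by (simp add: \<phi>_def exp_ln_b)
    define Bad where "Bad = {x\<in>space M. \<not> (1 / R0 \<le> u1 x \<and> u1 x \<le> R0)} \<union>
      {x\<in>space M. \<not> (1 / R0 \<le> u2 x \<and> u2 x \<le> R0)} \<union>
      ({x\<in>space M. \<not> (1 / R1 \<le> v1 x \<and> v1 x \<le> R1)} \<union>
      {x\<in>space M. \<not> (1 / R2 \<le> v2 x \<and> v2 x \<le> R2)})"
    have [measurable]: "Bad \<in> sets M" unfolding Bad_def by measurable
    have "emeasure ?N Bad \<le> (ennreal (r / 8) + ennreal (r / 8)) + (ennreal (r / 8) + ennreal (r / 8))"
      unfolding Bad_def using k1(2) k2(2) R1(2) R2(2)
      by (intro order_trans[OF emeasure_subadditive] add_mono) (auto simp: u1_def u2_def)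
    also have "\<dots> = ennreal (r / 2)" using r by (simp flip: ennreal_plus)
    finally have bad: "emeasure ?N Bad \<le> ennreal (r / 2)" .
    have "measure_dist ?N \<phi> \<phi>0 \<le> (\<integral>\<^sup>+x. indicator Bad x + ennreal (2 * R\<^sup>2 / L) \<partial>?N)"
      unfolding measure_dist_def
    proof (rule nn_integral_mono)
      fix x assume "x \<in> space ?N"
      then have x: "x \<in> space M" by simp
      show "ennreal (min 1 (dist (\<phi> x) (\<phi>0 x))) \<le> indicator Bad x + ennreal (2 * R\<^sup>2 / L)"
      proof (cases "x \<in> Bad")
        case True
        have "ennreal (min 1 (dist (\<phi> x) (\<phi>0 x))) \<le> 1" by (simp add: min_def)
        then show ?thesis using True by (simp add: add_increasing2)
      next
        case False
        have inv: "1 / R \<le> 1 / R0" "1 / R \<le> 1 / R1" "1 / R \<le> 1 / R2"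
          using R R0(1) R1(1) R2(1) by (auto intro!: divide_left_mono)
        have "1 / R \<le> u1 x" "u1 x \<le> R" "1 / R \<le> u2 x" "u2 x \<le> R"
            "1 / R \<le> v1 x" "v1 x \<le> R" "1 / R \<le> v2 x" "v2 x \<le> R"
          using False x R inv by (auto simp: Bad_def)
        then have close: "\<bar>ln (b1 x) - ln (v1 x)\<bar> \<le> R\<^sup>2 / L" "\<bar>ln (b2 x) - ln (v2 x)\<bar> \<le> R\<^sup>2 / L"
          unfolding b1_def b2_def using R(1) LR by (auto intro!: ln_blend_close)
        have "dist (\<phi> x) (\<phi>0 x) \<le> dist (fst (\<phi> x)) (fst (\<phi>0 x)) + dist (snd (\<phi> x)) (snd (\<phi>0 x))"
          unfolding dist_prod_def by (intro sqrt_sum_squares_le_sum) auto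
        also have "\<dots> = \<bar>ln (b1 x) - ln (v1 x)\<bar> + \<bar>ln (b2 x) - ln (v2 x)\<bar>"
          by (simp add: \<phi>_def v1_def v2_def dist_real_def)
        also have "\<dots> \<le> 2 * R\<^sup>2 / L" using close by simp
        finally have "ennreal (min 1 (dist (\<phi> x) (\<phi>0 x))) \<le> ennreal (2 * R\<^sup>2 / L)"
          by (intro ennreal_leI) simp
        then show ?thesis by (simp add: add_increasing)
      qed
    qed
    also have "\<dots> = emeasure ?N Bad + ennreal (2 * R\<^sup>2 / L) * emeasure ?N (space M)"
      by (subst nn_integral_add) auto
    also have "emeasure ?N (space M) = ennreal m"
      unfolding m_def by (simp add: N.emeasure_eq_measure)
    also have "ennreal (2 * R\<^sup>2 / L) * ennreal m = ennreal (2 * R\<^sup>2 / L * m)"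
      using L1 m0 by (intro ennreal_mult[symmetric]) auto
    also have "emeasure ?N Bad + ennreal (2 * R\<^sup>2 / L * m) \<le> ennreal (r / 2) + ennreal (r / 4)"
      by (intro add_mono bad ennreal_leI Lr)
    also have "\<dots> < ennreal r"
      using r by (simp add: ennreal_lessI flip: ennreal_plus)
    finally have "maximal_bound t (ennreal (real (Suc n))) (factored_weight t \<phi>)"
      by (rule ball[OF \<phi>])
    moreover have "factored_weight t \<phi> = (\<lambda>x. b1 x * b2 x powr (1 - t))"
      by (rule ext) (simp add: factored_weight_def \<phi>_def exp_ln_b)
    ultimately have mb: "maximal_bound t (ennreal (real (Suc n))) (\<lambda>x. b1 x * b2 x powr (1 - t))"
      by (simp only:)
    have L_split: "L powr t = L * L powr (t - 1)" using L1 by (simp add: powr_diff)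
    have "maximal_bound t (ennreal C) (\<lambda>x. u1 x * u2 x powr (1 - t))"
      unfolding C_def
    proof (rule maximal_bound_comparable[OF mb])
      fix x
      note bb = blend_bounds[OF L1 vp(1)[of x] up(1)[of x], folded b1_def]
        blend_bounds[OF L1 vp(2)[of x] up(2)[of x], folded b2_def]
      have LL: "(L * z) powr (1 - t) = z powr (1 - t) / L powr (t - 1)"
          "(z / L) powr (1 - t) = z powr (1 - t) * L powr (t - 1)" if "0 < z" for z
        using L1 that powr_minus[of L "t - 1"] by (auto simp: powr_mult powr_divide field_simps)
      have b2_low: "u2 x powr (1 - t) / L powr (t - 1) \<le> b2 x powr (1 - t)"
        unfolding LL(1)[OF up(2), symmetric] using bb bp t by (intro powr_mono2') auto
      have b2_up: "b2 x powr (1 - t) \<le> u2 x powr (1 - t) * L powr (t - 1)"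
        unfolding LL(2)[OF up(2), symmetric] using bb up L1 t by (intro powr_mono2') auto
      have "b1 x * b2 x powr (1 - t) \<le> (L * u1 x) * (u2 x powr (1 - t) * L powr (t - 1))"
        using bb b2_up bp up L1 by (intro mult_mono) (auto intro: less_imp_le)
      then show "b1 x * b2 x powr (1 - t) \<le> L powr t * (u1 x * u2 x powr (1 - t))"
        by (simp add: L_split mult_ac)
      have "(u1 x / L) * (u2 x powr (1 - t) / L powr (t - 1)) \<le> b1 x * b2 x powr (1 - t)"
        using bb b2_low bp(1)[of x] up L1 by (intro mult_mono) (auto intro: less_imp_le)
      then show "u1 x * u2 x powr (1 - t) \<le> L powr t * (b1 x * b2 x powr (1 - t))"
        using L1 by (simp add: L_split field_simps)
    qed (use Lt t in auto)
    moreover have "(\<lambda>x. u1 x * u2 x powr (1 - t)) = (\<lambda>x. (k1 x * k2 x powr (1 - t)) * (w1 x * w2 x powr (1 - t)))"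
      using kp wp by (intro ext) (simp add: u1_def u2_def powr_mult less_imp_le)
    ultimately have mb2: "maximal_bound t (ennreal C) (\<lambda>x. (k1 x * k2 x powr (1 - t)) * (w1 x * w2 x powr (1 - t)))"
      by (simp only:)
    show ?thesis
    proof (rule maximal_bound_unscale[OF mb2])
      show "component_constant (\<lambda>x. k1 x * k2 x powr (1 - t))"
        by (intro component_constant_mult component_constant_powr k1 k2)
      show "0 < w1 x * w2 x powr (1 - t)" for x using wp(1)[of x] wp(2)[of x] by simp
    qed (use t in auto)
  qed
  ultimately show ?thesis by blast
qed

end

section \<open>Young pairs\<close>

lemma extend_inf_ennreal: "0 \<le> s \<Longrightarrow> extend_inf \<Phi> (ennreal s) = ennreal (\<Phi> s)"
  by (simp add: extend_inf_def)

lemma extend_inf_top [simp]: "extend_inf \<Phi> top = top"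
  by (simp add: extend_inf_def)

lemma extend_inf_mono:
  assumes "mono_on {0..} \<Phi>" "x \<le> y"
  shows "extend_inf \<Phi> x \<le> extend_inf \<Phi> y"
  using assms
  by (cases x; cases y)
     (auto simp: extend_inf_ennreal top_unique mono_on_def intro!: ennreal_leI)

lemma extend_inf_measurable:
  assumes "mono_on {0..} \<Phi>" and [measurable]: "f \<in> borel_measurable M"
  shows "(\<lambda>x. extend_inf \<Phi> (f x)) \<in> borel_measurable M"
proof -
  have "mono (\<lambda>s. \<Phi> (max 0 s))" using assms(1) by (auto simp: mono_def mono_on_def)
  then have [measurable]: "(\<lambda>s. \<Phi> (max 0 s)) \<in> borel_measurable borel" by (rule borel_measurable_mono)
  have "(\<lambda>x. if f x = \<infinity> then \<infinity> else ennreal (\<Phi> (max 0 (enn2real (f x))))) \<in> borel_measurable M"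
    by measurable
  moreover have "(\<lambda>x. if f x = \<infinity> then \<infinity> else ennreal (\<Phi> (max 0 (enn2real (f x))))) = (\<lambda>x. extend_inf \<Phi> (f x))"
    by (rule ext) (simp add: extend_inf_def)
  ultimately show ?thesis by (simp only:)
qed

lemma ennreal_mult_cancel:
  assumes "0 < c" "0 \<le> q"
  shows "ennreal (c * q) * ennreal (1 / c) = ennreal q"
  using assms by (subst ennreal_mult[symmetric]) auto

text \<open>
  The properties of a Young function and its complementary function on which the duality argument rests.
  The powers with conjugate exponents share them, although \<open>\<Phi>c\<close> then differs from the complementary function of \<open>\<Phi>\<close> by
  a constant factor.
\<close>

locale young_pair =
  fixes \<Phi> \<Phi>c :: "real \<Rightarrow> real"
  assumes mono: "mono_on {0..} \<Phi>" and mono_c: "mono_on {0..} \<Phi>c"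
    and zero: "\<Phi> 0 = 0"
    and pos: "\<And>s. 0 < s \<Longrightarrow> 0 < \<Phi> s"
    and ratio: "\<And>s t. 0 < s \<Longrightarrow> s \<le> t \<Longrightarrow> \<Phi> s / s \<le> \<Phi> t / t"
    and young: "\<And>s t. 0 \<le> s \<Longrightarrow> 0 \<le> t \<Longrightarrow> s * t \<le> \<Phi> s + \<Phi>c t"
    and reverse_young: "\<And>s. 0 < s \<Longrightarrow> \<Phi>c (\<Phi> s / s) \<le> \<Phi> s"
    and shrink: "\<And>a t. 0 < a \<Longrightarrow> a \<le> 1 \<Longrightarrow> 0 \<le> t \<Longrightarrow> \<Phi>c (a * t) \<le> a * \<Phi>c t"
begin

lemma nonneg: "0 \<le> s \<Longrightarrow> 0 \<le> \<Phi> s"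
  using pos[of s] zero by (cases "s = 0") auto

lemma nonneg_c: "0 \<le> t \<Longrightarrow> 0 \<le> \<Phi>c t"
  using young[of 0 t] zero by simp

lemma young_ennreal: "x * y \<le> extend_inf \<Phi> x + extend_inf \<Phi>c y"
proof (cases "x = top \<or> y = top")
  case False
  then obtain s t where st: "x = ennreal s" "y = ennreal t" "0 \<le> s" "0 \<le> t"
    by (cases x; cases y) auto
  then show ?thesis
    using young[OF st(3,4)] nonneg[OF st(3)] nonneg_c[OF st(4)]
    by (simp add: extend_inf_ennreal ennreal_leI flip: ennreal_mult ennreal_plus)
qed auto

lemma shrink_ennreal:
  assumes "0 < a" "a \<le> 1"
  shows "extend_inf \<Phi>c (ennreal a * y) \<le> ennreal a * extend_inf \<Phi>c y"
proof (cases y)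
  case (real t)
  then show ?thesis
    using shrink[OF assms, of t] assms by (simp add: extend_inf_ennreal ennreal_leI flip: ennreal_mult')
next
  case top
  then show ?thesis using assms by (simp add: ennreal_mult_top)
qed

lemma scale_down:
  assumes "0 < a" "a \<le> 1" "0 \<le> s"
  shows "\<Phi> (a * s) \<le> a * \<Phi> s"
proof (cases "s = 0")
  case False
  have "\<Phi> (a * s) / (a * s) \<le> \<Phi> s / s"
    using assms False by (intro ratio) (auto simp: mult_left_le_one_le)
  then show ?thesis using assms False by (simp add: field_simps)
qed (simp add: zero)

lemma max_le_sum:
  assumes "0 \<le> s" "0 \<le> t"
  shows "\<Phi> (max s t) \<le> \<Phi> s + \<Phi> t"
  using nonneg assms by (simp add: max_def)

end

lemma extend_inf_powr:
  assumes "0 < r"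
  shows "extend_inf (\<lambda>s. s powr r) x = x epowr r"
  using assms by (cases x) (auto simp: extend_inf_ennreal epowr_ennreal_nonneg epowr_top)

text \<open>
  \<open>s t\<close> is at most \<open>s\<^sup>r\<close> or at most \<open>t\<^sup>r\<^sup>/\<^sup>(\<^sup>r\<^sup>-\<^sup>1\<^sup>)\<close>, according to whether \<open>t \<le> s\<^sup>r\<^sup>-\<^sup>1\<close>.
\<close>

lemma young_pair_powr:
  assumes r: "1 < r"
  shows "young_pair (\<lambda>s. s powr r) (\<lambda>t. t powr (r / (r - 1)))"
proof
  let ?q = "r / (r - 1)"
  have q: "1 < ?q" "?q = 1 + 1 / (r - 1)" using r by (auto simp: field_simps)
  show "mono_on {0..} (\<lambda>s::real. s powr r)" using r by (auto simp: mono_on_def intro: powr_mono2)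
  show "mono_on {0..} (\<lambda>s::real. s powr ?q)" using q by (auto simp: mono_on_def intro: powr_mono2)
  show "(0::real) powr r = 0" by simp
  show "0 < s powr r" if "0 < s" for s using that by simp
  show "s powr r / s \<le> t powr r / t" if "0 < s" "s \<le> t" for s t
  proof -
    have "s powr r / s = s powr (r - 1)" "t powr r / t = t powr (r - 1)"
      using that by (auto simp: powr_diff)
    then show ?thesis using that r by (simp add: powr_mono2)
  qed
  show "s * t \<le> s powr r + t powr ?q" if st: "0 \<le> s" "0 \<le> t" for s t
  proof (cases "s = 0")
    case False
    then have s: "0 < s" using st by simp
    show ?thesis
    proof (cases "t \<le> s powr (r - 1)")
      case True
      then have "s * t \<le> s * s powr (r - 1)" using s by simp
      also have "\<dots> = s powr r" using s by (simp add: powr_diff)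
      finally show ?thesis by (simp add: add_increasing2)
    next
      case False
      then have t: "0 < t" "s powr (r - 1) \<le> t" using s by (auto simp: not_le intro: le_less_trans[of 0 "s powr (r - 1)"])
      have "(s powr (r - 1)) powr (1 / (r - 1)) \<le> t powr (1 / (r - 1))"
        using t s r by (intro powr_mono2) auto
      then have "s \<le> t powr (1 / (r - 1))" using s r by (simp add: powr_powr)
      then have "s * t \<le> t powr (1 / (r - 1)) * t" using t by simp
      also have "\<dots> = t powr ?q" unfolding q(2) using t by (simp add: powr_add)
      finally show ?thesis by (simp add: add_increasing)
    qed
  qed simp
  show "(s powr r / s) powr ?q \<le> s powr r" if "0 < s" for s
  proof -
    have "s powr r / s = s powr (r - 1)" using that by (simp add: powr_diff)
    then show ?thesis using that r by (simp add: powr_powr)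
  qed
  show "(a * t) powr ?q \<le> a * t powr ?q" if "0 < a" "a \<le> 1" "0 \<le> t" for a t
  proof -
    have "a powr ?q \<le> a powr 1" using that q by (intro powr_mono') auto
    then show ?thesis using that by (simp add: powr_mult mult_right_mono)
  qed
qed

text \<open>
  Superlinear growth makes the supremum that defines the complementary function finite; convexity and
  \<open>\<Phi> 0 = 0\<close> make \<open>\<Phi> s / s\<close> increasing, which gives the reverse of Young's inequality; sublinear behaviour at \<open>0\<close>
  makes the complementary function positive.
\<close>

lemma young_function_pair:
  assumes "young_function \<Phi>"
  shows "young_pair \<Phi> (complementary \<Phi>)"
    and "\<And>t. 0 < t \<Longrightarrow> 0 < complementary \<Phi> t"
proof -
  have nn: "\<And>s. 0 \<le> s \<Longrightarrow> 0 \<le> \<Phi> s" and cont: "continuous_on {0..} \<Phi>" and conv: "convex_on {0..} \<Phi>"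
    and sm: "strict_mono_on {0..} \<Phi>" and lim0: "((\<lambda>t. \<Phi> t / t) \<longlongrightarrow> 0) (at_right 0)"
    and lim: "filterlim (\<lambda>t. \<Phi> t / t) at_top at_top"
    using assms by (auto simp: young_function_def)
  have zero: "\<Phi> 0 = 0"
  proof -
    have "(\<Phi> \<longlongrightarrow> \<Phi> 0) (at 0 within {0..})" using cont by (simp add: continuous_on_def)
    then have 1: "(\<Phi> \<longlongrightarrow> \<Phi> 0) (at_right 0)" by (rule tendsto_within_subset) auto
    have "((\<lambda>t. \<Phi> t / t * t) \<longlongrightarrow> 0 * 0) (at_right 0)"
      by (intro tendsto_mult lim0 tendsto_ident_at)
    then have "((\<lambda>t. \<Phi> t / t * t) \<longlongrightarrow> 0) (at_right 0)" by simp
    moreover have "eventually (\<lambda>t. \<Phi> t / t * t = \<Phi> t) (at_right 0)"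
      by (auto simp: eventually_at_right_field intro: exI[of _ 1])
    ultimately have 2: "(\<Phi> \<longlongrightarrow> 0) (at_right 0)" by (rule Lim_transform_eventually)
    show ?thesis using tendsto_unique[OF _ 1 2] by simp
  qed
  have pos: "0 < \<Phi> s" if "0 < s" for s
    using strict_mono_onD[OF sm, of 0 s] that zero by simp
  have ratio: "\<Phi> s / s \<le> \<Phi> t / t" if "0 < s" "s \<le> t" for s t
  proof -
    have "\<Phi> ((1 - s / t) *\<^sub>R 0 + (s / t) *\<^sub>R t) \<le> (1 - s / t) * \<Phi> 0 + (s / t) * \<Phi> t"
      using that by (intro convex_onD[OF conv]) auto
    then have "\<Phi> s \<le> s / t * \<Phi> t" using that zero by simp
    then show ?thesis using that by (simp add: field_simps)
  qed
  have bdd: "bdd_above ((\<lambda>s. s * t - \<Phi> s) ` {0<..})" for t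
  proof -
    obtain S where S: "\<And>s. S \<le> s \<Longrightarrow> t \<le> \<Phi> s / s"
      using lim unfolding filterlim_at_top by (auto simp: eventually_at_top_linorder)
    have "s * t - \<Phi> s \<le> \<bar>S\<bar> * \<bar>t\<bar>" if "0 < s" for s
    proof (cases "S \<le> s")
      case True
      then have "t \<le> \<Phi> s / s" by (rule S)
      then have "s * t \<le> \<Phi> s" using that by (simp add: field_simps)
      moreover have "0 \<le> \<bar>S\<bar> * \<bar>t\<bar>" by simp
      ultimately show ?thesis by linarith
    next
      case False
      have "s * t \<le> s * \<bar>t\<bar>" using that by simp
      also have "\<dots> \<le> \<bar>S\<bar> * \<bar>t\<bar>" using False that by (intro mult_right_mono) auto
      finally show ?thesis using nn[of s] that by simp
    qed
    then show ?thesis by (intro bdd_aboveI2[where M="\<bar>S\<bar> * \<bar>t\<bar>"]) auto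
  qed
  have upper: "s * t - \<Phi> s \<le> complementary \<Phi> t" if "0 < s" for s t
    unfolding complementary_def using that by (intro cSUP_upper bdd) auto
  have least: "complementary \<Phi> t \<le> b" if "\<And>s. 0 < s \<Longrightarrow> s * t - \<Phi> s \<le> b" for t b
    unfolding complementary_def using that by (intro cSUP_least) auto
  have nnc: "0 \<le> complementary \<Phi> t" if "0 \<le> t" for t
  proof (rule field_le_epsilon)
    fix e :: real assume e: "0 < e"
    define s where "s = min 1 (e / \<Phi> 1)"
    have s: "0 < s" "s \<le> 1" using e pos[of 1] by (auto simp: s_def)
    have "\<Phi> s \<le> s * \<Phi> 1" using ratio[of s 1] s by (simp add: field_simps)
    also have "\<dots> \<le> e / \<Phi> 1 * \<Phi> 1" using pos[of 1] by (intro mult_right_mono) (auto simp: s_def)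
    also have "\<dots> = e" using pos[of 1] by simp
    finally have "\<Phi> s \<le> e" .
    moreover have "0 \<le> s * t" using s that by simp
    ultimately show "0 \<le> complementary \<Phi> t + e" using upper[OF s(1), of t] by linarith
  qed
  show "young_pair \<Phi> (complementary \<Phi>)"
  proof
    show "mono_on {0..} \<Phi>" using sm by (rule strict_mono_on_imp_mono_on)
    show "mono_on {0..} (complementary \<Phi>)"
    proof (rule mono_onI)
      fix r t :: real assume "r \<le> t"
      show "complementary \<Phi> r \<le> complementary \<Phi> t"
      proof (rule least)
        fix s :: real assume "0 < s"
        then have "s * r \<le> s * t" using \<open>r \<le> t\<close> by simp
        then show "s * r - \<Phi> s \<le> complementary \<Phi> t" using upper[OF \<open>0 < s\<close>, of t] by linarith
      qed
    qed
    show "\<Phi> 0 = 0" by (rule zero)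
    show "0 < \<Phi> s" if "0 < s" for s by (rule pos[OF that])
    show "\<Phi> s / s \<le> \<Phi> t / t" if "0 < s" "s \<le> t" for s t by (rule ratio[OF that])
    show "s * t \<le> \<Phi> s + complementary \<Phi> t" if "0 \<le> s" "0 \<le> t" for s t
      using upper[of s t] nnc[of t] zero that by (cases "s = 0") auto
    show "complementary \<Phi> (\<Phi> s / s) \<le> \<Phi> s" if s: "0 < s" for s
    proof (rule least)
      fix r :: real assume r: "0 < r"
      show "r * (\<Phi> s / s) - \<Phi> r \<le> \<Phi> s"
      proof (cases "r \<le> s")
        case True
        have "r * (\<Phi> s / s) \<le> s * (\<Phi> s / s)" using True pos[OF s] s by (intro mult_right_mono) auto
        then show ?thesis using s pos[OF r] by simp
      next
        case False
        then have "\<Phi> s / s \<le> \<Phi> r / r" using s by (intro ratio) auto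
        then have "r * (\<Phi> s / s) \<le> r * (\<Phi> r / r)" using r by (intro mult_left_mono) auto
        then show ?thesis using r pos[OF s] by simp
      qed
    qed
    show "complementary \<Phi> (a * t) \<le> a * complementary \<Phi> t" if a: "0 < a" "a \<le> 1" "0 \<le> t" for a t
    proof (rule least)
      fix s :: real assume s: "0 < s"
      have "a * \<Phi> s \<le> \<Phi> s" using a pos[OF s] by simp
      then have "s * (a * t) - \<Phi> s \<le> a * (s * t - \<Phi> s)" by (simp add: algebra_simps)
      also have "\<dots> \<le> a * complementary \<Phi> t" using a upper[OF s] by (intro mult_left_mono) auto
      finally show "s * (a * t) - \<Phi> s \<le> a * complementary \<Phi> t" .
    qed
  qed
  show "0 < complementary \<Phi> t" if t: "0 < t" for t
  proof -
    have "eventually (\<lambda>s. \<Phi> s / s < t) (at_right 0)" by (rule order_tendstoD(2)[OF lim0 t])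
    then obtain b where b: "0 < b" "\<And>s. 0 < s \<Longrightarrow> s < b \<Longrightarrow> \<Phi> s / s < t"
      by (auto simp: eventually_at_right_field)
    have "\<Phi> (b / 2) / (b / 2) < t" using b(1) by (intro b(2)) auto
    then have "0 < (b / 2) * t - \<Phi> (b / 2)" using b(1) by (simp add: field_simps)
    also have "\<dots> \<le> complementary \<Phi> t" using b(1) by (intro upper) auto
    finally show ?thesis .
  qed
qed

lemma Delta2_dilation:
  assumes "Delta2 \<Phi>" "young_pair \<Phi> \<Phi>c" "0 \<le> K"
  shows "\<exists>D\<ge>0. \<forall>s\<ge>0. \<Phi> (K * s) \<le> D * \<Phi> s"
proof -
  interpret young_pair \<Phi> \<Phi>c by fact
  obtain C0 where C0: "\<And>t. 0 < t \<Longrightarrow> \<Phi> (2 * t) \<le> C0 * \<Phi> t"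
    using assms(1) by (auto simp: Delta2_def)
  define C where "C = max C0 0"
  have C: "\<Phi> (2 * t) \<le> C * \<Phi> t" if "0 \<le> t" for t
  proof (cases "t = 0")
    case False
    then have "\<Phi> (2 * t) \<le> C0 * \<Phi> t" using that by (intro C0) auto
    also have "\<dots> \<le> C * \<Phi> t" using nonneg[OF that] by (intro mult_right_mono) (auto simp: C_def)
    finally show ?thesis .
  qed (simp add: zero)
  have pow: "\<Phi> (2 ^ n * t) \<le> C ^ n * \<Phi> t" if "0 \<le> t" for n t
  proof (induction n)
    case (Suc n)
    have "\<Phi> (2 ^ Suc n * t) \<le> C * \<Phi> (2 ^ n * t)" using C[of "2 ^ n * t"] that by (simp add: mult.assoc)
    also have "\<dots> \<le> C * (C ^ n * \<Phi> t)" by (intro mult_left_mono Suc.IH) (simp add: C_def)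
    finally show ?case by (simp add: mult.assoc)
  qed simp
  obtain n where n: "K < 2 ^ n" using real_arch_pow[of 2 K] by auto
  have "\<Phi> (K * s) \<le> C ^ n * \<Phi> s" if s: "0 \<le> s" for s
  proof -
    have "\<Phi> (K * s) \<le> \<Phi> (2 ^ n * s)"
      using n s \<open>0 \<le> K\<close> by (intro mono_onD[OF mono]) (auto intro: mult_right_mono)
    also have "\<dots> \<le> C ^ n * \<Phi> s" by (rule pow[OF s])
    finally show ?thesis .
  qed
  then show ?thesis by (intro exI[of _ "C ^ n"]) (auto simp: C_def)
qed

section \<open>The iteration of Rubio de Francia and modular extrapolation\<close>

context muckenhoupt
begin

text \<open>
  The iteration of Rubio de Francia. Since the maximal operator shifts the series by one term, the sum is an \<open>A\<^sub>1\<close> weight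
  with constant \<open>c\<close> as soon as it is positive and finite. For \<open>k = h v\<close> it equals \<open>v\<close> times the iteration of the dual maximal operator on
  \<open>h\<close>.
\<close>

definition rdf :: "real \<Rightarrow> ('a \<Rightarrow> ennreal) \<Rightarrow> 'a \<Rightarrow> ennreal" where
  "rdf c k x = (\<Sum>j. ennreal ((1 / c) ^ j) * (ess_maximal ^^ j) k x)"

lemma iterate_measurable [measurable]:
  "k \<in> borel_measurable M \<Longrightarrow> (ess_maximal ^^ j) k \<in> borel_measurable M"
  by (cases j) auto

lemma rdf_measurable [measurable]: "k \<in> borel_measurable M \<Longrightarrow> rdf c k \<in> borel_measurable M"
  unfolding rdf_def[abs_def] by measurable

lemma rdf_ge: "k x \<le> rdf c k x"
  unfolding rdf_def
  using sum_le_suminf[of "\<lambda>j. ennreal ((1 / c) ^ j) * (ess_maximal ^^ j) k x" "{0}"] by simp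

lemma rdf_average:
  assumes c: "0 < c" and [measurable]: "k \<in> borel_measurable M" and B: "B \<in> \<B>"
  shows "AE x in M. x \<in> B \<longrightarrow> average M B (rdf c k) \<le> ennreal c * rdf c k x"
proof -
  have "AE x in M. \<forall>j. x \<in> B \<longrightarrow> average M B ((ess_maximal ^^ j) k) \<le> ess_maximal ((ess_maximal ^^ j) k) x"
    unfolding AE_all_countable using average_le_ess_maximal[OF B] by blast
  then show ?thesis
  proof eventually_elim
    case (elim x)
    show ?case
    proof
      assume x: "x \<in> B"
      have "average M B (rdf c k) = (\<Sum>j. ennreal ((1 / c) ^ j) * average M B ((ess_maximal ^^ j) k))"
        unfolding rdf_def[abs_def] using B by (simp add: average_suminf average_cmult)
      also have "\<dots> \<le> (\<Sum>j. ennreal ((1 / c) ^ j) * (ess_maximal ^^ Suc j) k x)"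
        using elim x by (intro suminf_le mult_left_mono) auto
      also have "\<dots> = (\<Sum>j. ennreal c * (ennreal ((1 / c) ^ Suc j) * (ess_maximal ^^ Suc j) k x))"
      proof (intro suminf_cong)
        fix j
        have "ennreal ((1 / c) ^ j) = ennreal c * ennreal ((1 / c) ^ Suc j)"
          using c by (simp flip: ennreal_mult')
        then show "ennreal ((1 / c) ^ j) * (ess_maximal ^^ Suc j) k x =
            ennreal c * (ennreal ((1 / c) ^ Suc j) * (ess_maximal ^^ Suc j) k x)"
          by (simp add: mult.assoc)
      qed
      also have "\<dots> = ennreal c * (\<Sum>j. ennreal ((1 / c) ^ Suc j) * (ess_maximal ^^ Suc j) k x)"
        by simp
      also have "\<dots> \<le> ennreal c * rdf c k x"
        unfolding rdf_def
        by (subst (2) suminf_offset[where i=1]) (auto intro!: mult_left_mono)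
      finally show "average M B (rdf c k) \<le> ennreal c * rdf c k x" .
    qed
  qed
qed

lemma rdf_A1:
  assumes c: "0 < c" and [measurable]: "k \<in> borel_measurable M" and pos: "AE x in M. 0 < k x"
    and fin: "AE x in M. rdf c k x < \<infinity>"
  obtains w where "A1 c w" "AE x in M. ennreal (w x) = rdf c k x"
proof
  define w where "w x = (if 0 < rdf c k x \<and> rdf c k x < \<infinity> then enn2real (rdf c k x) else 1)" for x
  have [measurable]: "w \<in> borel_measurable M" unfolding w_def by measurable
  have w: "0 < w x" for x by (auto simp: w_def enn2real_positive_iff less_top)
  show eq: "AE x in M. ennreal (w x) = rdf c k x"
    using pos fin
  proof eventually_elim
    case (elim x)
    then have "0 < rdf c k x" using rdf_ge[of k x c] by order
    then show ?case using elim by (simp add: w_def)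
  qed
  have "AE x in M. x \<in> B \<longrightarrow> average M B (\<lambda>x. ennreal (w x)) \<le> ennreal (c * w x)" if B: "B \<in> \<B>" for B
  proof -
    have avg: "average M B (\<lambda>x. ennreal (w x)) = average M B (rdf c k)"
      using eq by (intro average_cong B) auto
    show ?thesis
      using rdf_average[OF c _ B, of k] eq unfolding avg
      by (auto elim!: eventually_elim2 simp: ennreal_mult' less_imp_le[OF c])
  qed
  then show "A1 c w" using w by (auto simp: A1_def)
qed

text \<open>
  Young's inequality is applied to each term of the series. The modular of the \<open>j\<close>-th iterate grows at most like
  \<open>N\<^sup>j\<close>, so the factors \<open>(2 N)\<^sup>-\<^sup>j\<close> make the sum converge; here \<open>k\<close> stands for \<open>h v\<close>.
\<close>

lemma modular_integral_rdf:
  fixes u v :: "'a \<Rightarrow> real"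
  assumes yp: "young_pair \<Phi> \<Phi>c" and N: "1 \<le> N"
    and [measurable]: "u \<in> borel_measurable M" "v \<in> borel_measurable M"
    and u: "\<And>x. 0 < u x" and v: "\<And>x. 0 < v x"
    and step: "\<And>m. m \<in> borel_measurable M \<Longrightarrow>
      (\<integral>\<^sup>+x. extend_inf \<Phi>c (ess_maximal m x * ennreal (1 / (v x * u x))) * ennreal (v x) \<partial>M)
      \<le> ennreal N * (\<integral>\<^sup>+x. extend_inf \<Phi>c (m x * ennreal (1 / (v x * u x))) * ennreal (v x) \<partial>M)"
    and [measurable]: "k \<in> borel_measurable M" "G \<in> borel_measurable M"
    and K: "1 \<le> K"
  shows "(\<integral>\<^sup>+x. G x * rdf (2 * N) k x \<partial>M) \<le>
    2 * ((\<integral>\<^sup>+x. extend_inf \<Phi> (ennreal K * (G x * ennreal (u x))) * ennreal (v x) \<partial>M) +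
      ennreal (1 / K) * (\<integral>\<^sup>+x. extend_inf \<Phi>c (k x * ennreal (1 / (v x * u x))) * ennreal (v x) \<partial>M))"
proof -
  interpret young_pair \<Phi> \<Phi>c by fact
  note [measurable] = extend_inf_measurable[OF mono] extend_inf_measurable[OF mono_c]
  let ?m = "\<lambda>j. (ess_maximal ^^ j) k"
  let ?X = "\<integral>\<^sup>+x. extend_inf \<Phi> (ennreal K * (G x * ennreal (u x))) * ennreal (v x) \<partial>M"
  define S where "S m = (\<integral>\<^sup>+x. extend_inf \<Phi>c (m x * ennreal (1 / (v x * u x))) * ennreal (v x) \<partial>M)" for m
  have Sj: "S (?m j) \<le> ennreal (N ^ j) * S k" for j
  proof (induction j)
    case (Suc j)
    have "S (?m (Suc j)) \<le> ennreal N * S (?m j)"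
      unfolding S_def using step[of "?m j"] by simp
    also have "\<dots> \<le> ennreal N * (ennreal (N ^ j) * S k)" by (intro mult_left_mono Suc.IH) auto
    also have "\<dots> = ennreal (N ^ Suc j) * S k" using N by (simp add: ennreal_mult' mult.assoc)
    finally show ?case .
  qed simp
  have int_j: "(\<integral>\<^sup>+x. G x * ?m j x \<partial>M) \<le> ?X + ennreal (1 / K) * (ennreal (N ^ j) * S k)" for j
  proof -
    have "(\<integral>\<^sup>+x. G x * ?m j x \<partial>M) \<le>
        (\<integral>\<^sup>+x. extend_inf \<Phi> (ennreal K * (G x * ennreal (u x))) * ennreal (v x)
          + ennreal (1 / K) * (extend_inf \<Phi>c (?m j x * ennreal (1 / (v x * u x))) * ennreal (v x)) \<partial>M)"
    proof (rule nn_integral_mono)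
      fix x
      let ?a = "ennreal K * (G x * ennreal (u x))" and ?b = "?m j x * ennreal (1 / (v x * u x))"
      have one: "ennreal K * ennreal (u x) * ennreal (1 / K) * ennreal (1 / (v x * u x)) * ennreal (v x) = 1"
        using K u[of x] v[of x] by (simp flip: ennreal_mult')
      have "G x * ?m j x = G x * ?m j x * (ennreal K * ennreal (u x) * ennreal (1 / K) * ennreal (1 / (v x * u x)) * ennreal (v x))"
        by (simp only: one mult_1_right)
      also have "\<dots> = (?a * (ennreal (1 / K) * ?b)) * ennreal (v x)" by (simp add: mult_ac)
      also have "\<dots> \<le> (extend_inf \<Phi> ?a + extend_inf \<Phi>c (ennreal (1 / K) * ?b)) * ennreal (v x)"
        by (intro mult_right_mono young_ennreal) auto
      also have "\<dots> \<le> (extend_inf \<Phi> ?a + ennreal (1 / K) * extend_inf \<Phi>c ?b) * ennreal (v x)"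
        using K by (intro mult_right_mono add_left_mono shrink_ennreal) auto
      finally show "G x * ?m j x \<le> extend_inf \<Phi> ?a * ennreal (v x) + ennreal (1 / K) * (extend_inf \<Phi>c ?b * ennreal (v x))"
        by (simp add: distrib_right mult.assoc)
    qed
    also have "\<dots> = ?X + ennreal (1 / K) * S (?m j)"
      unfolding S_def by (subst nn_integral_add) (auto simp: nn_integral_cmult)
    also have "\<dots> \<le> ?X + ennreal (1 / K) * (ennreal (N ^ j) * S k)"
      by (intro add_left_mono mult_left_mono Sj) auto
    finally show ?thesis .
  qed
  have "(\<integral>\<^sup>+x. G x * rdf (2 * N) k x \<partial>M) = (\<integral>\<^sup>+x. (\<Sum>j. ennreal ((1 / (2 * N)) ^ j) * (G x * ?m j x)) \<partial>M)"
    unfolding rdf_def by (simp add: ennreal_suminf_cmult[symmetric] mult_ac del: ennreal_suminf_cmult)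
  also have "\<dots> = (\<Sum>j. ennreal ((1 / (2 * N)) ^ j) * (\<integral>\<^sup>+x. G x * ?m j x \<partial>M))"
    by (subst nn_integral_suminf) (auto simp: nn_integral_cmult)
  also have "\<dots> \<le> (\<Sum>j. ennreal ((1 / 2) ^ j) * (?X + ennreal (1 / K) * S k))"
  proof (intro suminf_le)
    fix j
    have a: "(1 / (2 * N)) ^ j \<le> (1 / 2) ^ j" using N by (intro power_mono divide_left_mono) auto
    have "ennreal ((1 / (2 * N)) ^ j) * (\<integral>\<^sup>+x. G x * ?m j x \<partial>M)
        \<le> ennreal ((1 / (2 * N)) ^ j) * (?X + ennreal (1 / K) * (ennreal (N ^ j) * S k))"
      by (intro mult_left_mono int_j) auto
    also have "\<dots> = ennreal ((1 / (2 * N)) ^ j) * ?X + (ennreal ((1 / (2 * N)) ^ j) * ennreal (N ^ j)) * (ennreal (1 / K) * S k)"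
      by (simp add: distrib_left mult_ac)
    also have "ennreal ((1 / (2 * N)) ^ j) * ennreal (N ^ j) = ennreal ((1 / 2) ^ j)"
      using N by (simp add: power_mult_distrib[symmetric] flip: ennreal_mult')
    also have "ennreal ((1 / (2 * N)) ^ j) * ?X \<le> ennreal ((1 / 2) ^ j) * ?X"
      by (intro mult_right_mono ennreal_leI a) auto
    finally show "ennreal ((1 / (2 * N)) ^ j) * (\<integral>\<^sup>+x. G x * ?m j x \<partial>M)
        \<le> ennreal ((1 / 2) ^ j) * (?X + ennreal (1 / K) * S k)"
      by (simp add: distrib_left add_right_mono)
  qed auto
  also have "\<dots> = 2 * (?X + ennreal (1 / K) * S k)"
    by (simp only: ennreal_suminf_multc suminf_half)
  finally show ?thesis by (simp only: S_def)
qed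

text \<open>
  The dual function is \<open>h = u \<Phi>(\<tau>)/\<tau>\<close> with \<open>\<tau> = F u\<close>, for which \<open>F h = \<Phi>(\<tau>)\<close> and
  \<open>\<Phi>c(h/u) \<le> \<Phi>(\<tau>)\<close>. To absorb the modular of \<open>\<tau>\<close> it must be finite, hence the truncations \<open>\<tau> n\<close>; to obtain a weight
  that vanishes nowhere, \<open>\<tau> n\<close> is replaced by its maximum with \<open>\<delta> z\<close>, where \<open>z\<close> is positive with finite modular, and \<open>\<delta>\<close>
  tends to zero.
\<close>

proposition modular_extrapolation:
  fixes u v :: "'a \<Rightarrow> real"
  assumes yp: "young_pair \<Phi> \<Phi>c" and N: "1 \<le> N" and C: "1 \<le> C" and D: "0 \<le> D"
    and doubling: "\<And>s. 0 \<le> s \<Longrightarrow> \<Phi> (4 * C * s) \<le> D * \<Phi> s"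
    and [measurable]: "u \<in> borel_measurable M" "v \<in> borel_measurable M"
    and u: "\<And>x. 0 < u x" and v: "\<And>x. 0 < v x"
    and step: "\<And>m. m \<in> borel_measurable M \<Longrightarrow>
      (\<integral>\<^sup>+x. extend_inf \<Phi>c (ess_maximal m x * ennreal (1 / (v x * u x))) * ennreal (v x) \<partial>M)
      \<le> ennreal N * (\<integral>\<^sup>+x. extend_inf \<Phi>c (m x * ennreal (1 / (v x * u x))) * ennreal (v x) \<partial>M)"
    and [measurable]: "F \<in> borel_measurable M" "G \<in> borel_measurable M"
    and ext: "\<And>w. A1 (2 * N) w \<Longrightarrow>
      (\<integral>\<^sup>+x. F x * ennreal (w x) \<partial>M) \<le> ennreal C * (\<integral>\<^sup>+x. G x * ennreal (w x) \<partial>M)"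
  shows "(\<integral>\<^sup>+x. extend_inf \<Phi> (F x * ennreal (u x)) * ennreal (v x) \<partial>M)
    \<le> ennreal (4 * C * D) * (\<integral>\<^sup>+x. extend_inf \<Phi> (G x * ennreal (u x)) * ennreal (v x) \<partial>M)"
proof -
  interpret young_pair \<Phi> \<Phi>c by fact
  note meas[measurable] = extend_inf_measurable[OF mono] extend_inf_measurable[OF mono_c]
  have \<Phi>_meas: "(\<lambda>x. ennreal (\<Phi> (g x))) \<in> borel_measurable M"
    if [measurable]: "g \<in> borel_measurable M" and "\<And>x. 0 \<le> g x" for g
  proof -
    have "(\<lambda>x. extend_inf \<Phi> (ennreal (g x))) \<in> borel_measurable M" by measurable
    then show ?thesis using that(2) by (simp add: extend_inf_ennreal)
  qed
  obtain h where [measurable]: "h \<in> borel_measurable M" and h: "\<And>x. h x > (0::real)"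
      "\<And>x. h x \<le> 1" "integrable M h"
    by (rule obtain_positive_integrable_function, rule that)
  define z where "z x = h x / (1 + v x)" for x
  have [measurable]: "z \<in> borel_measurable M" unfolding z_def by measurable
  have z0: "0 < z x" for x using h(1)[of x] v[of x] by (simp add: z_def)
  have zv: "z x * v x \<le> h x" for x
    using h(1)[of x] v[of x] by (simp add: z_def field_simps)
  have z1: "z x \<le> 1" for x
    using h(1)[of x] h(2)[of x] v[of x] by (simp add: z_def field_simps)
  have zv_fin: "(\<integral>\<^sup>+x. ennreal (z x * v x) \<partial>M) < \<infinity>"
  proof -
    have "(\<integral>\<^sup>+x. ennreal (z x * v x) \<partial>M) \<le> (\<integral>\<^sup>+x. ennreal (h x) \<partial>M)"
      by (intro nn_integral_mono ennreal_leI zv)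
    also have "\<dots> < \<infinity>" using h by (simp add: nn_integral_eq_integral less_imp_le)
    finally show ?thesis .
  qed
  define Z where "Z = (\<integral>\<^sup>+x. ennreal (\<Phi> (z x)) * ennreal (v x) \<partial>M)"
  have Z_fin: "Z < \<infinity>"
  proof -
    have "Z \<le> (\<integral>\<^sup>+x. ennreal (\<Phi> 1) * ennreal (z x * v x) \<partial>M)"
      unfolding Z_def
    proof (rule nn_integral_mono)
      fix x
      have "\<Phi> (z x) \<le> z x * \<Phi> 1" using scale_down[OF z0 z1, of 1] by simp
      then have "\<Phi> (z x) * v x \<le> \<Phi> 1 * (z x * v x)"
        using v[of x] by (simp add: mult_right_mono mult_ac)
      then show "ennreal (\<Phi> (z x)) * ennreal (v x) \<le> ennreal (\<Phi> 1) * ennreal (z x * v x)"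
        using nonneg[of "z x"] nonneg[of 1] z0[of x] by (simp add: ennreal_leI less_imp_le flip: ennreal_mult')
    qed
    also have "\<dots> = ennreal (\<Phi> 1) * (\<integral>\<^sup>+x. ennreal (z x * v x) \<partial>M)" by (rule nn_integral_cmult) measurable
    also have "\<dots> < \<infinity>" using zv_fin by (simp add: ennreal_mult_less_top)
    finally show ?thesis .
  qed
  let ?XG = "\<integral>\<^sup>+x. extend_inf \<Phi> (ennreal (4 * C) * (G x * ennreal (u x))) * ennreal (v x) \<partial>M"
  define E where "E n = {x\<in>space M. 1 \<le> real n * z x}" for n
  have [measurable]: "E n \<in> sets M" for n unfolding E_def by measurable
  define \<tau> where "\<tau> n x = enn2real (min (F x * ennreal (u x)) (ennreal (real n))) * indicator (E n) x" for n x
  have [measurable]: "\<tau> n \<in> borel_measurable M" for n unfolding \<tau>_def[abs_def] by measurable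
  have \<tau>0: "0 \<le> \<tau> n x" for n x by (simp add: \<tau>_def)
  have enn_min: "ennreal (enn2real (min y (ennreal (real n)))) = min y (ennreal (real n))" for y n
    by (intro ennreal_enn2real) (simp add: min_less_iff_disj)
  have \<tau>_le: "ennreal (\<tau> n x) \<le> F x * ennreal (u x)" "ennreal (\<tau> n x) \<le> ennreal (real n)" for n x
    by (auto simp: \<tau>_def indicator_def enn_min simp del: ennreal_le_iff)
  have main: "(\<integral>\<^sup>+x. ennreal (\<Phi> (\<tau> n x)) * ennreal (v x) \<partial>M) \<le> ennreal (4 * C) * ?XG" for n
  proof -
    let ?A = "\<integral>\<^sup>+x. ennreal (\<Phi> (\<tau> n x)) * ennreal (v x) \<partial>M"
    have A_fin: "?A < \<infinity>"
    proof -
      have "?A \<le> (\<integral>\<^sup>+x. ennreal (\<Phi> (real n) * real n) * ennreal (z x * v x) \<partial>M)"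
      proof (rule nn_integral_mono)
        fix x
        have "\<Phi> (\<tau> n x) \<le> \<Phi> (real n) * real n * z x"
        proof (cases "x \<in> E n")
          case True
          have "\<tau> n x \<le> real n" using \<tau>_le(2)[of n x] ennreal_le_iff[of "real n" "\<tau> n x"] by simp
          then have "\<Phi> (\<tau> n x) \<le> \<Phi> (real n)" using \<tau>0[of n x] by (intro mono_onD[OF mono]) auto
          also have "\<dots> \<le> \<Phi> (real n) * (real n * z x)"
            using True nonneg[of "real n"] by (simp add: E_def mult_le_cancel_left1)
          finally show ?thesis by (simp add: mult.assoc)
        next
          case False
          then show ?thesis using z0[of x] nonneg[of "real n"] by (simp add: \<tau>_def zero)
        qed
        then have "\<Phi> (\<tau> n x) * v x \<le> \<Phi> (real n) * real n * z x * v x"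
          using v[of x] by (intro mult_right_mono) auto
        then show "ennreal (\<Phi> (\<tau> n x)) * ennreal (v x) \<le> ennreal (\<Phi> (real n) * real n) * ennreal (z x * v x)"
          using nonneg[OF \<tau>0[of n x]] nonneg[of "real n"] z0[of x]
          by (simp add: ennreal_leI mult.assoc flip: ennreal_mult')
      qed
      also have "\<dots> = ennreal (\<Phi> (real n) * real n) * (\<integral>\<^sup>+x. ennreal (z x * v x) \<partial>M)"
        by (rule nn_integral_cmult) measurable
      also have "\<dots> < \<infinity>" using zv_fin by (simp add: ennreal_mult_less_top)
      finally show ?thesis .
    qed
    have le_d: "?A \<le> ennreal (4 * C) * ?XG + ennreal \<delta> * Z" if \<delta>: "0 < \<delta>" "\<delta> \<le> 1" for \<delta>
    proof -
      define \<sigma> where "\<sigma> x = max (\<tau> n x) (\<delta> * z x)" for x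
      have [measurable]: "\<sigma> \<in> borel_measurable M" unfolding \<sigma>_def[abs_def] by measurable
      have \<sigma>0: "0 < \<sigma> x" for x using \<delta> z0[of x] by (simp add: \<sigma>_def less_max_iff_disj)
      have q0: "0 < \<Phi> (\<sigma> x) / \<sigma> x" for x using \<sigma>0 pos by simp
      have \<sigma>_meas: "(\<lambda>x. \<Phi> (\<sigma> x)) \<in> borel_measurable M"
      proof -
        have "(\<lambda>x. enn2real (ennreal (\<Phi> (\<sigma> x)))) \<in> borel_measurable M"
          using \<Phi>_meas[of \<sigma>] \<sigma>0 by (intro borel_measurable_enn2real) (auto intro: less_imp_le)
        then show ?thesis using nonneg \<sigma>0 by (simp add: less_imp_le)
      qed
      note [measurable] = \<sigma>_meas
      define k where "k x = ennreal (v x * u x * (\<Phi> (\<sigma> x) / \<sigma> x))" for x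
      have [measurable]: "k \<in> borel_measurable M" unfolding k_def[abs_def] by measurable
      have "0 < v x * u x * (\<Phi> (\<sigma> x) / \<sigma> x)" for x
        using q0 u v by (intro mult_pos_pos)
      then have k0: "0 < k x" for x by (simp only: k_def ennreal_less_zero_iff)
      let ?S = "\<integral>\<^sup>+x. extend_inf \<Phi>c (k x * ennreal (1 / (v x * u x))) * ennreal (v x) \<partial>M"
      have S_le: "?S \<le> ?A + ennreal \<delta> * Z"
      proof -
        have "?S \<le> (\<integral>\<^sup>+x. ennreal (\<Phi> (\<tau> n x)) * ennreal (v x) + ennreal \<delta> * (ennreal (\<Phi> (z x)) * ennreal (v x)) \<partial>M)"
        proof (rule nn_integral_mono)
          fix x
          have "k x * ennreal (1 / (v x * u x)) = ennreal (\<Phi> (\<sigma> x) / \<sigma> x)"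
            unfolding k_def using u[of x] v[of x] less_imp_le[OF q0[of x]] by (intro ennreal_mult_cancel) auto
          then have "extend_inf \<Phi>c (k x * ennreal (1 / (v x * u x))) = ennreal (\<Phi>c (\<Phi> (\<sigma> x) / \<sigma> x))"
            using q0[of x] by (simp add: extend_inf_ennreal)
          also have "\<dots> \<le> ennreal (\<Phi> (\<tau> n x) + \<delta> * \<Phi> (z x))"
          proof (rule ennreal_leI)
            have "\<Phi>c (\<Phi> (\<sigma> x) / \<sigma> x) \<le> \<Phi> (\<sigma> x)" by (rule reverse_young[OF \<sigma>0])
            also have "\<dots> \<le> \<Phi> (\<tau> n x) + \<Phi> (\<delta> * z x)"
              unfolding \<sigma>_def using \<tau>0[of n x] \<delta> z0[of x] by (intro max_le_sum) auto
            also have "\<Phi> (\<delta> * z x) \<le> \<delta> * \<Phi> (z x)" using \<delta> z0[of x] by (intro scale_down) auto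
            finally show "\<Phi>c (\<Phi> (\<sigma> x) / \<sigma> x) \<le> \<Phi> (\<tau> n x) + \<delta> * \<Phi> (z x)" by simp
          qed
          also have "\<dots> = ennreal (\<Phi> (\<tau> n x)) + ennreal \<delta> * ennreal (\<Phi> (z x))"
            using nonneg[OF \<tau>0[of n x]] nonneg[of "z x"] z0[of x] \<delta> by (simp add: ennreal_mult' less_imp_le)
          finally have "extend_inf \<Phi>c (k x * ennreal (1 / (v x * u x))) * ennreal (v x)
              \<le> (ennreal (\<Phi> (\<tau> n x)) + ennreal \<delta> * ennreal (\<Phi> (z x))) * ennreal (v x)"
            by (rule mult_right_mono) simp
          then show "extend_inf \<Phi>c (k x * ennreal (1 / (v x * u x))) * ennreal (v x)
              \<le> ennreal (\<Phi> (\<tau> n x)) * ennreal (v x) + ennreal \<delta> * (ennreal (\<Phi> (z x)) * ennreal (v x))"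
            by (simp only: distrib_right mult.assoc)
        qed
        also have "\<dots> = ?A + ennreal \<delta> * Z"
          unfolding Z_def using \<Phi>_meas[of "\<tau> n"] \<Phi>_meas[of z] \<tau>0 z0
          by (subst nn_integral_add) (auto simp: nn_integral_cmult less_imp_le)
        finally show ?thesis .
      qed
      have S_fin: "?S < \<infinity>"
        using S_le A_fin Z_fin by (auto intro: le_less_trans simp: ennreal_mult_less_top)
      \<comment> \<open>the integral of the majorant against the positive function \<open>z / u\<close> is finite\<close>
      have fin: "AE x in M. rdf (2 * N) k x < \<infinity>"
      proof -
        have "(\<integral>\<^sup>+x. ennreal (z x / u x) * rdf (2 * N) k x \<partial>M) \<le>
          2 * ((\<integral>\<^sup>+x. extend_inf \<Phi> (ennreal 1 * (ennreal (z x / u x) * ennreal (u x))) * ennreal (v x) \<partial>M) +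
            ennreal (1 / 1) * ?S)"
          by (rule modular_integral_rdf[OF yp N _ _ u v step]) auto
        also have "(\<integral>\<^sup>+x. extend_inf \<Phi> (ennreal 1 * (ennreal (z x / u x) * ennreal (u x))) * ennreal (v x) \<partial>M) = Z"
          unfolding Z_def
        proof (intro nn_integral_cong)
          fix x
          have "ennreal (z x / u x) * ennreal (u x) = ennreal (z x)"
            using u[of x] z0[of x] by (simp flip: ennreal_mult')
          then show "extend_inf \<Phi> (ennreal 1 * (ennreal (z x / u x) * ennreal (u x))) * ennreal (v x) = ennreal (\<Phi> (z x)) * ennreal (v x)"
            using z0[of x] by (simp add: extend_inf_ennreal)
        qed
        also have "2 * (Z + ennreal (1 / 1) * ?S) < \<infinity>"
          using Z_fin S_fin by (simp add: ennreal_mult_less_top)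
        finally have "AE x in M. ennreal (z x / u x) * rdf (2 * N) k x \<noteq> \<infinity>"
          by (intro nn_integral_PInf_AE) auto
        then show ?thesis
        proof eventually_elim
          case (elim x)
          show ?case
          proof (rule ccontr)
            assume "\<not> rdf (2 * N) k x < \<infinity>"
            then have "rdf (2 * N) k x = top" by (simp add: not_less top_unique)
            then show False using elim z0[of x] u[of x] by (simp add: ennreal_mult_top)
          qed
        qed
      qed
      obtain w where w: "A1 (2 * N) w" "AE x in M. ennreal (w x) = rdf (2 * N) k x"
        using rdf_A1[of "2 * N" k] N k0 fin by auto
      have "?A \<le> (\<integral>\<^sup>+x. F x * k x \<partial>M)"
      proof (rule nn_integral_mono)
        fix x
        show "ennreal (\<Phi> (\<tau> n x)) * ennreal (v x) \<le> F x * k x"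
        proof (cases "\<tau> n x = 0")
          case False
          then have t: "0 < \<tau> n x" using \<tau>0[of n x] by simp
          have "\<Phi> (\<tau> n x) / \<tau> n x \<le> \<Phi> (\<sigma> x) / \<sigma> x" by (rule ratio[OF t]) (simp add: \<sigma>_def)
          then have "ennreal (\<Phi> (\<tau> n x) / \<tau> n x * v x) \<le> ennreal (\<Phi> (\<sigma> x) / \<sigma> x * v x)"
            using v[of x] by (intro ennreal_leI mult_right_mono) auto
          have "ennreal (\<Phi> (\<tau> n x)) * ennreal (v x) = ennreal (\<tau> n x) * ennreal (\<Phi> (\<tau> n x) / \<tau> n x * v x)"
            using t nonneg[OF \<tau>0[of n x]] v[of x] by (simp flip: ennreal_mult')
          also have "\<dots> \<le> (F x * ennreal (u x)) * ennreal (\<Phi> (\<sigma> x) / \<sigma> x * v x)"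
            by (intro mult_mono \<tau>_le) (fact | simp)+
          also have "\<dots> = F x * k x"
            using u[of x] q0[of x] v[of x] by (simp add: k_def mult_ac flip: ennreal_mult')
          finally show ?thesis .
        qed (simp add: zero)
      qed
      also have "\<dots> \<le> (\<integral>\<^sup>+x. F x * rdf (2 * N) k x \<partial>M)"
        by (intro nn_integral_mono mult_left_mono rdf_ge) auto
      also have "\<dots> = (\<integral>\<^sup>+x. F x * ennreal (w x) \<partial>M)"
        using w(2) by (intro nn_integral_cong_AE) auto
      also have "\<dots> \<le> ennreal C * (\<integral>\<^sup>+x. G x * ennreal (w x) \<partial>M)" by (rule ext[OF w(1)])
      also have "(\<integral>\<^sup>+x. G x * ennreal (w x) \<partial>M) = (\<integral>\<^sup>+x. G x * rdf (2 * N) k x \<partial>M)"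
        using w(2) by (intro nn_integral_cong_AE) auto
      also have "\<dots> \<le> 2 * (?XG + ennreal (1 / (4 * C)) * ?S)"
        using C by (intro modular_integral_rdf[OF yp N _ _ u v step]) auto
      also have "ennreal C * (2 * (?XG + ennreal (1 / (4 * C)) * ?S)) = ennreal (2 * C) * ?XG + ennreal (1 / 2) * ?S"
      proof -
        have "ennreal C * 2 = ennreal (2 * C)" using C by (simp add: ennreal_mult' mult.commute)
        moreover have "ennreal (2 * C) * ennreal (1 / (4 * C)) = ennreal (1 / 2)" using C by (simp flip: ennreal_mult')
        ultimately show ?thesis by (simp only: mult.assoc[symmetric] distrib_left)
      qed
      also have "\<dots> \<le> ennreal (2 * C) * ?XG + ennreal (1 / 2) * (?A + ennreal \<delta> * Z)"
        by (intro add_left_mono mult_left_mono S_le) auto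
      finally have fin_ineq: "?A \<le> ennreal (2 * C) * ?XG + ennreal (1 / 2) * (?A + ennreal \<delta> * Z)"
        by (simp add: mult_left_mono)
      show ?thesis
      proof (cases "?XG = \<infinity>")
        case True
        then show ?thesis using C by (simp add: ennreal_mult_top)
      next
        case False
        obtain a where a: "?A = ennreal a" "0 \<le> a" using A_fin by (cases ?A) auto
        obtain b where b: "?XG = ennreal b" "0 \<le> b" using False by (cases ?XG) auto
        obtain c where c: "Z = ennreal c" "0 \<le> c" using Z_fin by (cases Z) auto
        have "ennreal a \<le> ennreal (2 * C * b + 1 / 2 * (a + \<delta> * c))"
        proof -
          have "ennreal (2 * C) * ennreal b + ennreal (1 / 2) * (ennreal a + ennreal \<delta> * ennreal c)
              = ennreal (2 * C * b + 1 / 2 * (a + \<delta> * c))"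
            using C a(2) b(2) c(2) \<delta>
            by (simp add: zero_le_mult_iff add_nonneg_nonneg flip: ennreal_mult' ennreal_plus del: ennreal_half)
          then show ?thesis using fin_ineq unfolding a(1) b(1) c(1) by (simp only:)
        qed
        moreover have "0 \<le> 2 * C * b + 1 / 2 * (a + \<delta> * c)" using C a(2) b(2) c(2) \<delta> by simp
        ultimately have "a \<le> 2 * C * b + 1 / 2 * (a + \<delta> * c)" by (simp only: ennreal_le_iff)
        then have "ennreal a \<le> ennreal (4 * C * b + \<delta> * c)" by (intro ennreal_leI) (simp add: field_simps)
        moreover have "ennreal (4 * C) * ennreal b + ennreal \<delta> * ennreal c = ennreal (4 * C * b + \<delta> * c)"
          using C b(2) c(2) \<delta> by (simp add: zero_le_mult_iff flip: ennreal_mult' ennreal_plus)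
        ultimately show ?thesis unfolding a(1) b(1) c(1) by (simp only:)
      qed
    qed
    show ?thesis
    proof (rule ennreal_le_epsilon)
      fix e :: real assume e: "0 < e"
      obtain c where c: "Z = ennreal c" "0 \<le> c" using Z_fin by (cases Z) auto
      define \<delta> where "\<delta> = min 1 (e / (c + 1))"
      have "0 < e / (c + 1)" using e c(2) by (intro divide_pos_pos) auto
      then have \<delta>: "0 < \<delta>" "\<delta> \<le> 1" by (auto simp: \<delta>_def)
      have "\<delta> * c \<le> e / (c + 1) * c" using c by (intro mult_right_mono) (auto simp: \<delta>_def)
      also have "\<dots> \<le> e" using e c by (simp add: field_simps)
      finally have "ennreal \<delta> * Z \<le> ennreal e" using c \<delta> by (simp add: ennreal_leI flip: ennreal_mult)
      then show "?A \<le> ennreal (4 * C) * ?XG + ennreal e"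
        using le_d[OF \<delta>] by (meson add_left_mono order_trans)
    qed
  qed
  have "(\<integral>\<^sup>+x. extend_inf \<Phi> (F x * ennreal (u x)) * ennreal (v x) \<partial>M)
      \<le> (\<integral>\<^sup>+x. liminf (\<lambda>n. ennreal (\<Phi> (\<tau> n x)) * ennreal (v x)) \<partial>M)"
  proof (rule nn_integral_mono)
    fix x assume x: "x \<in> space M"
    obtain n0 where n0: "1 / z x \<le> real n0" using real_arch_simple by blast
    have inE: "x \<in> E n" if "n \<ge> n0" for n
    proof -
      have "1 / z x \<le> real n" using n0 that by (meson of_nat_le_iff order_trans)
      then show ?thesis using x z0[of x] by (simp add: E_def field_simps)
    qed
    show "extend_inf \<Phi> (F x * ennreal (u x)) * ennreal (v x) \<le> liminf (\<lambda>n. ennreal (\<Phi> (\<tau> n x)) * ennreal (v x))"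
    proof (cases "F x * ennreal (u x)")
      case (real s)
      obtain n1 where n1: "s \<le> real n1" using real_arch_simple by blast
      have "eventually (\<lambda>n. extend_inf \<Phi> (F x * ennreal (u x)) * ennreal (v x) \<le> ennreal (\<Phi> (\<tau> n x)) * ennreal (v x)) sequentially"
        unfolding eventually_sequentially
      proof (intro exI[of _ "max n0 n1"] allI impI)
        fix n assume n: "max n0 n1 \<le> n"
        then have "s \<le> real n" using n1 by (meson max.boundedE of_nat_le_iff order_trans)
        then have "\<tau> n x = s" using inE[of n] n real by (simp add: \<tau>_def min_def)
        then show "extend_inf \<Phi> (F x * ennreal (u x)) * ennreal (v x) \<le> ennreal (\<Phi> (\<tau> n x)) * ennreal (v x)"
          using real by (simp add: extend_inf_ennreal)
      qed
      then show ?thesis by (rule Liminf_bounded)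
    next
      case top
      have "eventually (\<lambda>n. ennreal (real n * (\<Phi> 1 * v x)) \<le> ennreal (\<Phi> (\<tau> n x)) * ennreal (v x)) sequentially"
        unfolding eventually_sequentially
      proof (intro exI[of _ "max n0 1"] allI impI)
        fix n assume n: "max n0 1 \<le> n"
        then have "\<tau> n x = real n" using inE[of n] top by (simp add: \<tau>_def)
        moreover have "\<Phi> 1 / 1 \<le> \<Phi> (real n) / real n" using n by (intro ratio) auto
        ultimately have "real n * \<Phi> 1 \<le> \<Phi> (\<tau> n x)" using n by (simp add: field_simps)
        then have "real n * \<Phi> 1 * v x \<le> \<Phi> (\<tau> n x) * v x" using v[of x] by (intro mult_right_mono) auto
        then show "ennreal (real n * (\<Phi> 1 * v x)) \<le> ennreal (\<Phi> (\<tau> n x)) * ennreal (v x)"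
          using nonneg[OF \<tau>0[of n x]] by (simp add: ennreal_leI mult.assoc flip: ennreal_mult')
      qed
      then have "liminf (\<lambda>n. ennreal (real n * (\<Phi> 1 * v x))) \<le> liminf (\<lambda>n. ennreal (\<Phi> (\<tau> n x)) * ennreal (v x))"
        by (rule Liminf_mono)
      moreover have "(\<lambda>n. ennreal (real n * (\<Phi> 1 * v x))) \<longlonglongrightarrow> top"
      proof -
        have "filterlim (\<lambda>n. real n * (\<Phi> 1 * v x)) at_top sequentially"
          using pos[of 1] v[of x] by (intro filterlim_at_top_mult_tendsto_pos[OF tendsto_const]
              filterlim_real_sequentially) simp
        then show ?thesis by (simp add: ennreal_tendsto_top_eq_at_top)
      qed
      then have "liminf (\<lambda>n. ennreal (real n * (\<Phi> 1 * v x))) = top" by (intro lim_imp_Liminf) auto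
      ultimately show ?thesis by (simp add: top_unique)
    qed
  qed
  also have "\<dots> \<le> liminf (\<lambda>n. \<integral>\<^sup>+x. ennreal (\<Phi> (\<tau> n x)) * ennreal (v x) \<partial>M)"
    using \<Phi>_meas[of "\<tau> _"] \<tau>0 by (intro nn_integral_liminf) auto
  also have "\<dots> \<le> liminf (\<lambda>n. ennreal (4 * C) * ?XG)"
    by (intro Liminf_mono always_eventually allI main)
  also have "\<dots> = ennreal (4 * C) * ?XG" by (simp add: Liminf_const)
  also have "?XG \<le> (\<integral>\<^sup>+x. ennreal D * (extend_inf \<Phi> (G x * ennreal (u x)) * ennreal (v x)) \<partial>M)"
  proof (rule nn_integral_mono)
    fix x
    have "extend_inf \<Phi> (ennreal (4 * C) * y) \<le> ennreal D * extend_inf \<Phi> y" for y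
    proof (cases y)
      case (real s)
      then show ?thesis using doubling[of s] C D nonneg[of s]
        by (simp add: extend_inf_ennreal ennreal_leI flip: ennreal_mult')
    next
      case top
      have "0 < D"
      proof -
        have "\<Phi> 1 \<le> \<Phi> (4 * C * 1)" using C by (intro mono_onD[OF mono]) auto
        then have "\<Phi> 1 \<le> D * \<Phi> 1" using doubling[of 1] by linarith
        then show ?thesis using pos[of 1] D by (cases "D = 0") auto
      qed
      then show ?thesis using top by (simp add: ennreal_mult_top)
    qed
    then show "extend_inf \<Phi> (ennreal (4 * C) * (G x * ennreal (u x))) * ennreal (v x)
        \<le> ennreal D * (extend_inf \<Phi> (G x * ennreal (u x)) * ennreal (v x))"
      unfolding mult.assoc[symmetric, of "ennreal D"] by (intro mult_right_mono) auto
  qed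
  also have "\<dots> = ennreal D * (\<integral>\<^sup>+x. extend_inf \<Phi> (G x * ennreal (u x)) * ennreal (v x) \<partial>M)"
    by (rule nn_integral_cmult) measurable
  finally show ?thesis
    using C D by (simp add: ennreal_mult mult.assoc mult_left_mono)
qed

end

section \<open>Changing the exponent\<close>

lemma (in sigma_finite_measure) small_positive_function:
  fixes W :: "'a \<Rightarrow> real"
  assumes [measurable]: "W \<in> borel_measurable M" and W: "\<And>x. 0 < W x" and t: "0 < t" and e: "0 < e"
  obtains k where "k \<in> borel_measurable M" "\<And>x. 0 < k x" "(\<integral>\<^sup>+x. ennreal (k x powr t) * ennreal (W x) \<partial>M) \<le> ennreal e"
proof -
  obtain h where [measurable]: "h \<in> borel_measurable M" and h: "\<And>x. h x > (0::real)"
      "\<And>x. h x \<le> 1" "integrable M h"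
    by (rule obtain_positive_integrable_function, rule that)
  define c where "c = e / (integral\<^sup>L M h + 1)"
  have I0: "0 \<le> integral\<^sup>L M h" using h by (simp add: less_imp_le)
  have c: "0 < c" using e I0 unfolding c_def by (intro divide_pos_pos) auto
  define k where "k x = (c * h x / W x) powr (1 / t)" for x
  have k: "0 < k x" "k x powr t * W x = c * h x" for x
    using c h(1)[of x] W[of x] t by (auto simp: k_def powr_powr)
  have "(\<integral>\<^sup>+x. ennreal (k x powr t) * ennreal (W x) \<partial>M) = (\<integral>\<^sup>+x. ennreal (c * h x) \<partial>M)"
    by (intro nn_integral_cong) (simp add: k(2) flip: ennreal_mult')
  also have "\<dots> = ennreal (c * integral\<^sup>L M h)"
    using h c by (subst nn_integral_eq_integral) (auto simp: less_imp_le)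
  also have "\<dots> \<le> ennreal e"
    using e I0 unfolding c_def by (intro ennreal_leI) (simp add: field_simps)
  finally show ?thesis using k(1) by (intro that[of k]) (auto simp: k_def[abs_def])
qed

text \<open>
  The first term dominates where \<open>x \<ge> H\<close>, the second one elsewhere. This takes the place of Hoelder's inequality in the
  lowering of the exponent.
\<close>

lemma epowr_split_le:
  assumes "0 < p" "p < q" "0 < H"
  shows "x epowr p \<le> x epowr q * ennreal (H powr -(q - p)) + ennreal (H powr p)"
proof (cases x)
  case (real s)
  show ?thesis
  proof (cases "s \<le> H")
    case True
    then have "s powr p \<le> H powr p" using assms real by (intro powr_mono2) auto
    then show ?thesis using real assms by (simp add: epowr_ennreal_nonneg ennreal_leI add_increasing)
  next
    case False
    then have "s powr -(q - p) \<le> H powr -(q - p)" using assms by (intro powr_mono2') auto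
    then have "s powr q * s powr -(q - p) \<le> s powr q * H powr -(q - p)" by (intro mult_left_mono) auto
    moreover have "s powr q * s powr -(q - p) = s powr p" using False assms by (simp flip: powr_add)
    ultimately have "ennreal (s powr p) \<le> ennreal (s powr q) * ennreal (H powr -(q - p))"
      by (simp add: ennreal_leI flip: ennreal_mult')
    then show ?thesis using real assms by (simp add: epowr_ennreal_nonneg add_increasing2)
  qed
next
  case top
  then show ?thesis using assms by (simp add: epowr_top ennreal_top_mult)
qed

context muckenhoupt
begin

text \<open>
  The number \<open>(2 C)\<^sup>1\<^sup>/\<^sup>t\<close> is chosen so that the \<open>t\<close>-th powers of the normalised iterates have integrals at most
  \<open>2\<^sup>-\<^sup>j\<close> times that of \<open>k\<close>.
\<close>

lemma rdf_norm:
  assumes b: "maximal_bound t (ennreal C) W" and C: "1 \<le> C" and t: "0 < t"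
    and [measurable]: "W \<in> borel_measurable M" "k \<in> borel_measurable M"
  shows "(\<integral>\<^sup>+x. rdf (2 * (2 * C) powr (1 / t)) k x epowr t * ennreal (W x) \<partial>M)
    \<le> ennreal (2 powr t * 2) * (\<integral>\<^sup>+x. k x epowr t * ennreal (W x) \<partial>M)"
proof -
  define d where "d = (2 * C) powr (1 / t)"
  have d: "0 < d" "d powr t = 2 * C" using C t by (auto simp: d_def powr_powr)
  let ?m = "\<lambda>j. (ess_maximal ^^ j) k"
  let ?I = "\<integral>\<^sup>+x. k x epowr t * ennreal (W x) \<partial>M"
  define y where "y j x = ennreal ((1 / d) ^ j) * ?m j x" for j x
  have [measurable]: "y j \<in> borel_measurable M" for j unfolding y_def[abs_def] by measurable
  have pw: "((1 / d) ^ j) powr t = (1 / (2 * C)) ^ j" for j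
  proof -
    have "((1 / d) ^ j) powr t = ((1 / d) powr t) ^ j"
    proof (induction j)
      case (Suc j)
      have "((1 / d) ^ Suc j) powr t = (1 / d) powr t * ((1 / d) ^ j) powr t"
        unfolding power_Suc by (rule powr_mult)
      then show ?case by (simp only: Suc.IH power_Suc)
    qed simp
    then show ?thesis using d by (simp add: powr_divide)
  qed
  have rdf_eq: "rdf (2 * d) k x = (\<Sum>j. ennreal ((1/2) ^ j) * y j x)" for x
  proof -
    have "ennreal ((1 / (2 * d)) ^ j) = ennreal ((1/2) ^ j) * ennreal ((1 / d) ^ j)" for j
      using d by (simp add: power_mult_distrib[symmetric] flip: ennreal_mult')
    then show ?thesis unfolding rdf_def y_def by (simp add: mult.assoc)
  qed
  have mj: "(\<integral>\<^sup>+x. ?m j x epowr t * ennreal (W x) \<partial>M) \<le> ennreal (C ^ j) * ?I" for j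
  proof (induction j)
    case (Suc j)
    have "(\<integral>\<^sup>+x. ?m (Suc j) x epowr t * ennreal (W x) \<partial>M) \<le> ennreal C * (\<integral>\<^sup>+x. ?m j x epowr t * ennreal (W x) \<partial>M)"
      using maximal_boundD[OF b, of "?m j"] by simp
    also have "\<dots> \<le> ennreal C * (ennreal (C ^ j) * ?I)" by (intro mult_left_mono Suc.IH) auto
    also have "\<dots> = ennreal (C ^ Suc j) * ?I" using C by (simp add: ennreal_mult' mult.assoc)
    finally show ?case .
  qed simp
  have yj: "(\<integral>\<^sup>+x. y j x epowr t * ennreal (W x) \<partial>M) \<le> ennreal ((1/2) ^ j) * ?I" for j
  proof -
    have "(\<integral>\<^sup>+x. y j x epowr t * ennreal (W x) \<partial>M)
        = (\<integral>\<^sup>+x. ennreal ((1 / (2 * C)) ^ j) * (?m j x epowr t * ennreal (W x)) \<partial>M)"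
      using d t by (intro nn_integral_cong) (simp add: y_def epowr_mult epowr_ennreal pw mult.assoc)
    also have "\<dots> = ennreal ((1 / (2 * C)) ^ j) * (\<integral>\<^sup>+x. ?m j x epowr t * ennreal (W x) \<partial>M)"
      by (rule nn_integral_cmult) measurable
    also have "\<dots> \<le> ennreal ((1 / (2 * C)) ^ j) * (ennreal (C ^ j) * ?I)"
      by (intro mult_left_mono mj) auto
    also have "\<dots> = (ennreal ((1 / (2 * C)) ^ j) * ennreal (C ^ j)) * ?I" by (simp add: mult.assoc)
    also have "ennreal ((1 / (2 * C)) ^ j) * ennreal (C ^ j) = ennreal ((1/2) ^ j)"
      using C by (simp add: power_mult_distrib[symmetric] flip: ennreal_mult')
    finally show ?thesis .
  qed
  have "(\<integral>\<^sup>+x. rdf (2 * d) k x epowr t * ennreal (W x) \<partial>M)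
      \<le> (\<integral>\<^sup>+x. ennreal (2 powr t) * (\<Sum>j. y j x epowr t * ennreal (W x)) \<partial>M)"
  proof (rule nn_integral_mono)
    fix x
    have "rdf (2 * d) k x epowr t * ennreal (W x) \<le> (ennreal (2 powr t) * (\<Sum>j. y j x epowr t)) * ennreal (W x)"
      unfolding rdf_eq by (intro mult_right_mono epowr_geometric_sum_le t) auto
    then show "rdf (2 * d) k x epowr t * ennreal (W x) \<le> ennreal (2 powr t) * (\<Sum>j. y j x epowr t * ennreal (W x))"
      by (simp add: mult.assoc)
  qed
  also have "\<dots> = ennreal (2 powr t) * (\<Sum>j. \<integral>\<^sup>+x. y j x epowr t * ennreal (W x) \<partial>M)"
    by (simp add: nn_integral_cmult nn_integral_suminf del: ennreal_suminf_multc)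
  also have "\<dots> \<le> ennreal (2 powr t) * (\<Sum>j. ennreal ((1/2) ^ j) * ?I)"
    by (intro mult_left_mono suminf_le yj) auto
  also have "\<dots> = ennreal (2 powr t * 2) * ?I"
    by (simp only: ennreal_suminf_multc suminf_half) (simp add: ennreal_mult mult.assoc)
  finally show ?thesis by (simp only: d_def)
qed

text \<open>
  The inequality in \<open>L\<^sup>p\<close> for all factored weights, uniformly in weights with given \<open>A\<^sub>1\<close> constants of the factors.
  Changing \<open>p\<close> also changes \<open>a\<close>, and raising \<open>p\<close> requires \<open>a\<close> to be large; this is harmless, because an \<open>A\<^sub>1\<close>
  weight is factored with any \<open>a\<close> if \<open>w2 = 1\<close>.
\<close>

definition extrapolation_bound ::
    "(('a \<Rightarrow> ennreal) \<times> ('a \<Rightarrow> ennreal)) set \<Rightarrow> real \<Rightarrow> bool" where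
  "extrapolation_bound \<F> p \<longleftrightarrow> (\<exists>a0>0. \<forall>a\<ge>a0. \<forall>K\<ge>1. \<exists>C\<ge>1. \<forall>w1 w2 f g.
    A1 K w1 \<longrightarrow> A1 K w2 \<longrightarrow> (f, g) \<in> \<F> \<longrightarrow>
    (\<integral>\<^sup>+x. f x epowr p * ennreal (w1 x * w2 x powr - a) \<partial>M)
      \<le> ennreal C * (\<integral>\<^sup>+x. g x epowr p * ennreal (w1 x * w2 x powr - a) \<partial>M))"

lemma extrapolation_bound_A1:
  assumes "extrapolation_bound \<F> p" "1 \<le> K"
  obtains C where "1 \<le> C" "\<And>w f g. A1 K w \<Longrightarrow> (f, g) \<in> \<F> \<Longrightarrow>
    (\<integral>\<^sup>+x. f x epowr p * ennreal (w x) \<partial>M) \<le> ennreal C * (\<integral>\<^sup>+x. g x epowr p * ennreal (w x) \<partial>M)"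
proof -
  obtain a C where "1 \<le> C" and C: "\<And>w1 w2 f g. A1 K w1 \<Longrightarrow> A1 K w2 \<Longrightarrow> (f, g) \<in> \<F> \<Longrightarrow>
    (\<integral>\<^sup>+x. f x epowr p * ennreal (w1 x * w2 x powr - a) \<partial>M)
      \<le> ennreal C * (\<integral>\<^sup>+x. g x epowr p * ennreal (w1 x * w2 x powr - a) \<partial>M)"
    using assms unfolding extrapolation_bound_def by (meson order_refl)
  show ?thesis
    using \<open>1 \<le> C\<close> C[OF _ A1_one[OF assms(2)]] by (intro that[of C]) auto
qed

text \<open>
  Seek \<open>V \<ge> (w\<^sub>2\<^sup>a g\<^sup>q\<^sup>-\<^sup>p)\<^sup>1\<^sup>/\<^sup>A\<close> in \<open>A\<^sub>1\<close> and define \<open>H\<close> by \<open>H\<^sup>q\<^sup>-\<^sup>p = V\<^sup>A w\<^sub>2\<^sup>-\<^sup>a\<close>. Then \<open>H \<ge> g\<close>, and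
  \<open>H\<^sup>p\<^sup>-\<^sup>q w\<^sub>1 w\<^sub>2\<^sup>-\<^sup>a = w\<^sub>1 V\<^sup>-\<^sup>A\<close> is a factored weight, for which the bound with exponent \<open>q\<close> is available. The choice of
  \<open>A\<close> makes \<open>H\<^sup>p w\<^sub>1 w\<^sub>2\<^sup>-\<^sup>a\<close> equal to \<open>V\<^sup>t w\<^sub>1 w\<^sub>2\<^sup>1\<^sup>-\<^sup>t\<close>, so that the uniform bound of the maximal operator controls the
  remaining integral.
\<close>

lemma extrapolation_down:
  assumes E: "extrapolation_bound \<F> q" and fam: "extrapolation_family M \<F>" and p: "0 < p" "p < q"
  shows "extrapolation_bound \<F> p"
proof -
  obtain a0 where a0: "0 < a0" and E': "\<And>a K. a0 \<le> a \<Longrightarrow> 1 \<le> K \<Longrightarrow> \<exists>C\<ge>1. \<forall>w1 w2 f g.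
    A1 K w1 \<longrightarrow> A1 K w2 \<longrightarrow> (f, g) \<in> \<F> \<longrightarrow>
    (\<integral>\<^sup>+x. f x epowr q * ennreal (w1 x * w2 x powr - a) \<partial>M)
      \<le> ennreal C * (\<integral>\<^sup>+x. g x epowr q * ennreal (w1 x * w2 x powr - a) \<partial>M)"
    using E unfolding extrapolation_bound_def by blast
  have "\<exists>C\<ge>1. \<forall>w1 w2 f g. A1 K w1 \<longrightarrow> A1 K w2 \<longrightarrow> (f, g) \<in> \<F> \<longrightarrow>
    (\<integral>\<^sup>+x. f x epowr p * ennreal (w1 x * w2 x powr - a) \<partial>M)
      \<le> ennreal C * (\<integral>\<^sup>+x. g x epowr p * ennreal (w1 x * w2 x powr - a) \<partial>M)"
    if a: "a0 \<le> a" and K: "1 \<le> K" for a K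
  proof -
    define d where "d = q - p"
    have d: "0 < d" using p by (simp add: d_def)
    have ap: "0 < a" using a a0 by simp
    define t where "t = 1 + a * q / d"
    define A where "A = t * d / p"
    have t: "1 < t" using ap d p by (simp add: t_def)
    have tA: "t / A = p / d" "A * p / d = t" "0 < A" using t p d by (auto simp: A_def)
    have at: "a + a * p / d = t - 1" using d by (simp add: t_def d_def field_simps)
    have "a \<le> A"
    proof -
      have "a * p \<le> a * q" using ap p by simp
      also have "\<dots> \<le> d + a * q" using d by simp
      also have "\<dots> = A * p" using p d by (simp add: A_def t_def field_simps)
      finally show ?thesis using p by simp
    qed
    then have A0: "a0 \<le> A" using a by simp
    obtain C1 where C1: "1 \<le> C1" "\<And>w1 w2. A1 K w1 \<Longrightarrow> A1 K w2 \<Longrightarrow>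
        maximal_bound t (ennreal C1) (\<lambda>x. w1 x * w2 x powr (1 - t))"
      using ess_maximal_uniform_bound[OF t K] by blast
    define c where "c = 2 * (2 * C1) powr (1 / t)"
    have c: "1 \<le> c" "0 < c"
    proof -
      have "1 \<le> (2 * C1) powr (1 / t)" using C1(1) t by (intro ge_one_powr_ge_zero) auto
      then show "1 \<le> c" by (simp add: c_def)
      then show "0 < c" by simp
    qed
    define K' where "K' = max K c"
    have K'1: "1 \<le> K'" using K by (simp add: K'_def)
    obtain C2 where C2: "1 \<le> C2" "\<And>w1 w2 f g. A1 K' w1 \<Longrightarrow> A1 K' w2 \<Longrightarrow> (f, g) \<in> \<F> \<Longrightarrow>
      (\<integral>\<^sup>+x. f x epowr q * ennreal (w1 x * w2 x powr - A) \<partial>M)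
        \<le> ennreal C2 * (\<integral>\<^sup>+x. g x epowr q * ennreal (w1 x * w2 x powr - A) \<partial>M)"
      using E'[OF A0 K'1] by blast
    define C3 where "C3 = 2 powr t * 2 * 2 powr t"
    have C3: "0 \<le> C3" by (simp add: C3_def)
    have "(\<integral>\<^sup>+x. f x epowr p * ennreal (w1 x * w2 x powr - a) \<partial>M)
      \<le> ennreal (C2 + C3) * (\<integral>\<^sup>+x. g x epowr p * ennreal (w1 x * w2 x powr - a) \<partial>M)"
      if w1: "A1 K w1" and w2: "A1 K w2" and fg: "(f, g) \<in> \<F>" for w1 w2 f g
    proof (cases "(\<integral>\<^sup>+x. g x epowr p * ennreal (w1 x * w2 x powr - a) \<partial>M) = \<infinity>")
      case True
      then show ?thesis using C2(1) C3 by (simp add: ennreal_mult_top del: ennreal_plus)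
    next
      case False
      let ?I = "\<integral>\<^sup>+x. g x epowr p * ennreal (w1 x * w2 x powr - a) \<partial>M"
      note [measurable] = A1_measurable[OF w1] A1_measurable[OF w2]
      have [measurable]: "f \<in> borel_measurable M" "g \<in> borel_measurable M"
        using fam fg by (auto simp: extrapolation_family_def)
      note p1 = A1_pos[OF w1] and p2 = A1_pos[OF w2]
      let ?W = "\<lambda>x. w1 x * w2 x powr (1 - t)"
      have W0: "0 < ?W x" for x using p1[of x] p2[of x] by simp
      have Wm: "?W \<in> borel_measurable M" by measurable
      have t0: "0 < t" using t by simp
      have "AE x in M. g x epowr p * ennreal (w1 x * w2 x powr - a) \<noteq> \<infinity>"
        using False by (intro nn_integral_PInf_AE) auto
      then have g_fin: "AE x in M. g x \<noteq> top"
      proof eventually_elim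
        case (elim x)
        show ?case
        proof
          assume "g x = top"
          then show False using elim p1[of x] p2[of x] p by (simp add: epowr_top ennreal_top_mult)
        qed
      qed
      show ?thesis
      proof (rule ennreal_le_epsilon)
        fix e :: real assume e: "0 < e"
        define e' where "e' = e / (C3 + 1)"
        have e': "0 < e'" "C3 * e' \<le> e" using e C3 by (auto simp: e'_def field_simps)
        obtain k0 where [measurable]: "k0 \<in> borel_measurable M" and k0: "\<And>x. 0 < k0 x"
          "(\<integral>\<^sup>+x. ennreal (k0 x powr t) * ennreal (?W x) \<partial>M) \<le> ennreal e'"
          by (rule small_positive_function[OF Wm W0 t0 e'(1)], rule that)
        \<comment> \<open>the summand \<open>k0\<close> below keeps the majorant positive where \<open>g\<close> vanishes\<close>
        define k1 where "k1 x = (ennreal (w2 x powr a) * g x epowr d) epowr (1 / A)" for x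
        define k where "k x = k1 x + ennreal (k0 x)" for x
        have [measurable]: "k1 \<in> borel_measurable M" unfolding k1_def[abs_def] by measurable
        have [measurable]: "k \<in> borel_measurable M" unfolding k_def[abs_def] by measurable
        have k_pos: "0 < k x" for x using k0(1)[of x] by (simp add: k_def add_pos_nonneg add_nonneg_pos)
        have k1t: "k1 x epowr t * ennreal (?W x) = g x epowr p * ennreal (w1 x * w2 x powr - a)" for x
        proof -
          have "k1 x epowr t = (ennreal (w2 x powr a) * g x epowr d) epowr (p / d)"
            unfolding k1_def using t tA by (simp add: epowr_epowr)
          also have "\<dots> = ennreal (w2 x powr (a * p / d)) * g x epowr p"
            using p d p2[of x] by (simp add: epowr_mult epowr_ennreal epowr_epowr powr_powr)
          finally have "k1 x epowr t * ennreal (?W x) = g x epowr p * (ennreal (w2 x powr (a * p / d)) * ennreal (?W x))"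
            by (simp add: mult_ac)
          also have "ennreal (w2 x powr (a * p / d)) * ennreal (?W x) = ennreal (w1 x * (w2 x powr (a * p / d) * w2 x powr (1 - t)))"
            by (simp add: mult_ac flip: ennreal_mult')
          also have "w2 x powr (a * p / d) * w2 x powr (1 - t) = w2 x powr - a"
          proof -
            have "a * p / d + (1 - t) = - a" using at by linarith
            then show ?thesis by (simp only: powr_add[symmetric])
          qed
          finally show ?thesis .
        qed
        have kt: "(\<integral>\<^sup>+x. k x epowr t * ennreal (?W x) \<partial>M) \<le> ennreal (2 powr t) * (?I + ennreal e')"
        proof -
          have "(\<integral>\<^sup>+x. k x epowr t * ennreal (?W x) \<partial>M)
              \<le> (\<integral>\<^sup>+x. ennreal (2 powr t) * (k1 x epowr t * ennreal (?W x) + ennreal (k0 x powr t) * ennreal (?W x)) \<partial>M)"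
          proof (rule nn_integral_mono)
            fix x
            have "k x epowr t * ennreal (?W x) \<le> (ennreal (2 powr t) * (k1 x epowr t + ennreal (k0 x) epowr t)) * ennreal (?W x)"
              unfolding k_def using t by (intro mult_right_mono epowr_add_le) auto
            then show "k x epowr t * ennreal (?W x)
                \<le> ennreal (2 powr t) * (k1 x epowr t * ennreal (?W x) + ennreal (k0 x powr t) * ennreal (?W x))"
              by (simp only: epowr_ennreal[OF k0(1)] mult.assoc distrib_right)
          qed
          also have "\<dots> = ennreal (2 powr t) * ((\<integral>\<^sup>+x. k1 x epowr t * ennreal (?W x) \<partial>M) + (\<integral>\<^sup>+x. ennreal (k0 x powr t) * ennreal (?W x) \<partial>M))"
            by (subst nn_integral_cmult) (auto simp: nn_integral_add)
          also have "\<dots> \<le> ennreal (2 powr t) * (?I + ennreal e')"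
            unfolding k1t by (intro mult_left_mono add_left_mono k0(2)) auto
          finally show ?thesis .
        qed
        have Vt: "(\<integral>\<^sup>+x. rdf c k x epowr t * ennreal (?W x) \<partial>M) \<le> ennreal C3 * (?I + ennreal e')"
        proof -
          have "(\<integral>\<^sup>+x. rdf c k x epowr t * ennreal (?W x) \<partial>M) \<le> ennreal (2 powr t * 2) * (\<integral>\<^sup>+x. k x epowr t * ennreal (?W x) \<partial>M)"
            unfolding c_def using t by (intro rdf_norm[OF C1(2)[OF w1 w2] C1(1)]) auto
          also have "\<dots> \<le> ennreal (2 powr t * 2) * (ennreal (2 powr t) * (?I + ennreal e'))"
            by (intro mult_left_mono kt) auto
          also have "\<dots> = ennreal C3 * (?I + ennreal e')"
            unfolding C3_def by (simp add: ennreal_mult mult.assoc)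
          finally show ?thesis .
        qed
        have "ennreal C3 * (?I + ennreal e') < \<infinity>"
          using False by (simp add: ennreal_mult_less_top less_top)
        then have "(\<integral>\<^sup>+x. rdf c k x epowr t * ennreal (?W x) \<partial>M) \<noteq> \<infinity>" using Vt by auto
        then have "AE x in M. rdf c k x epowr t * ennreal (?W x) \<noteq> \<infinity>" by (intro nn_integral_PInf_AE) auto
        then have rdf_fin: "AE x in M. rdf c k x < \<infinity>"
        proof eventually_elim
          case (elim x)
          show ?case
          proof (rule ccontr)
            assume "\<not> rdf c k x < \<infinity>"
            then have "rdf c k x = top" by (simp add: not_less top_unique)
            then show False using elim p1[of x] p2[of x] t
              by (auto simp: epowr_top ennreal_top_mult split: if_splits)
          qed
        qed
        obtain V where V: "A1 c V" "AE x in M. ennreal (V x) = rdf c k x"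
          using rdf_A1[OF c(2) _ _ rdf_fin] k_pos by auto
        note [measurable] = A1_measurable[OF V(1)]
        note Vp = A1_pos[OF V(1)]
        define H where "H x = (V x powr A * w2 x powr - a) powr (1 / d)" for x
        have H: "0 < H x" for x using Vp[of x] p2[of x] by (simp add: H_def)
        have Hd: "H x powr - d * w2 x powr - a = V x powr - A" for x
        proof -
          have "H x powr - d = V x powr - A * w2 x powr a"
            using Vp[of x] p2[of x] d by (simp add: H_def powr_powr powr_mult)
          then show ?thesis using p2[of x] by (simp add: powr_minus)
        qed
        have Hp: "H x powr p * (w1 x * w2 x powr - a) = V x powr t * ?W x" for x
        proof -
          have "H x powr p = V x powr t * w2 x powr (- (a * p / d))"
            using Vp[of x] p2[of x] d tA by (simp add: H_def powr_powr powr_mult)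
          then have "H x powr p * (w1 x * w2 x powr - a) = V x powr t * (w1 x * (w2 x powr (- (a * p / d)) * w2 x powr - a))"
            by simp
          also have "w2 x powr (- (a * p / d)) * w2 x powr - a = w2 x powr (1 - t)"
          proof -
            have "- (a * p / d) + - a = 1 - t" using at by linarith
            then show ?thesis by (simp only: powr_add[symmetric])
          qed
          finally show ?thesis .
        qed
        have "(\<integral>\<^sup>+x. f x epowr p * ennreal (w1 x * w2 x powr - a) \<partial>M)
            \<le> (\<integral>\<^sup>+x. f x epowr q * ennreal (w1 x * V x powr - A) + ennreal (V x powr t) * ennreal (?W x) \<partial>M)"
        proof (rule nn_integral_mono)
          fix x
          have "f x epowr p * ennreal (w1 x * w2 x powr - a)
              \<le> (f x epowr q * ennreal (H x powr - d) + ennreal (H x powr p)) * ennreal (w1 x * w2 x powr - a)"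
            unfolding d_def using p H by (intro mult_right_mono epowr_split_le) auto
          also have "\<dots> = f x epowr q * (ennreal (H x powr - d) * ennreal (w1 x * w2 x powr - a))
              + ennreal (H x powr p) * ennreal (w1 x * w2 x powr - a)"
            by (simp add: distrib_right mult.assoc)
          also have "ennreal (H x powr - d) * ennreal (w1 x * w2 x powr - a) = ennreal (w1 x * V x powr - A)"
            by (simp flip: Hd ennreal_mult') (simp add: mult_ac)
          also have "ennreal (H x powr p) * ennreal (w1 x * w2 x powr - a) = ennreal (V x powr t) * ennreal (?W x)"
            by (simp only: ennreal_mult'[symmetric] powr_ge_zero Hp)
          finally show "f x epowr p * ennreal (w1 x * w2 x powr - a)
              \<le> f x epowr q * ennreal (w1 x * V x powr - A) + ennreal (V x powr t) * ennreal (?W x)" .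
        qed
        also have "\<dots> = (\<integral>\<^sup>+x. f x epowr q * ennreal (w1 x * V x powr - A) \<partial>M) + (\<integral>\<^sup>+x. ennreal (V x powr t) * ennreal (?W x) \<partial>M)"
          by (subst nn_integral_add) auto
        also have "(\<integral>\<^sup>+x. ennreal (V x powr t) * ennreal (?W x) \<partial>M) = (\<integral>\<^sup>+x. rdf c k x epowr t * ennreal (?W x) \<partial>M)"
        proof (rule nn_integral_cong_AE)
          show "AE x in M. ennreal (V x powr t) * ennreal (?W x) = rdf c k x epowr t * ennreal (?W x)"
            using V(2) by eventually_elim (use Vp in \<open>simp add: epowr_ennreal[symmetric]\<close>)
        qed
        also have "(\<integral>\<^sup>+x. f x epowr q * ennreal (w1 x * V x powr - A) \<partial>M)
            \<le> ennreal C2 * (\<integral>\<^sup>+x. g x epowr q * ennreal (w1 x * V x powr - A) \<partial>M)"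
          by (intro C2(2) A1_mono[OF w1] A1_mono[OF V(1)] fg) (auto simp: K'_def)
        also have "(\<integral>\<^sup>+x. g x epowr q * ennreal (w1 x * V x powr - A) \<partial>M) \<le> ?I"
        proof (rule nn_integral_mono_AE)
          show "AE x in M. g x epowr q * ennreal (w1 x * V x powr - A) \<le> g x epowr p * ennreal (w1 x * w2 x powr - a)"
            using V(2) g_fin
          proof eventually_elim
            case (elim x)
            obtain s where s: "g x = ennreal s" "0 \<le> s" using elim(2) by (cases "g x") auto
            have "k1 x \<le> ennreal (V x)"
              unfolding elim(1) using rdf_ge[of k x c] by (auto simp: k_def intro: order_trans[rotated])
            moreover have "k1 x = ennreal ((w2 x powr a * s powr d) powr (1 / A))"
              unfolding k1_def using s d tA by (simp add: epowr_ennreal_nonneg flip: ennreal_mult')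
            ultimately have "(w2 x powr a * s powr d) powr (1 / A) \<le> V x"
              using Vp[of x] by (simp add: ennreal_le_iff)
            then have "((w2 x powr a * s powr d) powr (1 / A)) powr A \<le> V x powr A"
              using tA by (intro powr_mono2) auto
            then have le: "w2 x powr a * s powr d \<le> V x powr A" using tA by (simp add: powr_powr)
            have "s powr d * V x powr - A \<le> w2 x powr - a"
              using le Vp[of x] p2[of x] by (simp add: powr_minus field_simps)
            then have "(s powr p * w1 x) * (s powr d * V x powr - A) \<le> (s powr p * w1 x) * w2 x powr - a"
              using p1[of x] by (intro mult_left_mono) auto
            moreover have "s powr q = s powr p * s powr d" by (simp add: d_def flip: powr_add)
            ultimately have "s powr q * (w1 x * V x powr - A) \<le> s powr p * (w1 x * w2 x powr - a)"
              by (simp add: mult_ac)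
            then show ?case using s p by (simp add: epowr_ennreal_nonneg ennreal_leI flip: ennreal_mult')
          qed
        qed
        also note Vt
        also have "ennreal C2 * ?I + ennreal C3 * (?I + ennreal e') = ennreal (C2 + C3) * ?I + ennreal (C3 * e')"
          using C2(1) C3 e' by (simp add: distrib_left distrib_right ennreal_mult' ennreal_plus add.assoc)
        also have "\<dots> \<le> ennreal (C2 + C3) * ?I + ennreal e"
          by (intro add_left_mono ennreal_leI e')
        finally show "(\<integral>\<^sup>+x. f x epowr p * ennreal (w1 x * w2 x powr - a) \<partial>M) \<le> ennreal (C2 + C3) * ?I + ennreal e"
          by (simp add: add_mono mult_left_mono)
      qed
    qed
    then show ?thesis using C2(1) C3 by (intro exI[of _ "C2 + C3"]) auto
  qed
  then show ?thesis using a0 unfolding extrapolation_bound_def by blast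
qed

text \<open>
  With \<open>s = p/(1+a) < q\<close>, the integral of \<open>f\<^sup>p\<close> is the modular of \<open>f\<^sup>s\<close> for the power \<open>1+a\<close>. The complementary
  modular lives on \<open>L\<^sup>t\<close> with \<open>t = (1+a)/a\<close>, and the dual weight
  \<open>(w\<^sub>1 w\<^sub>2\<^sup>-\<^sup>a)\<^sup>1\<^sup>-\<^sup>t = w\<^sub>2 w\<^sub>1\<^sup>1\<^sup>-\<^sup>t\<close> is again factored, with the roles of the factors interchanged.
\<close>

lemma extrapolation_up:
  assumes E: "extrapolation_bound \<F> q" and fam: "extrapolation_family M \<F>" and p: "0 < q" "q < p"
  shows "extrapolation_bound \<F> p"
proof -
  have "\<exists>C\<ge>1. \<forall>w1 w2 f g. A1 K w1 \<longrightarrow> A1 K w2 \<longrightarrow> (f, g) \<in> \<F> \<longrightarrow>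
    (\<integral>\<^sup>+x. f x epowr p * ennreal (w1 x * w2 x powr - a) \<partial>M)
      \<le> ennreal C * (\<integral>\<^sup>+x. g x epowr p * ennreal (w1 x * w2 x powr - a) \<partial>M)"
    if a: "p / q \<le> a" and K: "1 \<le> K" for a K
  proof -
    have a0: "0 < a" using a p by (intro less_le_trans[OF _ a]) auto
    define r where "r = 1 + a"
    define t where "t = r / (r - 1)"
    have r: "1 < r" using a0 by (simp add: r_def)
    have t: "1 < t" "a * (t - 1) = 1" using a0 by (auto simp: t_def r_def field_simps)
    define s where "s = p / r"
    have s: "0 < s" "s < q" "s * r = p"
    proof -
      show "0 < s" using p r by (simp add: s_def)
      have "p \<le> a * q" using a p by (simp add: field_simps)
      then have "p < q * r" using p by (simp add: r_def algebra_simps)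
      then show "s < q" using r by (simp add: s_def field_simps)
      show "s * r = p" using r by (simp add: s_def)
    qed
    obtain N where N: "1 \<le> N" "\<And>w1 w2. A1 K w1 \<Longrightarrow> A1 K w2 \<Longrightarrow>
        maximal_bound t (ennreal N) (\<lambda>x. w1 x * w2 x powr (1 - t))"
      using ess_maximal_uniform_bound[OF t(1) K] by blast
    obtain C where C: "1 \<le> C" "\<And>w f g. A1 (2 * N) w \<Longrightarrow> (f, g) \<in> \<F> \<Longrightarrow>
        (\<integral>\<^sup>+x. f x epowr s * ennreal (w x) \<partial>M) \<le> ennreal C * (\<integral>\<^sup>+x. g x epowr s * ennreal (w x) \<partial>M)"
      using extrapolation_bound_A1[OF extrapolation_down[OF E fam s(1,2)], of "2 * N"] N(1) by auto
    define D where "D = (4 * C) powr r"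
    have D: "1 \<le> D" unfolding D_def using C(1) r by (intro ge_one_powr_ge_zero) auto
    have "(\<integral>\<^sup>+x. f x epowr p * ennreal (w1 x * w2 x powr - a) \<partial>M)
      \<le> ennreal (4 * C * D) * (\<integral>\<^sup>+x. g x epowr p * ennreal (w1 x * w2 x powr - a) \<partial>M)"
      if w1: "A1 K w1" and w2: "A1 K w2" and fg: "(f, g) \<in> \<F>" for w1 w2 f g
    proof -
      note [measurable] = A1_measurable[OF w1] A1_measurable[OF w2]
      have [measurable]: "f \<in> borel_measurable M" "g \<in> borel_measurable M"
        using fam fg by (auto simp: extrapolation_family_def)
      note p1 = A1_pos[OF w1] and p2 = A1_pos[OF w2]
      define W where "W x = w1 x * w2 x powr - a" for x
      have [measurable]: "W \<in> borel_measurable M" unfolding W_def[abs_def] by measurable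
      have W: "0 < W x" for x using p1[of x] p2[of x] by (simp add: W_def)
      have dual: "(1 / W x) powr t * W x = w2 x * w1 x powr (1 - t)" for x
      proof -
        have "(1 / W x) powr t * W x = W x powr (1 - t)"
          using W[of x] by (simp add: powr_divide powr_diff)
        also have "\<dots> = w1 x powr (1 - t) * w2 x powr (a * (t - 1))"
          using p1[of x] p2[of x] by (simp add: W_def powr_mult powr_powr algebra_simps)
        finally show ?thesis using p2[of x] t by simp
      qed
      have step: "(\<integral>\<^sup>+x. extend_inf (\<lambda>s. s powr t) (ess_maximal m x * ennreal (1 / (W x * 1))) * ennreal (W x) \<partial>M)
        \<le> ennreal N * (\<integral>\<^sup>+x. extend_inf (\<lambda>s. s powr t) (m x * ennreal (1 / (W x * 1))) * ennreal (W x) \<partial>M)"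
        if [measurable]: "m \<in> borel_measurable M" for m
      proof -
        have eq: "extend_inf (\<lambda>s. s powr t) (y * ennreal (1 / (W x * 1))) * ennreal (W x)
            = y epowr t * ennreal (w2 x * w1 x powr (1 - t))" for y x
          using t W[of x] dual[of x] by (simp add: extend_inf_powr epowr_mult epowr_ennreal mult.assoc flip: ennreal_mult')
        show ?thesis unfolding eq by (rule maximal_boundD[OF N(2)[OF w2 w1]]) fact
      qed
      have "(\<integral>\<^sup>+x. extend_inf (\<lambda>s. s powr r) (f x epowr s * ennreal 1) * ennreal (W x) \<partial>M)
        \<le> ennreal (4 * C * D) * (\<integral>\<^sup>+x. extend_inf (\<lambda>s. s powr r) (g x epowr s * ennreal 1) * ennreal (W x) \<partial>M)"
      proof (rule modular_extrapolation[OF young_pair_powr[OF r], where N=N])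
        show "(4 * C * y) powr r \<le> D * y powr r" if "0 \<le> y" for y
          using that C(1) by (simp add: D_def powr_mult)
      qed (use N(1) C D W step[unfolded t_def] fg in auto)
      then show ?thesis
        using r s by (simp add: extend_inf_powr epowr_epowr W_def)
    qed
    moreover have "1 \<le> 4 * C * D" using C(1) D by (intro mult_ge1_I) auto
    ultimately show ?thesis by blast
  qed
  moreover have "0 < p / q" using p by simp
  ultimately show ?thesis unfolding extrapolation_bound_def by blast
qed

lemma extrapolation_all:
  assumes "extrapolation_bound \<F> q" "extrapolation_family M \<F>" "0 < q" "0 < p"
  shows "extrapolation_bound \<F> p"
  using extrapolation_down[OF assms(1,2), of p] extrapolation_up[OF assms(1,2,3), of p] assms
  by (cases p q rule: linorder_cases) auto

end

section \<open>Muckenhoupt constants and the extrapolation hypothesis\<close>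

lemma tangent_inequality:
  assumes "0 < (y::real)" and "0 \<le> s"
  shows "1 + s \<le> y powr - s + s * y"
proof -
  have "1 + - s * ln y \<le> exp (- s * ln y)" by (rule exp_ge_add_one_self)
  then have "1 - s * ln y \<le> y powr - s" using assms by (simp add: powr_def)
  moreover have "s * ln y \<le> s * (y - 1)"
    using assms by (intro mult_left_mono ln_le_minus_one) auto
  ultimately show ?thesis by (simp add: algebra_simps)
qed

lemma infsum_ennreal_nat:
  fixes h :: "nat \<Rightarrow> ennreal"
  shows "(\<Sum>\<^sub>\<infinity>j\<in>J. h j) = (\<Sum>j. if j \<in> J then h j else 0)"
proof -
  have "(\<Sum>\<^sub>\<infinity>j\<in>J. h j) = (\<Sum>\<^sub>\<infinity>j. if j \<in> J then h j else 0)"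
    by (rule infsum_cong_neutral) auto
  moreover have "((\<lambda>j. if j \<in> J then h j else 0) has_sum (\<Sum>\<^sub>\<infinity>j. if j \<in> J then h j else 0)) UNIV"
    by (rule has_sum_infsum) (simp add: nonneg_summable_on_complete)
  ultimately show ?thesis
    using has_sum_imp_sums sums_unique by metis
qed

context muckenhoupt
begin

text \<open>
  For \<open>p > 1\<close>, average the tangent inequality for the convex function \<open>y\<^sup>-\<^sup>s\<close>, with \<open>s = 1/(p-1)\<close>, at the
  average of \<open>w\<close>. For \<open>p = 1\<close>, average \<open>w\<close> over \<open>B\<close> in the pointwise bound of its average.
\<close>

lemma Ap_const_ge_one:
  assumes p: "1 \<le> p" and w: "w \<in> Ap M \<B> p"
  shows "1 \<le> Ap_const M \<B> p w"
proof -
  have [measurable]: "w \<in> borel_measurable M" and wp: "AE x in M. 0 < w x \<and> w x < \<infinity>"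
    and fin: "Ap_const M \<B> p w < \<infinity>"
    using w by (auto simp: Ap_def weight_def)
  obtain B where B: "B \<in> \<B>" using basis_nonempty by blast
  have [measurable]: "B \<in> sets M" by (rule basis_sets[OF B])
  have nontriv: "\<not> (AE x in M. x \<in> B \<longrightarrow> False)"
    using prob_space.AE_False[OF prob_space_on_basis[OF B]] AE_on_basis_iff[OF B, of "\<lambda>_. False"] by simp
  let ?A = "average M B w"
  have A0: "?A \<noteq> 0"
  proof
    assume "?A = 0"
    then have "AE x in uniform_measure M B. w x = 0"
      using B by (simp add: average_eq_nn_integral basis_sets nn_integral_0_iff_AE)
    then have "AE x in M. x \<in> B \<longrightarrow> w x = 0" using AE_on_basis_iff[OF B] by simp
    with wp have "AE x in M. x \<in> B \<longrightarrow> False" by eventually_elim auto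
    then show False using nontriv by simp
  qed
  show ?thesis
  proof (cases "p = 1")
    case True
    define c where "c = esssup M (\<lambda>x. maximal M \<B> w x * inverse (w x))"
    have c: "Ap_const M \<B> p w = c" "c < \<infinity>" using True fin by (auto simp: Ap_const_def c_def)
    have "AE x in M. maximal M \<B> w x * inverse (w x) \<le> c"
      unfolding c_def by (rule esssup_AE)
    with wp have le: "AE x in M. x \<in> B \<longrightarrow> ?A \<le> c * w x"
    proof eventually_elim
      case (elim x)
      show ?case
      proof
        assume x: "x \<in> B"
        have "?A \<le> maximal M \<B> w x" unfolding maximal_def using B x by (intro SUP_upper) auto
        then have "?A * inverse (w x) \<le> c" using elim by (meson mult_right_mono order_trans zero_le)
        then have "?A * inverse (w x) * w x \<le> c * w x" by (intro mult_right_mono) auto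
        moreover have "inverse (w x) * w x = 1"
          using elim ennreal_divide_self[of "w x"] by (auto simp: divide_ennreal_def mult.commute less_top)
        ultimately show "?A \<le> c * w x" by (simp add: mult.assoc)
      qed
    qed
    have A_fin: "?A \<noteq> \<infinity>"
    proof
      assume A: "?A = \<infinity>"
      from le wp have "AE x in M. x \<in> B \<longrightarrow> False"
        by eventually_elim (use c(2) A in \<open>auto simp: top_unique ennreal_mult_eq_top_iff\<close>)
      then show False using nontriv by simp
    qed
    have "average M B (\<lambda>_. ?A) \<le> average M B (\<lambda>x. c * w x)"
      using le B by (intro average_mono) auto
    then have "?A \<le> c * ?A" using B by (simp add: average_const average_cmult)
    then have "?A * 1 \<le> ?A * c" by (simp add: mult.commute)
    then have "1 \<le> c" using A0 A_fin by (subst (asm) ennreal_mult_le_mult_iff) auto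
    then show ?thesis using c by simp
  next
    case False
    then have p1: "1 < p" using p by simp
    define s where "s = 1 / (p - 1)"
    have s: "0 < s" "1 - conj_exponent p = - s" "s * (p - 1) = 1"
      using p1 by (auto simp: s_def conj_exponent_def field_simps)
    let ?b = "average M B (\<lambda>x. w x epowr - s)"
    have "1 \<le> ?A * ?b epowr (p - 1)"
    proof (cases "?A = \<infinity>")
      case True
      have "?b \<noteq> 0"
      proof
        assume "?b = 0"
        then have "AE x in uniform_measure M B. w x epowr - s = 0"
          using B by (simp add: average_eq_nn_integral basis_sets nn_integral_0_iff_AE)
        then have "AE x in M. x \<in> B \<longrightarrow> w x epowr - s = 0" using AE_on_basis_iff[OF B] by simp
        with wp have "AE x in M. x \<in> B \<longrightarrow> False"
        proof eventually_elim
          case (elim x)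
          then obtain y where "w x = ennreal y" "0 < y" by (cases "w x") auto
          then show ?case using elim by (simp add: epowr_ennreal)
        qed
        then show False using nontriv by simp
      qed
      then have "?b epowr (p - 1) \<noteq> 0"
        using p1 by (cases ?b) (auto simp: epowr_ennreal_nonneg epowr_top)
      then show ?thesis using True by (simp add: ennreal_top_mult)
    next
      case False
      then obtain a where a: "?A = ennreal a" "0 < a" using A0 by (cases ?A) (auto simp: less_le)
      have "average M B (\<lambda>_. ennreal ((1 + s) * a powr - s)) \<le>
          average M B (\<lambda>x. w x epowr - s + ennreal (s * a powr (- s - 1)) * w x)"
      proof (intro average_mono B)
        show "AE x in M. x \<in> B \<longrightarrow> ennreal ((1 + s) * a powr - s)
            \<le> w x epowr - s + ennreal (s * a powr (- s - 1)) * w x"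
          using wp
        proof eventually_elim
          case (elim x)
          then obtain y where y: "w x = ennreal y" "0 < y" by (cases "w x") auto
          have "(1 + s) * a powr - s \<le> ((y / a) powr - s + s * (y / a)) * a powr - s"
            using y a s by (intro mult_right_mono tangent_inequality) auto
          also have "\<dots> = y powr - s + s * a powr (- s - 1) * y"
            using y a by (simp add: powr_divide powr_diff distrib_right)
          finally show ?case
            using y s by (simp add: epowr_ennreal ennreal_leI flip: ennreal_mult' ennreal_plus)
        qed
      qed auto
      also have "\<dots> = ?b + ennreal (s * a powr (- s - 1)) * ?A"
        using B by (simp add: average_add average_cmult)
      also have "ennreal (s * a powr (- s - 1)) * ?A = ennreal (s * a powr - s)"
        using a s by (simp add: powr_diff flip: ennreal_mult)
      finally have le: "ennreal ((1 + s) * a powr - s) \<le> ?b + ennreal (s * a powr - s)"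
        using B by (simp add: average_const)
      have "ennreal (a powr - s) \<le> ?b"
      proof (cases ?b)
        case (real b)
        then have "ennreal ((1 + s) * a powr - s) \<le> ennreal (b + s * a powr - s)"
          using le s by (simp add: ennreal_plus)
        then have "a powr - s \<le> b" using real s by (simp add: distrib_right del: ennreal_plus)
        then show ?thesis using real by (simp add: ennreal_leI)
      qed simp
      then have "ennreal (a powr - s) epowr (p - 1) \<le> ?b epowr (p - 1)"
        using p1 by (intro epowr_mono) auto
      moreover have "ennreal (a powr - s) epowr (p - 1) = ennreal (1 / a)"
      proof -
        have "(a powr - s) powr (p - 1) = a powr - 1"
          using s(3) by (simp only: powr_powr mult_minus_left)
        also have "\<dots> = 1 / a" using a(2) by (simp add: powr_minus inverse_eq_divide)
        finally show ?thesis using a(2) by (subst epowr_ennreal) auto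
      qed
      ultimately have "ennreal a * ennreal (1 / a) \<le> ?A * ?b epowr (p - 1)"
        unfolding a(1) by (intro mult_left_mono) auto
      then show ?thesis using a by (simp flip: ennreal_mult)
    qed
    also have "\<dots> \<le> Ap_const M \<B> p w"
      using False B s(2) by (auto simp: Ap_const_def intro!: SUP_upper2[of B])
    finally show ?thesis .
  qed
qed

text \<open>
  A factored weight lies in \<open>A\<^sub>1\<^sub>+\<^sub>a\<close> with constant at most \<open>K\<^sup>1\<^sup>+\<^sup>a\<close>. That its \<open>A\<^sub>\<infinity>\<close> constant is at least \<open>1\<close>
  matters, as \<open>\<Psi>\<close> is monotone on \<open>[1, \<infinity>)\<close> only.
\<close>

lemma extrapolation_bound_of_hypothesis:
  assumes \<Psi>: "\<Psi> \<in> {1..} \<rightarrow> {1..}" "mono_on {1..} \<Psi>" and p: "0 < p" and fam: "extrapolation_family M \<F>"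
    and hyp: "\<forall>w\<in>Ainf M \<B>. \<forall>(f, g)\<in>\<F>.
      Lp_norm (density M w) p f \<le> ennreal (\<Psi> (enn2real (Ainf_const M \<B> w))) * Lp_norm (density M w) p g"
  shows "extrapolation_bound \<F> p"
  unfolding extrapolation_bound_def
proof (rule exI[of _ 1], intro conjI allI impI)
  fix a K :: real assume a: "1 \<le> a" and K: "1 \<le> K"
  define r where "r = 1 + a"
  have r: "1 < r" "1 - r = - a" using a by (auto simp: r_def)
  define c where "c = \<Psi> (K powr r)"
  have Kr: "1 \<le> K powr r" using K r by (intro ge_one_powr_ge_zero) auto
  have c: "1 \<le> c" using \<Psi>(1) Kr by (auto simp: c_def Pi_iff)
  have "(\<integral>\<^sup>+x. f x epowr p * ennreal (w1 x * w2 x powr - a) \<partial>M)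
      \<le> ennreal (c powr p) * (\<integral>\<^sup>+x. g x epowr p * ennreal (w1 x * w2 x powr - a) \<partial>M)"
    if w1: "A1 K w1" and w2: "A1 K w2" and fg: "(f, g) \<in> \<F>" for w1 w2 f g
  proof -
    note [measurable] = A1_measurable[OF w1] A1_measurable[OF w2]
    have [measurable]: "f \<in> borel_measurable M" "g \<in> borel_measurable M"
      using fam fg by (auto simp: extrapolation_family_def)
    define W where "W x = ennreal (w1 x * w2 x powr - a)" for x
    have [measurable]: "W \<in> borel_measurable M" unfolding W_def[abs_def] by measurable
    have W: "W \<in> Ap M \<B> r" "Ap_const M \<B> r W \<le> ennreal (K powr r)"
      using A1_factor_in_Ap[OF w1 w2 r(1)] K unfolding W_def[abs_def] r(2) by auto
    have inf: "W \<in> Ainf M \<B>" using W(1) r by (auto simp: Ainf_def)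
    have up: "Ainf_const M \<B> W \<le> ennreal (K powr r)"
      unfolding Ainf_const_def using W r by (intro INF_lower2[of r]) auto
    have low: "1 \<le> Ainf_const M \<B> W"
      unfolding Ainf_const_def by (intro INF_greatest) (auto intro: Ap_const_ge_one)
    obtain b where b: "Ainf_const M \<B> W = ennreal b" "0 \<le> b" using up by (cases "Ainf_const M \<B> W") (auto simp: top_unique)
    have "\<Psi> b \<le> c"
      unfolding c_def using up low b Kr by (intro mono_onD[OF \<Psi>(2)]) (auto simp: ennreal_le_iff)
    moreover have "Lp_norm (density M W) p f \<le> ennreal (\<Psi> b) * Lp_norm (density M W) p g"
      using hyp inf fg b by fastforce
    ultimately have le: "Lp_norm (density M W) p f \<le> ennreal c * Lp_norm (density M W) p g"
      by (meson ennreal_leI mult_right_mono order_trans zero_le)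
    have norm: "Lp_norm (density M W) p h epowr p = (\<integral>\<^sup>+x. h x epowr p * W x \<partial>M)"
      if [measurable]: "h \<in> borel_measurable M" for h
    proof -
      have "(\<integral>\<^sup>+x. h x epowr p \<partial>density M W) = (\<integral>\<^sup>+x. h x epowr p * W x \<partial>M)"
        by (subst nn_integral_density) (auto simp: mult.commute)
      then show ?thesis using p by (simp add: Lp_norm_def epowr_epowr epowr_one)
    qed
    have "Lp_norm (density M W) p f epowr p \<le> (ennreal c * Lp_norm (density M W) p g) epowr p"
      by (intro epowr_mono le p)
    then show ?thesis
      using c p by (simp add: epowr_mult norm epowr_ennreal W_def)
  qed
  moreover have "1 \<le> c powr p" using c p by (intro ge_one_powr_ge_zero) auto
  ultimately show "\<exists>C\<ge>1. \<forall>w1 w2 f g. A1 K w1 \<longrightarrow> A1 K w2 \<longrightarrow> (f, g) \<in> \<F> \<longrightarrow>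
    (\<integral>\<^sup>+x. f x epowr p * ennreal (w1 x * w2 x powr - a) \<partial>M)
      \<le> ennreal C * (\<integral>\<^sup>+x. g x epowr p * ennreal (w1 x * w2 x powr - a) \<partial>M)"
    by blast
qed simp

section \<open>Families of sequence-valued functions\<close>

definition lq_family :: "real \<Rightarrow> (('a \<Rightarrow> ennreal) \<times> ('a \<Rightarrow> ennreal)) set \<Rightarrow> (('a \<Rightarrow> ennreal) \<times> ('a \<Rightarrow> ennreal)) set" where
  "lq_family q \<F> = {(\<lambda>x. (\<Sum>\<^sub>\<infinity>j\<in>J. f j x epowr q) epowr (1 / q), \<lambda>x. (\<Sum>\<^sub>\<infinity>j\<in>J. g j x epowr q) epowr (1 / q)) |
    (J :: nat set) f g. \<forall>j\<in>J. (f j, g j) \<in> \<F>}"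

lemma lq_sum_measurable:
  assumes "\<And>j. j \<in> J \<Longrightarrow> f j \<in> borel_measurable M"
  shows "(\<lambda>x. \<Sum>\<^sub>\<infinity>j\<in>(J::nat set). f j x epowr q) \<in> borel_measurable M"
proof -
  have "(\<lambda>x. if j \<in> J then f j x epowr q else 0) \<in> borel_measurable M" for j
    using assms by (cases "j \<in> J") auto
  then show ?thesis by (simp add: infsum_ennreal_nat)
qed

lemma lq_sum_integral:
  assumes "\<And>j. j \<in> J \<Longrightarrow> f j \<in> borel_measurable M" and [measurable]: "W \<in> borel_measurable M"
  shows "(\<integral>\<^sup>+x. (\<Sum>\<^sub>\<infinity>j\<in>(J::nat set). f j x epowr q) * ennreal (W x) \<partial>M)
    = (\<Sum>j. if j \<in> J then \<integral>\<^sup>+x. f j x epowr q * ennreal (W x) \<partial>M else 0)"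
proof -
  have m: "(\<lambda>x. (if j \<in> J then f j x epowr q else 0) * ennreal (W x)) \<in> borel_measurable M" for j
    using assms(1) by (cases "j \<in> J") auto
  have "(\<integral>\<^sup>+x. (\<Sum>\<^sub>\<infinity>j\<in>J. f j x epowr q) * ennreal (W x) \<partial>M)
      = (\<integral>\<^sup>+x. (\<Sum>j. (if j \<in> J then f j x epowr q else 0) * ennreal (W x)) \<partial>M)"
    by (simp add: infsum_ennreal_nat)
  also have "\<dots> = (\<Sum>j. \<integral>\<^sup>+x. (if j \<in> J then f j x epowr q else 0) * ennreal (W x) \<partial>M)"
    by (rule nn_integral_suminf[OF m])
  also have "\<dots> = (\<Sum>j. if j \<in> J then \<integral>\<^sup>+x. f j x epowr q * ennreal (W x) \<partial>M else 0)"
    by (intro suminf_cong) auto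
  finally show ?thesis .
qed

lemma extrapolation_family_lq:
  assumes "extrapolation_family M \<F>"
  shows "extrapolation_family M (lq_family q \<F>)"
  using assms unfolding extrapolation_family_def lq_family_def
  by (fastforce intro!: epowr_measurable lq_sum_measurable)

text \<open>
  At the exponent \<open>q\<close> the integrals of the \<open>\<ell>\<^sup>q\<close> sums are sums over \<open>j\<close> of integrals, so the
  inequalities for the single pairs add up.
\<close>

lemma extrapolation_bound_lq:
  assumes E: "extrapolation_bound \<F> q" and fam: "extrapolation_family M \<F>" and q: "0 < q"
  shows "extrapolation_bound (lq_family q \<F>) q"
proof -
  have "(\<integral>\<^sup>+x. F x epowr q * ennreal (W x) \<partial>M) \<le> ennreal C * (\<integral>\<^sup>+x. G x epowr q * ennreal (W x) \<partial>M)"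
    if FG: "(F, G) \<in> lq_family q \<F>" and [measurable]: "W \<in> borel_measurable M"
      and le: "\<And>f g. (f, g) \<in> \<F> \<Longrightarrow>
        (\<integral>\<^sup>+x. f x epowr q * ennreal (W x) \<partial>M) \<le> ennreal C * (\<integral>\<^sup>+x. g x epowr q * ennreal (W x) \<partial>M)"
    for F G W C
  proof -
    obtain J :: "nat set" and f g where J: "\<And>j. j \<in> J \<Longrightarrow> (f j, g j) \<in> \<F>"
      and F: "F = (\<lambda>x. (\<Sum>\<^sub>\<infinity>j\<in>J. f j x epowr q) epowr (1 / q))"
      and G: "G = (\<lambda>x. (\<Sum>\<^sub>\<infinity>j\<in>J. g j x epowr q) epowr (1 / q))"
      using FG unfolding lq_family_def by blast
    have m: "f j \<in> borel_measurable M" "g j \<in> borel_measurable M" if "j \<in> J" for j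
      using fam J[OF that] by (auto simp: extrapolation_family_def)
    have "(\<integral>\<^sup>+x. F x epowr q * ennreal (W x) \<partial>M) = (\<Sum>j. if j \<in> J then \<integral>\<^sup>+x. f j x epowr q * ennreal (W x) \<partial>M else 0)"
      unfolding F using q m by (simp add: epowr_epowr epowr_one lq_sum_integral)
    also have "\<dots> \<le> (\<Sum>j. ennreal C * (if j \<in> J then \<integral>\<^sup>+x. g j x epowr q * ennreal (W x) \<partial>M else 0))"
      by (intro suminf_le) (auto intro: le J)
    also have "\<dots> = ennreal C * (\<integral>\<^sup>+x. G x epowr q * ennreal (W x) \<partial>M)"
      unfolding G using q m by (simp add: epowr_epowr epowr_one lq_sum_integral)
    finally show ?thesis .
  qed
  note key = this
  obtain a0 where a0: "0 < a0" and E': "\<And>a K. a0 \<le> a \<Longrightarrow> 1 \<le> K \<Longrightarrow> \<exists>C\<ge>1. \<forall>w1 w2 f g.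
    A1 K w1 \<longrightarrow> A1 K w2 \<longrightarrow> (f, g) \<in> \<F> \<longrightarrow>
    (\<integral>\<^sup>+x. f x epowr q * ennreal (w1 x * w2 x powr - a) \<partial>M)
      \<le> ennreal C * (\<integral>\<^sup>+x. g x epowr q * ennreal (w1 x * w2 x powr - a) \<partial>M)"
    using E unfolding extrapolation_bound_def by blast
  show ?thesis
    unfolding extrapolation_bound_def
  proof (rule exI[of _ a0], intro conjI allI impI a0)
    fix a K :: real assume "a0 \<le> a" "1 \<le> K"
    then obtain C where C: "1 \<le> C" "\<And>w1 w2 f g. A1 K w1 \<Longrightarrow> A1 K w2 \<Longrightarrow> (f, g) \<in> \<F> \<Longrightarrow>
      (\<integral>\<^sup>+x. f x epowr q * ennreal (w1 x * w2 x powr - a) \<partial>M)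
        \<le> ennreal C * (\<integral>\<^sup>+x. g x epowr q * ennreal (w1 x * w2 x powr - a) \<partial>M)"
      using E' by blast
    show "\<exists>C\<ge>1. \<forall>w1 w2 F G. A1 K w1 \<longrightarrow> A1 K w2 \<longrightarrow> (F, G) \<in> lq_family q \<F> \<longrightarrow>
      (\<integral>\<^sup>+x. F x epowr q * ennreal (w1 x * w2 x powr - a) \<partial>M)
        \<le> ennreal C * (\<integral>\<^sup>+x. G x epowr q * ennreal (w1 x * w2 x powr - a) \<partial>M)"
    proof (intro exI[of _ C] conjI allI impI C(1))
      fix w1 w2 F G assume w: "A1 K w1" "A1 K w2" and FG: "(F, G) \<in> lq_family q \<F>"
      note [measurable] = A1_measurable[OF w(1)] A1_measurable[OF w(2)]
      show "(\<integral>\<^sup>+x. F x epowr q * ennreal (w1 x * w2 x powr - a) \<partial>M)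
        \<le> ennreal C * (\<integral>\<^sup>+x. G x epowr q * ennreal (w1 x * w2 x powr - a) \<partial>M)"
        by (rule key[OF FG _ C(2)[OF w]]) auto
    qed
  qed
qed

section \<open>Modular inequalities for general Young functions\<close>

lemma weight_real_version:
  assumes "weight M w"
  obtains r where "r \<in> borel_measurable M" "\<And>x. 0 < r x" "AE x in M. w x = ennreal (r x)"
proof
  let ?r = "\<lambda>x. if 0 < w x \<and> w x < \<infinity> then enn2real (w x) else 1"
  have [measurable]: "w \<in> borel_measurable M" and "AE x in M. 0 < w x \<and> w x < \<infinity>"
    using assms by (auto simp: weight_def)
  show "?r \<in> borel_measurable M" by measurable
  show "0 < ?r x" for x by (auto simp: enn2real_positive_iff less_top)
  show "AE x in M. w x = ennreal (?r x)"
    using \<open>AE x in M. 0 < w x \<and> w x < \<infinity>\<close> by eventually_elim simp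
qed

text \<open>
  The function \<open>c 1\<^sub>B / v\<close> is dominated by its own dual maximal function, since \<open>c\<close> is the average of \<open>c 1\<^sub>B\<close> over
  \<open>B\<close>. So its modular is at most \<open>\<N>\<close> times itself, and it remains to find a positive \<open>c\<close> for which the modular is finite. This
  holds for the average of \<open>u v\<close>, because then \<open>c / v\<close> is dominated on \<open>B\<close> by the dual maximal function of \<open>u 1\<^sub>B\<close>,
  whose modular is a multiple of \<open>v(B)\<close>.
\<close>

lemma dual_maximal_constant_ge_one:
  fixes u v :: "'a \<Rightarrow> ennreal"
  assumes u: "weight M u" and v: "weight M v"
    and v_fin: "\<forall>B\<in>\<B>. (\<integral>\<^sup>+x\<in>B. v x \<partial>M) < \<infinity>"
    and yp: "young_pair \<Phi> \<Phi>c" and pos_c: "\<And>t. 0 < t \<Longrightarrow> 0 < \<Phi>c t"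
    and hyp: "\<forall>h::'a \<Rightarrow> real. h \<in> borel_measurable M \<longrightarrow>
      (\<integral>\<^sup>+x. extend_inf \<Phi>c (dual_maximal M \<B> v (\<lambda>y. ennreal \<bar>h y\<bar>) x * inverse (u x)) * v x \<partial>M)
      \<le> ennreal \<N> * (\<integral>\<^sup>+x. extend_inf \<Phi>c (ennreal \<bar>h x\<bar> * inverse (u x)) * v x \<partial>M)"
  shows "1 \<le> \<N>"
proof -
  interpret young_pair \<Phi> \<Phi>c by fact
  note [measurable] = extend_inf_measurable[OF mono_c]
  have [measurable]: "u \<in> borel_measurable M" "v \<in> borel_measurable M"
    using u v by (auto simp: weight_def)
  obtain ur where ur[measurable]: "ur \<in> borel_measurable M" and up: "\<And>x. 0 < ur x"
    and ue: "AE x in M. u x = ennreal (ur x)" using weight_real_version[OF u] by metis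
  obtain vr where vr[measurable]: "vr \<in> borel_measurable M" and vp: "\<And>x. 0 < vr x"
    and ve: "AE x in M. v x = ennreal (vr x)" using weight_real_version[OF v] by metis
  obtain B where B: "B \<in> \<B>" using basis_nonempty by blast
  have Bs[measurable]: "B \<in> sets M" by (rule basis_sets[OF B])
  have nontriv: "\<not> (AE x in M. x \<in> B \<longrightarrow> False)"
    using prob_space.AE_False[OF prob_space_on_basis[OF B]] AE_on_basis_iff[OF B, of "\<lambda>_. False"] by simp
  have zero_c: "\<Phi>c 0 = 0"
    using shrink[of "1/2" 0] nonneg_c[of 0] by simp
  define I where "I h = (\<integral>\<^sup>+x. extend_inf \<Phi>c (ennreal \<bar>h x\<bar> * inverse (u x)) * v x \<partial>M)" for h :: "'a \<Rightarrow> real"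
  define J where "J c = (\<integral>\<^sup>+x. extend_inf \<Phi>c (c * ennreal (1 / (vr x * ur x))) * ennreal (vr x) * indicator B x \<partial>M)" for c
  have lower: "J (average M B (\<lambda>y. ennreal \<bar>h y\<bar> * v y)) \<le> ennreal \<N> * I h" if [measurable]: "h \<in> borel_measurable M" for h
  proof -
    let ?c = "average M B (\<lambda>y. ennreal \<bar>h y\<bar> * v y)"
    have "J ?c \<le> (\<integral>\<^sup>+x. extend_inf \<Phi>c (dual_maximal M \<B> v (\<lambda>y. ennreal \<bar>h y\<bar>) x * inverse (u x)) * v x \<partial>M)"
      unfolding J_def
    proof (rule nn_integral_mono_AE)
      show "AE x in M. extend_inf \<Phi>c (?c * ennreal (1 / (vr x * ur x))) * ennreal (vr x) * indicator B x
          \<le> extend_inf \<Phi>c (dual_maximal M \<B> v (\<lambda>y. ennreal \<bar>h y\<bar>) x * inverse (u x)) * v x"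
        using ue ve
      proof eventually_elim
        case (elim x)
        show ?case
        proof (cases "x \<in> B")
          case True
          have "?c \<le> maximal M \<B> (\<lambda>y. ennreal \<bar>h y\<bar> * v y) x"
            unfolding maximal_def using B True by (intro SUP_upper) auto
          then have "?c * ennreal (1 / (vr x * ur x)) \<le> dual_maximal M \<B> v (\<lambda>y. ennreal \<bar>h y\<bar>) x * inverse (u x)"
            unfolding dual_maximal_def elim using up[of x] vp[of x]
            by (simp add: divide_ennreal_def inverse_ennreal mult.assoc inverse_eq_divide mult_right_mono flip: ennreal_mult')
          then show ?thesis
            using True elim by (simp add: mult_right_mono extend_inf_mono[OF mono_c])
        qed simp
      qed
    qed
    also have "\<dots> \<le> ennreal \<N> * I h" unfolding I_def using hyp that by blast
    finally show ?thesis .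
  qed
  \<comment> \<open>\<open>u 1\<^sub>B\<close> determines a constant \<open>c0\<close> for which \<open>J c0\<close> is finite\<close>
  define h0 where "h0 x = ur x * indicator B x" for x
  have [measurable]: "h0 \<in> borel_measurable M" unfolding h0_def[abs_def] by measurable
  define c0 where "c0 = average M B (\<lambda>y. ennreal \<bar>h0 y\<bar> * v y)"
  have "I h0 = (\<integral>\<^sup>+x. ennreal (\<Phi>c 1) * (v x * indicator B x) \<partial>M)"
    unfolding I_def
  proof (rule nn_integral_cong_AE)
    show "AE x in M. extend_inf \<Phi>c (ennreal \<bar>h0 x\<bar> * inverse (u x)) * v x = ennreal (\<Phi>c 1) * (v x * indicator B x)"
      using ue
    proof eventually_elim
      case (elim x)
      have "ennreal \<bar>h0 x\<bar> * inverse (u x) = indicator B x"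
        using elim up[of x] by (auto simp: h0_def indicator_def inverse_ennreal abs_of_pos simp flip: ennreal_mult')
      moreover have "extend_inf \<Phi>c (indicator B x) = ennreal (\<Phi>c 1) * indicator B x"
        using extend_inf_ennreal[of 1 \<Phi>c] extend_inf_ennreal[of 0 \<Phi>c] zero_c by (simp add: indicator_def)
      ultimately show ?case by (simp add: mult_ac)
    qed
  qed
  also have "\<dots> = ennreal (\<Phi>c 1) * (\<integral>\<^sup>+x\<in>B. v x \<partial>M)" by (rule nn_integral_cmult) measurable
  also have "\<dots> < \<infinity>" using v_fin B by (simp add: ennreal_mult_less_top)
  finally have I0: "I h0 < \<infinity>" .
  have J_fin: "J c0 < \<infinity>"
    using lower[of h0] I0 by (auto simp: c0_def ennreal_mult_less_top intro: le_less_trans)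
  have c0_fin: "c0 \<noteq> \<infinity>"
  proof
    assume c0: "c0 = \<infinity>"
    have "AE x in M. extend_inf \<Phi>c (c0 * ennreal (1 / (vr x * ur x))) * ennreal (vr x) * indicator B x \<noteq> \<infinity>"
      using J_fin unfolding J_def by (intro nn_integral_PInf_AE) auto
    then have "AE x in M. x \<in> B \<longrightarrow> False"
    proof eventually_elim
      case (elim x)
      show ?case
      proof
        assume x: "x \<in> B"
        have "c0 * ennreal (1 / (vr x * ur x)) = top" using up[of x] vp[of x] c0 by (simp add: ennreal_top_mult)
        then show False using elim x vp[of x] by (simp add: ennreal_top_mult)
      qed
    qed
    then show False using nontriv by simp
  qed
  have c0_pos: "c0 \<noteq> 0"
  proof
    assume "c0 = 0"
    then have "AE x in uniform_measure M B. ennreal \<bar>h0 x\<bar> * v x = 0"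
      unfolding c0_def using B by (simp add: average_eq_nn_integral basis_sets nn_integral_0_iff_AE)
    then have "AE x in M. x \<in> B \<longrightarrow> ennreal \<bar>h0 x\<bar> * v x = 0" using AE_on_basis_iff[OF B] by simp
    with ve have "AE x in M. x \<in> B \<longrightarrow> False"
    proof eventually_elim
      case (elim x)
      show ?case
      proof
        assume "x \<in> B"
        then have "ennreal (ur x) * ennreal (vr x) = 0" using elim up[of x] by (simp add: h0_def)
        then show False using up[of x] vp[of x] by simp
      qed
    qed
    then show False using nontriv by simp
  qed
  obtain c where c: "c0 = ennreal c" "0 < c" using c0_fin c0_pos by (cases c0) (auto simp: less_le)
  define h1 where "h1 x = c / vr x * indicator B x" for x
  have [measurable]: "h1 \<in> borel_measurable M" unfolding h1_def[abs_def] by measurable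
  have "average M B (\<lambda>y. ennreal \<bar>h1 y\<bar> * v y) = average M B (\<lambda>_. ennreal c)"
  proof (rule average_cong[OF B])
    show "AE x in M. x \<in> B \<longrightarrow> ennreal \<bar>h1 x\<bar> * v x = ennreal c"
      using ve
    proof eventually_elim
      case (elim x)
      show ?case using elim vp[of x] c(2) by (simp add: h1_def flip: ennreal_mult')
    qed
  qed auto
  then have avg1: "average M B (\<lambda>y. ennreal \<bar>h1 y\<bar> * v y) = c0" using B c by (simp add: average_const)
  have I1: "I h1 = J c0"
    unfolding I_def J_def
  proof (rule nn_integral_cong_AE)
    show "AE x in M. extend_inf \<Phi>c (ennreal \<bar>h1 x\<bar> * inverse (u x)) * v x
        = extend_inf \<Phi>c (c0 * ennreal (1 / (vr x * ur x))) * ennreal (vr x) * indicator B x"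
      using ue ve
    proof eventually_elim
      case (elim x)
      show ?case
      proof (cases "x \<in> B")
        case True
        have "ennreal \<bar>h1 x\<bar> * inverse (u x) = c0 * ennreal (1 / (vr x * ur x))"
          using True elim up[of x] vp[of x] c by (simp add: h1_def inverse_ennreal divide_inverse flip: ennreal_mult')
        then show ?thesis using True elim by simp
      next
        case False
        then show ?thesis using extend_inf_ennreal[of 0 \<Phi>c] zero_c by (simp add: h1_def)
      qed
    qed
  qed
  have J_pos: "J c0 \<noteq> 0"
  proof
    assume "J c0 = 0"
    then have "AE x in M. extend_inf \<Phi>c (c0 * ennreal (1 / (vr x * ur x))) * ennreal (vr x) * indicator B x = 0"
      unfolding J_def by (subst (asm) nn_integral_0_iff_AE) auto
    then have "AE x in M. x \<in> B \<longrightarrow> False"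
    proof eventually_elim
      case (elim x)
      show ?case
      proof
        assume x: "x \<in> B"
        have y: "0 < c / (vr x * ur x)" using c up[of x] vp[of x] by simp
        have "c0 * ennreal (1 / (vr x * ur x)) = ennreal (c / (vr x * ur x))"
          using c up[of x] vp[of x] by (simp flip: ennreal_mult')
        then show False
          using elim x vp[of x] pos_c[OF y] y by (simp add: extend_inf_ennreal)
      qed
    qed
    then show False using nontriv by simp
  qed
  have "J c0 \<le> ennreal \<N> * J c0" using lower[of h1] by (simp add: avg1 I1)
  then have "J c0 * 1 \<le> J c0 * ennreal \<N>" by (simp add: mult.commute)
  then have "1 \<le> ennreal \<N>" using J_pos J_fin by (subst (asm) ennreal_mult_le_mult_iff) auto
  then show ?thesis by simp
qed

text \<open>
  The hypothesis concerns real functions and the pointwise operator. A function with finite modular is finite almost everywhere, and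
  the essential operator is dominated by the pointwise one, so the hypothesis supplies the bound that
  \<open>modular_extrapolation\<close> asks for.
\<close>

lemma modular_inequality:
  fixes u v :: "'a \<Rightarrow> ennreal"
  assumes u: "weight M u" and v: "weight M v"
    and yp: "young_pair \<Phi> \<Phi>c" and delta: "Delta2 \<Phi>" and N: "1 \<le> \<N>"
    and hyp: "\<forall>h::'a \<Rightarrow> real. h \<in> borel_measurable M \<longrightarrow>
      (\<integral>\<^sup>+x. extend_inf \<Phi>c (dual_maximal M \<B> v (\<lambda>y. ennreal \<bar>h y\<bar>) x * inverse (u x)) * v x \<partial>M)
      \<le> ennreal \<N> * (\<integral>\<^sup>+x. extend_inf \<Phi>c (ennreal \<bar>h x\<bar> * inverse (u x)) * v x \<partial>M)"
    and E: "extrapolation_bound \<F> p" and fam: "extrapolation_family M \<F>"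
  shows "\<exists>C::real. 0 \<le> C \<and> (\<forall>(f, g)\<in>\<F>.
    (\<integral>\<^sup>+x. extend_inf \<Phi> (f x epowr p * u x) * v x \<partial>M)
      \<le> ennreal C * (\<integral>\<^sup>+x. extend_inf \<Phi> (g x epowr p * u x) * v x \<partial>M))"
proof -
  interpret young_pair \<Phi> \<Phi>c by fact
  note [measurable] = extend_inf_measurable[OF mono_c] extend_inf_measurable[OF mono]
  have [measurable]: "u \<in> borel_measurable M" "v \<in> borel_measurable M"
    using u v by (auto simp: weight_def)
  obtain ur where ur[measurable]: "ur \<in> borel_measurable M" and up: "\<And>x. 0 < ur x"
    and ue: "AE x in M. u x = ennreal (ur x)" using weight_real_version[OF u] by metis
  obtain vr where vr[measurable]: "vr \<in> borel_measurable M" and vp: "\<And>x. 0 < vr x"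
    and ve: "AE x in M. v x = ennreal (vr x)" using weight_real_version[OF v] by metis
  have inv: "y / ennreal (vr x) * inverse (ennreal (ur x)) = y * ennreal (1 / (vr x * ur x))" for x y
    using up[of x] vp[of x]
    by (simp add: divide_ennreal_def inverse_ennreal mult.assoc inverse_eq_divide flip: ennreal_mult')
  have step: "(\<integral>\<^sup>+x. extend_inf \<Phi>c (ess_maximal m x * ennreal (1 / (vr x * ur x))) * ennreal (vr x) \<partial>M)
      \<le> ennreal \<N> * (\<integral>\<^sup>+x. extend_inf \<Phi>c (m x * ennreal (1 / (vr x * ur x))) * ennreal (vr x) \<partial>M)"
    if [measurable]: "m \<in> borel_measurable M" for m
  proof (cases "(\<integral>\<^sup>+x. extend_inf \<Phi>c (m x * ennreal (1 / (vr x * ur x))) * ennreal (vr x) \<partial>M) = \<infinity>")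
    case True
    then show ?thesis using N by (simp add: ennreal_mult_top)
  next
    case False
    then have "AE x in M. extend_inf \<Phi>c (m x * ennreal (1 / (vr x * ur x))) * ennreal (vr x) \<noteq> \<infinity>"
      by (intro nn_integral_PInf_AE) auto
    then have m_fin: "AE x in M. m x \<noteq> top"
    proof eventually_elim
      case (elim x)
      show ?case
      proof
        assume "m x = top"
        then have "m x * ennreal (1 / (vr x * ur x)) = top" using up[of x] vp[of x] by (simp add: ennreal_top_mult)
        then show False using elim vp[of x] by (simp add: ennreal_top_mult)
      qed
    qed
    define h where "h x = enn2real (m x) / vr x" for x
    have [measurable]: "h \<in> borel_measurable M" unfolding h_def[abs_def] by measurable
    have h0: "\<bar>h x\<bar> = h x" for x using vp[of x] by (simp add: h_def)
    have hv: "AE x in M. m x = ennreal \<bar>h x\<bar> * v x"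
      using m_fin ve
    proof eventually_elim
      case (elim x)
      have "ennreal (h x) * ennreal (vr x) = ennreal (enn2real (m x))"
        using vp[of x] by (simp add: h_def flip: ennreal_mult'')
      then show ?case using elim by (simp add: h0 less_top)
    qed
    have "(\<integral>\<^sup>+x. extend_inf \<Phi>c (ess_maximal m x * ennreal (1 / (vr x * ur x))) * ennreal (vr x) \<partial>M)
        \<le> (\<integral>\<^sup>+x. extend_inf \<Phi>c (dual_maximal M \<B> v (\<lambda>y. ennreal \<bar>h y\<bar>) x * inverse (u x)) * v x \<partial>M)"
    proof (rule nn_integral_mono_AE)
      show "AE x in M. extend_inf \<Phi>c (ess_maximal m x * ennreal (1 / (vr x * ur x))) * ennreal (vr x)
          \<le> extend_inf \<Phi>c (dual_maximal M \<B> v (\<lambda>y. ennreal \<bar>h y\<bar>) x * inverse (u x)) * v x"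
        using ue ve
      proof eventually_elim
        case (elim x)
        have "ess_maximal m x \<le> maximal M \<B> (\<lambda>y. ennreal \<bar>h y\<bar> * v y) x"
          using hv by (intro ess_maximal_le_maximal) auto
        then show ?case
          unfolding dual_maximal_def elim inv
          by (intro mult_right_mono extend_inf_mono[OF mono_c]) auto
      qed
    qed
    also have "\<dots> \<le> ennreal \<N> * (\<integral>\<^sup>+x. extend_inf \<Phi>c (ennreal \<bar>h x\<bar> * inverse (u x)) * v x \<partial>M)"
      using hyp by simp
    also have "(\<integral>\<^sup>+x. extend_inf \<Phi>c (ennreal \<bar>h x\<bar> * inverse (u x)) * v x \<partial>M)
        = (\<integral>\<^sup>+x. extend_inf \<Phi>c (m x * ennreal (1 / (vr x * ur x))) * ennreal (vr x) \<partial>M)"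
    proof (rule nn_integral_cong_AE)
      show "AE x in M. extend_inf \<Phi>c (ennreal \<bar>h x\<bar> * inverse (u x)) * v x
          = extend_inf \<Phi>c (m x * ennreal (1 / (vr x * ur x))) * ennreal (vr x)"
        using ue ve hv
      proof eventually_elim
        case (elim x)
        have "m x / ennreal (vr x) = ennreal \<bar>h x\<bar>"
          unfolding elim(3) elim(2) using vp[of x] by (simp add: ennreal_mult_divide_eq)
        then show ?case by (simp add: elim(1,2) inv[symmetric])
      qed
    qed
    finally show ?thesis .
  qed
  obtain C where C: "1 \<le> C" "\<And>w f g. A1 (2 * \<N>) w \<Longrightarrow> (f, g) \<in> \<F> \<Longrightarrow>
      (\<integral>\<^sup>+x. f x epowr p * ennreal (w x) \<partial>M) \<le> ennreal C * (\<integral>\<^sup>+x. g x epowr p * ennreal (w x) \<partial>M)"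
    using extrapolation_bound_A1[OF E, of "2 * \<N>"] N by auto
  obtain D where D: "0 \<le> D" "\<And>s. 0 \<le> s \<Longrightarrow> \<Phi> (4 * C * s) \<le> D * \<Phi> s"
    using Delta2_dilation[OF delta yp, of "4 * C"] C(1) by auto
  have "(\<integral>\<^sup>+x. extend_inf \<Phi> (f x epowr p * u x) * v x \<partial>M)
      \<le> ennreal (4 * C * D) * (\<integral>\<^sup>+x. extend_inf \<Phi> (g x epowr p * u x) * v x \<partial>M)"
    if fg: "(f, g) \<in> \<F>" for f g
  proof -
    have [measurable]: "f \<in> borel_measurable M" "g \<in> borel_measurable M"
      using fam fg by (auto simp: extrapolation_family_def)
    have eq: "(\<integral>\<^sup>+x. extend_inf \<Phi> (k x * u x) * v x \<partial>M) = (\<integral>\<^sup>+x. extend_inf \<Phi> (k x * ennreal (ur x)) * ennreal (vr x) \<partial>M)" for k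
      using ue ve by (intro nn_integral_cong_AE) (auto elim!: eventually_elim2)
    show ?thesis
      unfolding eq
      by (rule modular_extrapolation[OF yp N C(1) D ur vr up vp step _ _ C(2)[OF _ fg]]) auto
  qed
  then show ?thesis using C(1) D(1) by (intro exI[of _ "4 * C * D"]) auto
qed

end

theorem theorem4p36:
  fixes M :: "'a measure"
    and \<B> :: "'a set set"
    and \<F> :: "(('a \<Rightarrow> ennreal) \<times> ('a \<Rightarrow> ennreal)) set"
    and u v :: "'a \<Rightarrow> ennreal"
    and \<Phi> \<Psi> :: "real \<Rightarrow> real"
    and \<N> p0 :: real
  assumes "sigma_finite_measure M" and "non_atomic M" and "0 < emeasure M (space M)"
    and "muckenhoupt_basis M \<B>"
    and "extrapolation_family M \<F>"
    and "weight M u" and "weight M v"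
    and "\<forall>B\<in>\<B>. (\<integral>\<^sup>+x\<in>B. v x \<partial>M) < \<infinity>"
    and "young_function \<Phi>" and "Delta2 \<Phi>"
    and "\<forall>h::'a \<Rightarrow> real. h \<in> borel_measurable M \<longrightarrow>
      (\<integral>\<^sup>+x. extend_inf (complementary \<Phi>)
          (dual_maximal M \<B> v (\<lambda>y. ennreal \<bar>h y\<bar>) x * inverse (u x)) * v x \<partial>M)
      \<le> ennreal \<N> *
        (\<integral>\<^sup>+x. extend_inf (complementary \<Phi>) (ennreal \<bar>h x\<bar> * inverse (u x)) * v x \<partial>M)"
    and "\<Psi> \<in> {1..} \<rightarrow> {1..}" and "mono_on {1..} \<Psi>"
    and "0 < p0"
    and "\<forall>w\<in>Ainf M \<B>. \<forall>(f, g)\<in>\<F>.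
      Lp_norm (density M w) p0 f
      \<le> ennreal (\<Psi> (enn2real (Ainf_const M \<B> w))) * Lp_norm (density M w) p0 g"
  shows "(\<forall>p>0. \<exists>C<(\<infinity>::ennreal). \<forall>(f, g)\<in>\<F>.
      (\<integral>\<^sup>+x. extend_inf \<Phi> (f x epowr p * u x) * v x \<partial>M)
      \<le> C * ennreal (\<Psi> (2 * \<N>) powr p) *
        (\<integral>\<^sup>+x. extend_inf \<Phi> (g x epowr p * u x) * v x \<partial>M)) \<and>
    (\<forall>q>0. \<exists>C<(\<infinity>::ennreal). \<forall>(J::nat set) f g. (\<forall>j\<in>J. (f j, g j) \<in> \<F>) \<longrightarrow>
      (\<integral>\<^sup>+x. extend_inf \<Phi> ((\<Sum>\<^sub>\<infinity>j\<in>J. f j x epowr q) epowr (1 / q) * u x) * v x \<partial>M)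
      \<le> C *
        (\<integral>\<^sup>+x. extend_inf \<Phi> ((\<Sum>\<^sub>\<infinity>j\<in>J. g j x epowr q) epowr (1 / q) * u x) * v x \<partial>M))"
proof -
  have "\<B> \<noteq> {}"
  proof
    assume "\<B> = {}"
    then have "space M \<in> null_sets M" using assms(4) by (auto simp: muckenhoupt_basis_def basis_def)
    then show False using assms(3) by auto
  qed
  then interpret muckenhoupt M \<B>
    using assms(1,4) by (simp add: muckenhoupt_def muckenhoupt_axioms_def)
  note yp = young_function_pair[OF assms(9)]
  have N: "1 \<le> \<N>" by (rule dual_maximal_constant_ge_one[OF assms(6-8) yp assms(11)])
  have E: "extrapolation_bound \<F> p" if "0 < p" for p
    by (rule extrapolation_all[OF extrapolation_bound_of_hypothesis[OF assms(12-14,5,15)] assms(5,14) that])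
  note modular = modular_inequality[OF assms(6,7) yp(1) assms(10) N assms(11)]
  show ?thesis
  proof (intro conjI allI impI)
    fix p :: real assume p: "0 < p"
    obtain C :: real where C: "\<forall>(f, g)\<in>\<F>. (\<integral>\<^sup>+x. extend_inf \<Phi> (f x epowr p * u x) * v x \<partial>M)
        \<le> ennreal C * (\<integral>\<^sup>+x. extend_inf \<Phi> (g x epowr p * u x) * v x \<partial>M)"
      using modular[OF E[OF p] assms(5)] by blast
    have "1 \<le> \<Psi> (2 * \<N>)" using assms(12) N by (auto simp: Pi_iff)
    then have "1 \<le> \<Psi> (2 * \<N>) powr p" using p by (intro ge_one_powr_ge_zero) auto
    then have \<Psi>1: "ennreal C * 1 \<le> ennreal C * ennreal (\<Psi> (2 * \<N>) powr p)"
      by (intro mult_left_mono) auto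
    show "\<exists>C<(\<infinity>::ennreal). \<forall>(f, g)\<in>\<F>. (\<integral>\<^sup>+x. extend_inf \<Phi> (f x epowr p * u x) * v x \<partial>M)
      \<le> C * ennreal (\<Psi> (2 * \<N>) powr p) * (\<integral>\<^sup>+x. extend_inf \<Phi> (g x epowr p * u x) * v x \<partial>M)"
    proof (intro exI[of _ "ennreal C"] conjI ballI)
      fix fg assume "fg \<in> \<F>"
      then show "case fg of (f, g) \<Rightarrow> (\<integral>\<^sup>+x. extend_inf \<Phi> (f x epowr p * u x) * v x \<partial>M)
        \<le> ennreal C * ennreal (\<Psi> (2 * \<N>) powr p) * (\<integral>\<^sup>+x. extend_inf \<Phi> (g x epowr p * u x) * v x \<partial>M)"
        using C \<Psi>1 by (cases fg) (fastforce intro: order_trans mult_right_mono)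
    qed simp
  next
    fix q :: real assume q: "0 < q"
    have "extrapolation_bound (lq_family q \<F>) 1"
      by (rule extrapolation_all[OF extrapolation_bound_lq[OF E[OF q] assms(5) q]
            extrapolation_family_lq[OF assms(5)] q]) simp
    then obtain C :: real where C: "\<forall>(f, g)\<in>lq_family q \<F>. (\<integral>\<^sup>+x. extend_inf \<Phi> (f x epowr 1 * u x) * v x \<partial>M)
        \<le> ennreal C * (\<integral>\<^sup>+x. extend_inf \<Phi> (g x epowr 1 * u x) * v x \<partial>M)"
      using modular[OF _ extrapolation_family_lq[OF assms(5)]] by blast
    show "\<exists>C<(\<infinity>::ennreal). \<forall>(J::nat set) f g. (\<forall>j\<in>J. (f j, g j) \<in> \<F>) \<longrightarrow>
      (\<integral>\<^sup>+x. extend_inf \<Phi> ((\<Sum>\<^sub>\<infinity>j\<in>J. f j x epowr q) epowr (1 / q) * u x) * v x \<partial>M)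
      \<le> C * (\<integral>\<^sup>+x. extend_inf \<Phi> ((\<Sum>\<^sub>\<infinity>j\<in>J. g j x epowr q) epowr (1 / q) * u x) * v x \<partial>M)"
    proof (intro exI[of _ "ennreal C"] conjI allI impI)
      fix J :: "nat set" and f g assume "\<forall>j\<in>J. (f j, g j) \<in> \<F>"
      then have "(\<lambda>x. (\<Sum>\<^sub>\<infinity>j\<in>J. f j x epowr q) epowr (1 / q), \<lambda>x. (\<Sum>\<^sub>\<infinity>j\<in>J. g j x epowr q) epowr (1 / q)) \<in> lq_family q \<F>"
        unfolding lq_family_def by blast
      from bspec[OF C this]
      show "(\<integral>\<^sup>+x. extend_inf \<Phi> ((\<Sum>\<^sub>\<infinity>j\<in>J. f j x epowr q) epowr (1 / q) * u x) * v x \<partial>M)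
        \<le> ennreal C * (\<integral>\<^sup>+x. extend_inf \<Phi> ((\<Sum>\<^sub>\<infinity>j\<in>J. g j x epowr q) epowr (1 / q) * u x) * v x \<partial>M)"
        by (simp add: epowr_one)
    qed simp
  qed
qed

end
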